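(* If there exists an integer $N\ge1$ such that the non-degenerate source condition (NDSC) holds, then (for this $N$) $F^\dagger=(\sigma_iu_i\otimes q)_{1\le i\le N}=(u_i^\dagger\otimes q^\dagger)_{1\le i\le N}$ is the unique solution to $$\min_{F\in H^1(\Omega;\mathcal{W})^N}\ \sum_{i=1}^N\|F_i\|_*\quad\text{subject to}\quad\Phi F=z.$$ Moreover, $q^\dagger$ is uniquely determined by $F_i^\dagger$ via the identity $$q^\dagger=\frac{1}{\int_{\partial\Omega}|f_i|^2}\int_{\partial\Omega}F_i^\dagger|_{\partial\Omega}(x,\cdot)\,f_i(x)\,dx .$$
   Context: Let $\Omega\subset\mathbb{R}^d$ ($d\ge2$) be a bounded Lipschitz domain and $\mathcal{W}$ a finite-dimensional subspace of $C(\overline\Omega)$ (real-valued functions), endowed with the $L^2(\Omega)$ inner product. Let $q^\dagger\in\mathcal{W}$ be such that $0$ is not a Dirichlet eigenvalue of $-\Delta+q^\dagger$ on $\Omega$, and assume $\int_\Omega q^\dagger\ne0$ (this number is known). Let $\{f_i\}_{i\ge1}$ be an orthonormal basis of $H^{1/2}(\partial\Omega)$ with every $f_i$ bounded. For each $i$, $u_i^\dagger\in H^1(\Omega)$ is the unique weak solution of $-\Delta u_i^\dagger+q^\dagger u_i^\dagger=0$ in $\Omega$, $u_i^\dagger=f_i$ on $\partial\Omega$. Put $u_i=u_i^\dagger/\|u_i^\dagger\|_{H^1(\Omega)}$, $q=q^\dagger/\|q^\dagger\|_{\mathcal{W}}$, $\sigma_i=\|u_i^\dagger\|_{H^1(\Omega)}\|q^\dagger\|_{\mathcal{W}}$.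 $H^1(\Omega;\mathcal{W})$ is the Hilbert space of $\mathcal{W}$-valued $H^1$ functions, isometrically identified with the space of Hilbert–Schmidt operators $H^1(\Omega)\to\mathcal{W}$: $u\otimes v$ is the function $x\mapsto u(x)v$, identified with the operator $a\mapsto\langle u,a\rangle_{H^1(\Omega)}v$. Through this identification one speaks of the rank, nuclear norm $\|\cdot\|_*$ (sum of singular values, possibly $+\infty$), operator norm $\|\cdot\|$, adjoint, and action on vectors of an element of $H^1(\Omega;\mathcal{W})$. We write $F(x,y)=F(x)(y)$. For $F\in H^1(\Omega;\mathcal{W})$, $F|_{\mathrm{diag}}\in L^2(\Omega)$ is $x\mapsto F(x,x)$. Traces on $\partial\Omega$ of elements of $H^1(\Omega;\mathcal{W})$ are in $L^2(\partial\Omega;\mathcal{W})$. For $F=(F_i)_{1\le i\le N}\in H^1(\Omega;\mathcal{W})^N$, $u_{F_i}\in H^1(\Omega)$ is the weak solution of $\Delta u_{F_i}=F_i|_{\mathrm{diag}}$ in $\Omega$, $u_{F_i}=f_i$ on $\partial\Omega$; $\tilde f_i\in H^1(\Omega)$ is the harmonic extension of $f_i$; $v_{F_i}=u_{F_i}-\tilde f_i\in H^1_0(\Omega)$. The bounded linear operator $\Phi=(\Phi_1,\Phi_2,\Phi_3):H^1(\Omega;\mathcal{W})^N\to\mathcal{H}=H^{-1/2}(\partial\Omega)^N\times H^1(\Omega)^N\times L^2(\partial\Omega;\mathcal{W})^{\binom N2}$ is $$\Phi_1F=(\partial_\nu v_{F_i}|_{\partial\Omega})_{1\le i\le N},\quad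 \Phi_2F=\Big(\int_\Omega F_i(\cdot,y)dy-\Big[\int_\Omega q^\dagger\Big]v_{F_i}\Big)_{1\le i\le N},\quad \Phi_3F=\big(x\mapsto f_j(x)F_i(x)-f_i(x)F_j(x)\big)_{1\le i<j\le N}.$$ $F^\dagger=(u_i^\dagger\otimes q^\dagger)_{1\le i\le N}$ and $z=\Phi F^\dagger=\big((\partial_\nu v_{F_i^\dagger}|_{\partial\Omega})_i,([\int_\Omega q^\dagger]\tilde f_i)_i,0\big)$. (NDSC) (for a given $N$): there exists $H=(H_i)_{1\le i\le N}\in\mathrm{Im}(\Phi^* )$ such that for every $1\le i\le N$, $H_i=u_i\otimes q+W_i$ with $W_iu_i=0$, $W_i^*q=0$ and $\|W_i\|<1$. *)

theory Defs
  imports "HOL-Analysis.Analysis"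
begin

section \<open>Bounded Lipschitz domains and the surface measure of their boundary\<close>

text \<open>
  Locally, up to a rotation, the domain is the strict epigraph of a Lipschitz function
  \<open>\<psi>\<close> of the coordinates orthogonal to the unit vector \<open>e\<close>.
\<close>

definition bounded_lipschitz_domain :: "'a::euclidean_space set \<Rightarrow> bool" where
  "bounded_lipschitz_domain \<Omega> \<longleftrightarrow>
     \<Omega> \<noteq> {} \<and> open \<Omega> \<and> connected \<Omega> \<and> bounded \<Omega> \<and>
     (\<forall>p\<in>frontier \<Omega>. \<exists>r>0. \<exists>e L \<psi>. norm e = 1 \<and> L-lipschitz_on UNIV \<psi> \<and>
        \<Omega> \<inter> ball p r = {x \<in> ball p r. (\<psi> (x - (x \<bullet> e) *\<^sub>R e) :: real) < x \<bullet> e})"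

text \<open>
  The \<open>s\<close>-dimensional Hausdorff measure for \<open>s > 0\<close>, normalised so that it agrees with the
  Euclidean \<open>s\<close>-dimensional volume when \<open>s\<close> is an integer. Covering sets are required to be
  bounded because \<^const>\<open>diameter\<close> is meaningless on unbounded sets.
\<close>

definition hausdorff_pre :: "real \<Rightarrow> real \<Rightarrow> 'a::euclidean_space set \<Rightarrow> ennreal" where
  "hausdorff_pre s \<delta> A =
     (INF U \<in> {U :: nat \<Rightarrow> 'a set. A \<subseteq> (\<Union>j. U j) \<and> (\<forall>j. bounded (U j) \<and> diameter (U j) \<le> \<delta>)}.
        \<Sum>j. ennreal (unit_ball_vol s * (diameter (U j) / 2) powr s))"

definition hausdorff_measure :: "real \<Rightarrow> 'a::euclidean_space measure" where
  "hausdorff_measure s = measure_of UNIV (sets borel) (\<lambda>A. SUP \<delta>\<in>{0<..}. hausdorff_pre s \<delta> A)"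

definition surface_measure :: "'a::euclidean_space set \<Rightarrow> 'a measure" where
  "surface_measure \<Omega> =
     completion (restrict_space (hausdorff_measure (real DIM('a) - 1)) (frontier \<Omega>))"


section \<open>The Sobolev space \<open>H\<^sup>1\<close> and traces\<close>

text \<open>
  Elements of \<open>L\<^sup>2\<close> and Sobolev spaces are represented by functions on the whole space. Their
  values outside \<open>\<Omega>\<close> (or outside the boundary) are irrelevant, and equality is
  almost-everywhere equality.
\<close>

primrec C_diff :: "nat \<Rightarrow> ('a::euclidean_space \<Rightarrow> real) \<Rightarrow> bool" where
  "C_diff 0 \<phi> \<longleftrightarrow> continuous_on UNIV \<phi>"
| "C_diff (Suc k) \<phi> \<longleftrightarrow>
     \<phi> differentiable_on UNIV \<and> (\<forall>v. C_diff k (\<lambda>x. frechet_derivative \<phi> (at x) v))"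

definition smooth :: "('a::euclidean_space \<Rightarrow> real) \<Rightarrow> bool" where
  "smooth \<phi> \<longleftrightarrow> (\<forall>k. C_diff k \<phi>)"

definition grad :: "('a::euclidean_space \<Rightarrow> real) \<Rightarrow> 'a \<Rightarrow> 'a" where
  "grad \<phi> x = (\<Sum>b\<in>Basis. frechet_derivative \<phi> (at x) b *\<^sub>R b)"

definition test_functions :: "'a::euclidean_space set \<Rightarrow> ('a \<Rightarrow> real) set" where
  "test_functions \<Omega> = {\<phi>. smooth \<phi> \<and> (\<exists>K. compact K \<and> K \<subseteq> \<Omega> \<and> (\<forall>x. x \<notin> K \<longrightarrow> \<phi> x = 0))}"

definition square_integrable :: "'a measure \<Rightarrow> ('a \<Rightarrow> 'b::euclidean_space) \<Rightarrow> bool" where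
  "square_integrable M f \<longleftrightarrow> f \<in> borel_measurable M \<and> integrable M (\<lambda>x. (norm (f x))\<^sup>2)"

definition L2_inner :: "'a::euclidean_space set \<Rightarrow> ('a \<Rightarrow> real) \<Rightarrow> ('a \<Rightarrow> real) \<Rightarrow> real" where
  "L2_inner \<Omega> u v = (LINT x|lebesgue_on \<Omega>. u x * v x)"

definition L2_norm :: "'a::euclidean_space set \<Rightarrow> ('a \<Rightarrow> real) \<Rightarrow> real" where
  "L2_norm \<Omega> u = sqrt (L2_inner \<Omega> u u)"

definition is_weak_grad :: "'a::euclidean_space set \<Rightarrow> ('a \<Rightarrow> real) \<Rightarrow> ('a \<Rightarrow> 'a) \<Rightarrow> bool" where
  "is_weak_grad \<Omega> u G \<longleftrightarrow>
     square_integrable (lebesgue_on \<Omega>) G \<and>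
     (\<forall>\<phi>\<in>test_functions \<Omega>.
        (LINT x|lebesgue_on \<Omega>. u x *\<^sub>R grad \<phi> x) = - (LINT x|lebesgue_on \<Omega>. \<phi> x *\<^sub>R G x))"

definition H1 :: "'a::euclidean_space set \<Rightarrow> ('a \<Rightarrow> real) set" where
  "H1 \<Omega> = {u. square_integrable (lebesgue_on \<Omega>) u \<and> (\<exists>G. is_weak_grad \<Omega> u G)}"

definition weak_grad :: "'a::euclidean_space set \<Rightarrow> ('a \<Rightarrow> real) \<Rightarrow> 'a \<Rightarrow> 'a" where
  "weak_grad \<Omega> u = (SOME G. is_weak_grad \<Omega> u G)"

definition grad_inner :: "'a::euclidean_space set \<Rightarrow> ('a \<Rightarrow> real) \<Rightarrow> ('a \<Rightarrow> real) \<Rightarrow> real" where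
  "grad_inner \<Omega> u v = (LINT x|lebesgue_on \<Omega>. weak_grad \<Omega> u x \<bullet> weak_grad \<Omega> v x)"

definition H1_inner :: "'a::euclidean_space set \<Rightarrow> ('a \<Rightarrow> real) \<Rightarrow> ('a \<Rightarrow> real) \<Rightarrow> real" where
  "H1_inner \<Omega> u v = L2_inner \<Omega> u v + grad_inner \<Omega> u v"

definition H1_norm :: "'a::euclidean_space set \<Rightarrow> ('a \<Rightarrow> real) \<Rightarrow> real" where
  "H1_norm \<Omega> u = sqrt (H1_inner \<Omega> u u)"

text \<open>
  The graph of the trace operator from \<open>H\<^sup>1(\<Omega>)\<close> to \<open>L\<^sup>2(\<partial>\<Omega>)\<close>, i.e. of the continuous extension
  of the restriction map \<open>\<phi> \<mapsto> \<phi>|\<partial>\<Omega>\<close>, defined for functions \<open>\<phi>\<close> that are smooth up to the boundary.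
\<close>

definition has_trace :: "'a::euclidean_space set \<Rightarrow> ('a \<Rightarrow> real) \<Rightarrow> ('a \<Rightarrow> real) \<Rightarrow> bool" where
  "has_trace \<Omega> u g \<longleftrightarrow>
     u \<in> H1 \<Omega> \<and> square_integrable (surface_measure \<Omega>) g \<and>
     (\<exists>\<phi>. (\<forall>n::nat. smooth (\<phi> n)) \<and>
          (\<lambda>n. H1_norm \<Omega> (\<lambda>x. \<phi> n x - u x)) \<longlonglongrightarrow> 0 \<and>
          (\<lambda>n. LINT x|surface_measure \<Omega>. (\<phi> n x - g x)\<^sup>2) \<longlonglongrightarrow> 0)"

definition H10 :: "'a::euclidean_space set \<Rightarrow> ('a \<Rightarrow> real) set" where
  "H10 \<Omega> = {u. has_trace \<Omega> u (\<lambda>_. 0)}"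

text \<open>\<open>H\<^sup>1\<^sup>/\<^sup>2(\<partial>\<Omega>)\<close> is the trace space with its quotient norm; inner products come by polarisation.\<close>

definition Hhalf :: "'a::euclidean_space set \<Rightarrow> ('a \<Rightarrow> real) set" where
  "Hhalf \<Omega> = {g. \<exists>u. has_trace \<Omega> u g}"

definition Hhalf_norm :: "'a::euclidean_space set \<Rightarrow> ('a \<Rightarrow> real) \<Rightarrow> real" where
  "Hhalf_norm \<Omega> g = Inf (H1_norm \<Omega> ` {u. has_trace \<Omega> u g})"

definition Hhalf_inner :: "'a::euclidean_space set \<Rightarrow> ('a \<Rightarrow> real) \<Rightarrow> ('a \<Rightarrow> real) \<Rightarrow> real" where
  "Hhalf_inner \<Omega> g h =
     ((Hhalf_norm \<Omega> (\<lambda>x. g x + h x))\<^sup>2 - (Hhalf_norm \<Omega> (\<lambda>x. g x - h x))\<^sup>2) / 4"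

definition Hhalf_orthonormal_basis :: "'a::euclidean_space set \<Rightarrow> (nat \<Rightarrow> 'a \<Rightarrow> real) \<Rightarrow> bool" where
  "Hhalf_orthonormal_basis \<Omega> f \<longleftrightarrow>
     (\<forall>i\<ge>1. f i \<in> Hhalf \<Omega>) \<and>
     (\<forall>i\<ge>1. \<forall>j\<ge>1. Hhalf_inner \<Omega> (f i) (f j) = of_bool (i = j)) \<and>
     (\<forall>g\<in>Hhalf \<Omega>.
        (\<lambda>n. Hhalf_norm \<Omega> (\<lambda>x. g x - (\<Sum>i=1..n. Hhalf_inner \<Omega> g (f i) * f i x))) \<longlonglongrightarrow> 0)"

text \<open>
  \<open>H\<^sup>-\<^sup>1\<^sup>/\<^sup>2(\<partial>\<Omega>)\<close> is the space of bounded linear functionals on \<open>H\<^sup>1\<^sup>/\<^sup>2(\<partial>\<Omega>)\<close>, with the dual norm.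
\<close>

definition Hneghalf :: "'a::euclidean_space set \<Rightarrow> (('a \<Rightarrow> real) \<Rightarrow> real) set" where
  "Hneghalf \<Omega> = {l.
     (\<forall>g\<in>Hhalf \<Omega>. \<forall>h\<in>Hhalf \<Omega>. \<forall>a b. l (\<lambda>x. a * g x + b * h x) = a * l g + b * l h) \<and>
     (\<exists>C. \<forall>g\<in>Hhalf \<Omega>. \<bar>l g\<bar> \<le> C * Hhalf_norm \<Omega> g)}"

definition Hneghalf_norm :: "'a::euclidean_space set \<Rightarrow> (('a \<Rightarrow> real) \<Rightarrow> real) \<Rightarrow> real" where
  "Hneghalf_norm \<Omega> l = Sup {\<bar>l g\<bar> | g. g \<in> Hhalf \<Omega> \<and> Hhalf_norm \<Omega> g \<le> 1}"

definition Hneghalf_inner ::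
    "'a::euclidean_space set \<Rightarrow> (('a \<Rightarrow> real) \<Rightarrow> real) \<Rightarrow> (('a \<Rightarrow> real) \<Rightarrow> real) \<Rightarrow> real" where
  "Hneghalf_inner \<Omega> l m =
     ((Hneghalf_norm \<Omega> (\<lambda>g. l g + m g))\<^sup>2 - (Hneghalf_norm \<Omega> (\<lambda>g. l g - m g))\<^sup>2) / 4"


section \<open>Weak solutions and normal derivatives\<close>

text \<open>\<open>u\<close> is a weak solution of \<open>- \<Delta>u + q u = h\<close> in \<open>\<Omega>\<close>, \<open>u = f\<close> on \<open>\<partial>\<Omega>\<close>.\<close>

definition weak_solution ::
    "'a::euclidean_space set \<Rightarrow> ('a \<Rightarrow> real) \<Rightarrow> ('a \<Rightarrow> real) \<Rightarrow> ('a \<Rightarrow> real) \<Rightarrow> ('a \<Rightarrow> real) \<Rightarrow> bool" where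
  "weak_solution \<Omega> q h f u \<longleftrightarrow>
     has_trace \<Omega> u f \<and>
     (\<forall>v\<in>H10 \<Omega>. grad_inner \<Omega> u v + (LINT x|lebesgue_on \<Omega>. q x * u x * v x) = L2_inner \<Omega> h v)"

definition dirichlet_eigenvalue :: "'a::euclidean_space set \<Rightarrow> ('a \<Rightarrow> real) \<Rightarrow> real \<Rightarrow> bool" where
  "dirichlet_eigenvalue \<Omega> q ev \<longleftrightarrow>
     (\<exists>u. weak_solution \<Omega> q (\<lambda>x. ev * u x) (\<lambda>_. 0) u \<and> \<not> (AE x in lebesgue_on \<Omega>. u x = 0))"

definition weak_laplacian :: "'a::euclidean_space set \<Rightarrow> ('a \<Rightarrow> real) \<Rightarrow> 'a \<Rightarrow> real" where
  "weak_laplacian \<Omega> v = (SOME h. square_integrable (lebesgue_on \<Omega>) h \<and>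
     (\<forall>\<phi>\<in>test_functions \<Omega>. grad_inner \<Omega> v \<phi> = - L2_inner \<Omega> h \<phi>))"

text \<open>
  The normal derivative in \<open>H\<^sup>-\<^sup>1\<^sup>/\<^sup>2(\<partial>\<Omega>)\<close> of \<open>v \<in> H\<^sup>1(\<Omega>)\<close> with \<open>\<Delta>v \<in> L\<^sup>2(\<Omega>)\<close>, given by Green's formula.
\<close>

definition normal_derivative :: "'a::euclidean_space set \<Rightarrow> ('a \<Rightarrow> real) \<Rightarrow> ('a \<Rightarrow> real) \<Rightarrow> real" where
  "normal_derivative \<Omega> v g =
     (let w = (SOME w. has_trace \<Omega> w g)
      in grad_inner \<Omega> v w + L2_inner \<Omega> (weak_laplacian \<Omega> v) w)"


section \<open>The space \<open>H\<^sup>1(\<Omega>;\<W>)\<close> and its operators\<close>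

text \<open>\<open>C(closure \<Omega>)\<close>: functions are extended by zero, so that equality is equality of functions.\<close>

definition C_closure :: "'a::euclidean_space set \<Rightarrow> ('a \<Rightarrow> real) set" where
  "C_closure \<Omega> = {w. continuous_on (closure \<Omega>) w \<and> (\<forall>x. x \<notin> closure \<Omega> \<longrightarrow> w x = 0)}"

definition finite_dim_subspace_C :: "'a::euclidean_space set \<Rightarrow> ('a \<Rightarrow> real) set \<Rightarrow> bool" where
  "finite_dim_subspace_C \<Omega> W \<longleftrightarrow>
     (\<exists>B. finite B \<and> B \<subseteq> C_closure \<Omega> \<and> W = {\<lambda>x. \<Sum>b\<in>B. c b * b x | c. True})"

text \<open>
  A \<open>\<W>\<close>-valued function is a curried function \<open>F x y = F(x)(y)\<close>. As \<open>\<W>\<close> is finite-dimensional and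
  point evaluations at \<open>y \<in> closure \<Omega>\<close> span its dual, \<open>F\<close> is in \<open>H\<^sup>1(\<Omega>;\<W>)\<close> iff all its slices
  \<open>F(\<cdot>,y)\<close> are in \<open>H\<^sup>1(\<Omega>)\<close>, and \<open>\<partial>\<^sub>b F (x)(y)\<close> is the weak derivative of the slice. Since \<open>\<W>\<close> carries
  the \<open>L\<^sup>2(\<Omega>)\<close> inner product, the inner product of \<open>H\<^sup>1(\<Omega>;\<W>)\<close> is the integral over \<open>y\<close> of the
  \<open>H\<^sup>1\<close> inner products of the slices. The same device is used for traces.
\<close>

type_synonym 'a kernel = "'a \<Rightarrow> 'a \<Rightarrow> real"

definition H1W :: "'a::euclidean_space set \<Rightarrow> ('a \<Rightarrow> real) set \<Rightarrow> 'a kernel set" where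
  "H1W \<Omega> W = {F. (\<forall>x\<in>\<Omega>. F x \<in> W) \<and> (\<forall>y\<in>closure \<Omega>. (\<lambda>x. F x y) \<in> H1 \<Omega>)}"

definition H1W_inner :: "'a::euclidean_space set \<Rightarrow> 'a kernel \<Rightarrow> 'a kernel \<Rightarrow> real" where
  "H1W_inner \<Omega> F G = (LINT y|lebesgue_on \<Omega>. H1_inner \<Omega> (\<lambda>x. F x y) (\<lambda>x. G x y))"

definition tensor :: "('a \<Rightarrow> real) \<Rightarrow> ('a \<Rightarrow> real) \<Rightarrow> 'a kernel" where
  "tensor u v = (\<lambda>x y. u x * v y)"

text \<open>
  The operator \<open>H\<^sup>1(\<Omega>) \<rightarrow> \<W>\<close> identified with \<open>F\<close>: the linear extension of
  \<open>u \<otimes> v \<mapsto> (a \<mapsto> \<langle>u, a\<rangle> v)\<close>.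
\<close>

definition op_of :: "'a::euclidean_space set \<Rightarrow> 'a kernel \<Rightarrow> ('a \<Rightarrow> real) \<Rightarrow> 'a \<Rightarrow> real" where
  "op_of \<Omega> F a = (\<lambda>y. H1_inner \<Omega> (\<lambda>x. F x y) a)"

definition adjoint_of :: "'a::euclidean_space set \<Rightarrow> 'a kernel \<Rightarrow> ('a \<Rightarrow> real) \<Rightarrow> 'a \<Rightarrow> real" where
  "adjoint_of \<Omega> F w =
     (SOME a. a \<in> H1 \<Omega> \<and> (\<forall>b\<in>H1 \<Omega>. H1_inner \<Omega> a b = L2_inner \<Omega> w (op_of \<Omega> F b)))"

definition op_norm :: "'a::euclidean_space set \<Rightarrow> 'a kernel \<Rightarrow> real" where
  "op_norm \<Omega> F = Sup {L2_norm \<Omega> (op_of \<Omega> F a) | a. a \<in> H1 \<Omega> \<and> H1_norm \<Omega> a \<le> 1}"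

text \<open>
  \<open>F = \<Sum>k<r. s k (a k \<otimes> v k)\<close> is a singular value decomposition with (positive) singular values
  \<open>s k\<close>, repeated according to multiplicity. As \<open>\<W>\<close> is finite-dimensional, every \<open>F\<close> has finite
  rank, so the decomposition is a finite sum and the nuclear norm is a real number.
\<close>

definition is_svd :: "'a::euclidean_space set \<Rightarrow> ('a \<Rightarrow> real) set \<Rightarrow> 'a kernel \<Rightarrow> nat \<Rightarrow>
    (nat \<Rightarrow> real) \<Rightarrow> (nat \<Rightarrow> 'a \<Rightarrow> real) \<Rightarrow> (nat \<Rightarrow> 'a \<Rightarrow> real) \<Rightarrow> bool" where
  "is_svd \<Omega> W F r s a v \<longleftrightarrow>
     (\<forall>k<r. s k > 0 \<and> a k \<in> H1 \<Omega> \<and> v k \<in> W) \<and>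
     (\<forall>j<r. \<forall>k<r. H1_inner \<Omega> (a j) (a k) = of_bool (j = k)) \<and>
     (\<forall>j<r. \<forall>k<r. L2_inner \<Omega> (v j) (v k) = of_bool (j = k)) \<and>
     (AE x in lebesgue_on \<Omega>. \<forall>y. F x y = (\<Sum>k<r. s k * tensor (a k) (v k) x y))"

definition nuclear_norm :: "'a::euclidean_space set \<Rightarrow> ('a \<Rightarrow> real) set \<Rightarrow> 'a kernel \<Rightarrow> real" where
  "nuclear_norm \<Omega> W F = (THE t. \<exists>r s a v. is_svd \<Omega> W F r s a v \<and> t = (\<Sum>k<r. s k))"

definition has_traceW ::
    "'a::euclidean_space set \<Rightarrow> ('a \<Rightarrow> real) set \<Rightarrow> 'a kernel \<Rightarrow> 'a kernel \<Rightarrow> bool" where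
  "has_traceW \<Omega> W F G \<longleftrightarrow>
     (\<forall>x\<in>frontier \<Omega>. G x \<in> W) \<and> (\<forall>y\<in>closure \<Omega>. has_trace \<Omega> (\<lambda>x. F x y) (\<lambda>x. G x y))"

definition traceW :: "'a::euclidean_space set \<Rightarrow> ('a \<Rightarrow> real) set \<Rightarrow> 'a kernel \<Rightarrow> 'a kernel" where
  "traceW \<Omega> W F = (SOME G. has_traceW \<Omega> W F G)"

definition L2_boundaryW :: "'a::euclidean_space set \<Rightarrow> ('a \<Rightarrow> real) set \<Rightarrow> 'a kernel set" where
  "L2_boundaryW \<Omega> W = {G. (\<forall>x\<in>frontier \<Omega>. G x \<in> W) \<and>
     (\<forall>y\<in>closure \<Omega>. square_integrable (surface_measure \<Omega>) (\<lambda>x. G x y))}"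


section \<open>The measurement operator and its data space\<close>

definition poisson_solution ::
    "'a::euclidean_space set \<Rightarrow> ('a \<Rightarrow> real) \<Rightarrow> 'a kernel \<Rightarrow> 'a \<Rightarrow> real" where
  "poisson_solution \<Omega> f F = (SOME u. weak_solution \<Omega> (\<lambda>_. 0) (\<lambda>x. - F x x) f u)"

definition harmonic_extension ::
    "'a::euclidean_space set \<Rightarrow> ('a \<Rightarrow> real) \<Rightarrow> 'a \<Rightarrow> real" where
  "harmonic_extension \<Omega> f = (SOME u. weak_solution \<Omega> (\<lambda>_. 0) (\<lambda>_. 0) f u)"

definition vF :: "'a::euclidean_space set \<Rightarrow> ('a \<Rightarrow> real) \<Rightarrow> 'a kernel \<Rightarrow> 'a \<Rightarrow> real" where
  "vF \<Omega> f F = (\<lambda>x. poisson_solution \<Omega> f F x - harmonic_extension \<Omega> f x)"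

text \<open>
  Families indexed by \<open>1 \<le> i \<le> N\<close> (resp. \<open>1 \<le> i < j \<le> N\<close>) are functions of \<open>i\<close> (resp. of
  \<open>i\<close> and \<open>j\<close>) whose values at other indices are irrelevant.
\<close>

type_synonym 'a data =
  "(nat \<Rightarrow> ('a \<Rightarrow> real) \<Rightarrow> real) \<times> (nat \<Rightarrow> 'a \<Rightarrow> real) \<times> (nat \<Rightarrow> nat \<Rightarrow> 'a kernel)"

definition Phi :: "'a::euclidean_space set \<Rightarrow> ('a \<Rightarrow> real) set \<Rightarrow> ('a \<Rightarrow> real) \<Rightarrow>
    (nat \<Rightarrow> 'a \<Rightarrow> real) \<Rightarrow> (nat \<Rightarrow> 'a kernel) \<Rightarrow> 'a data" where
  "Phi \<Omega> W q f F =
     (\<lambda>i. normal_derivative \<Omega> (vF \<Omega> (f i) (F i)),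
      \<lambda>i x. (LINT y|lebesgue_on \<Omega>. F i x y) - (LINT y|lebesgue_on \<Omega>. q y) * vF \<Omega> (f i) (F i) x,
      \<lambda>i j x y. f j x * traceW \<Omega> W (F i) x y - f i x * traceW \<Omega> W (F j) x y)"

definition pairs :: "nat \<Rightarrow> (nat \<times> nat) set" where
  "pairs N = {(i, j). 1 \<le> i \<and> i < j \<and> j \<le> N}"

definition data_space :: "'a::euclidean_space set \<Rightarrow> ('a \<Rightarrow> real) set \<Rightarrow> nat \<Rightarrow> 'a data set" where
  "data_space \<Omega> W N = {(p1, p2, p3).
     (\<forall>i\<in>{1..N}. p1 i \<in> Hneghalf \<Omega> \<and> p2 i \<in> H1 \<Omega>) \<and>
     (\<forall>(i, j)\<in>pairs N. p3 i j \<in> L2_boundaryW \<Omega> W)}"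

definition data_eq :: "'a::euclidean_space set \<Rightarrow> nat \<Rightarrow> 'a data \<Rightarrow> 'a data \<Rightarrow> bool" where
  "data_eq \<Omega> N = (\<lambda>(p1, p2, p3) (z1, z2, z3).
     (\<forall>i\<in>{1..N}. (\<forall>g\<in>Hhalf \<Omega>. p1 i g = z1 i g) \<and> (AE x in lebesgue_on \<Omega>. p2 i x = z2 i x)) \<and>
     (\<forall>(i, j)\<in>pairs N. AE x in surface_measure \<Omega>. p3 i j x = z3 i j x))"

definition data_inner :: "'a::euclidean_space set \<Rightarrow> nat \<Rightarrow> 'a data \<Rightarrow> 'a data \<Rightarrow> real" where
  "data_inner \<Omega> N = (\<lambda>(p1, p2, p3) (z1, z2, z3).
     (\<Sum>i=1..N. Hneghalf_inner \<Omega> (p1 i) (z1 i)) + (\<Sum>i=1..N. H1_inner \<Omega> (p2 i) (z2 i)) +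
     (\<Sum>(i, j)\<in>pairs N. LINT x|surface_measure \<Omega>. L2_inner \<Omega> (p3 i j x) (z3 i j x)))"

definition range_Phi_adjoint :: "'a::euclidean_space set \<Rightarrow> ('a \<Rightarrow> real) set \<Rightarrow> ('a \<Rightarrow> real) \<Rightarrow>
    (nat \<Rightarrow> 'a \<Rightarrow> real) \<Rightarrow> nat \<Rightarrow> (nat \<Rightarrow> 'a kernel) set" where
  "range_Phi_adjoint \<Omega> W q f N = {H. (\<forall>i\<in>{1..N}. H i \<in> H1W \<Omega> W) \<and>
     (\<exists>p\<in>data_space \<Omega> W N. \<forall>F. (\<forall>i\<in>{1..N}. F i \<in> H1W \<Omega> W) \<longrightarrow>
        (\<Sum>i=1..N. H1W_inner \<Omega> (H i) (F i)) = data_inner \<Omega> N p (Phi \<Omega> W q f F))}"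


section \<open>The source condition and the convex program\<close>

text \<open>\<open>q\<close> and \<open>u\<close> are the unnormalised potential and solutions (\<open>q\<^sup>\<dagger>\<close> and \<open>u\<^sub>i\<^sup>\<dagger>\<close>).\<close>

definition normalized_solution :: "'a::euclidean_space set \<Rightarrow> ('a \<Rightarrow> real) \<Rightarrow> 'a \<Rightarrow> real" where
  "normalized_solution \<Omega> u = (\<lambda>x. u x / H1_norm \<Omega> u)"

definition normalized_potential :: "'a::euclidean_space set \<Rightarrow> ('a \<Rightarrow> real) \<Rightarrow> 'a \<Rightarrow> real" where
  "normalized_potential \<Omega> q = (\<lambda>x. q x / L2_norm \<Omega> q)"

definition NDSC :: "'a::euclidean_space set \<Rightarrow> ('a \<Rightarrow> real) set \<Rightarrow> ('a \<Rightarrow> real) \<Rightarrow>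
    (nat \<Rightarrow> 'a \<Rightarrow> real) \<Rightarrow> (nat \<Rightarrow> 'a \<Rightarrow> real) \<Rightarrow> nat \<Rightarrow> bool" where
  "NDSC \<Omega> W q f u N \<longleftrightarrow>
     (\<exists>H\<in>range_Phi_adjoint \<Omega> W q f N. \<forall>i\<in>{1..N}. \<exists>V\<in>H1W \<Omega> W.
        (AE x in lebesgue_on \<Omega>. \<forall>y. H i x y =
           tensor (normalized_solution \<Omega> (u i)) (normalized_potential \<Omega> q) x y + V x y) \<and>
        op_of \<Omega> V (normalized_solution \<Omega> (u i)) = (\<lambda>_. 0) \<and>
        (AE x in lebesgue_on \<Omega>. adjoint_of \<Omega> V (normalized_potential \<Omega> q) x = 0) \<and>
        op_norm \<Omega> V < 1)"

definition feasible :: "'a::euclidean_space set \<Rightarrow> ('a \<Rightarrow> real) set \<Rightarrow> ('a \<Rightarrow> real) \<Rightarrow>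
    (nat \<Rightarrow> 'a \<Rightarrow> real) \<Rightarrow> nat \<Rightarrow> 'a data \<Rightarrow> (nat \<Rightarrow> 'a kernel) \<Rightarrow> bool" where
  "feasible \<Omega> W q f N z F \<longleftrightarrow>
     (\<forall>i\<in>{1..N}. F i \<in> H1W \<Omega> W) \<and> data_eq \<Omega> N (Phi \<Omega> W q f F) z"

definition is_minimizer :: "'a::euclidean_space set \<Rightarrow> ('a \<Rightarrow> real) set \<Rightarrow> ('a \<Rightarrow> real) \<Rightarrow>
    (nat \<Rightarrow> 'a \<Rightarrow> real) \<Rightarrow> nat \<Rightarrow> 'a data \<Rightarrow> (nat \<Rightarrow> 'a kernel) \<Rightarrow> bool" where
  "is_minimizer \<Omega> W q f N z F \<longleftrightarrow>
     feasible \<Omega> W q f N z F \<and>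
     (\<forall>G. feasible \<Omega> W q f N z G \<longrightarrow>
        (\<Sum>i=1..N. nuclear_norm \<Omega> W (F i)) \<le> (\<Sum>i=1..N. nuclear_norm \<Omega> W (G i)))"

definition is_unique_minimizer :: "'a::euclidean_space set \<Rightarrow> ('a \<Rightarrow> real) set \<Rightarrow> ('a \<Rightarrow> real) \<Rightarrow>
    (nat \<Rightarrow> 'a \<Rightarrow> real) \<Rightarrow> nat \<Rightarrow> 'a data \<Rightarrow> (nat \<Rightarrow> 'a kernel) \<Rightarrow> bool" where
  "is_unique_minimizer \<Omega> W q f N z F \<longleftrightarrow>
     is_minimizer \<Omega> W q f N z F \<and>
     (\<forall>G. is_minimizer \<Omega> W q f N z G \<longrightarrow>
        (\<forall>i\<in>{1..N}. AE x in lebesgue_on \<Omega>. G i x = F i x))"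

end

theory Submission
  imports Defs
begin

text \<open>
  Minimality is convex duality: \<open>H\<close> pairs with every feasible \<open>F\<close> to the same number \<open>\<Sum>\<sigma>\<^sub>i\<close>, and
  decomposing \<open>F\<^sub>i\<close> into singular vectors shows that \<open>\<langle>H\<^sub>i, F\<^sub>i\<rangle> \<le> \<parallel>F\<^sub>i\<parallel>\<^sub>*\<close>, with equality only if \<open>F\<^sub>i\<close>
  is a multiple \<open>\<tau>\<^sub>i\<close> of \<open>F\<^sub>i\<^sup>\<dagger>\<close>. To see that \<open>\<tau>\<^sub>i = 1\<close>, keep only the components with a common
  value \<open>\<tau>\<close> of \<open>\<tau>\<^sub>i\<close>, both in the minimiser and in \<open>F\<^sup>\<dagger>\<close>, and replace the others by \<open>0\<close>. By the third
  constraint \<open>f\<^sub>i f\<^sub>j\<close> vanishes on the boundary whenever \<open>\<tau>\<^sub>i \<noteq> \<tau>\<^sub>j\<close>, so both truncations have the same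
  data; pairing them with \<open>H\<close> yields \<open>\<tau> = 1\<close>. This avoids any existence theory for the Poisson problem.

  The analytic input is the uniqueness of weak gradients and of traces. The latter follows from the
  trace inequality for smooth functions, for which the Hausdorff measure of a Lipschitz graph is
  compared with the Lebesgue measure of the slab above it.
\<close>

section \<open>Smooth functions\<close>

text \<open>The direct route to \<open>\<tau> i = 1\<close> would use the second part of the data:
  it makes \<open>\<tau> i - 1\<close> times the i-th solution equal to a difference of two
  functions \<open>vF\<close>, hence an element of \<open>H10\<close> if the Poisson problem is
  solvable. But \<open>vF\<close> and \<open>normal_derivative\<close> are defined by choice, and
  without an existence result nothing is known about the chosen functions. Truncation only uses that
  the first two parts of \<open>Phi\<close> look at each component separately, so that equal
  components have equal data whatever the choices are. The pairing with H depends on the data alone,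
  and on a class C of equal \<tau> it reads: \<tau> times the sum of \<sigma> over C equals that
  sum, which is positive. The same concern shapes the other notions: weak gradients, traces,
  adjoints and the nuclear norm are also given by choice or description, so each is tied to an
  explicit witness together with a uniqueness statement. Since W is finite-dimensional, every kernel
  is a finite sum of tensors, and the singular value decomposition reduces to diagonalising Gram
  matrices.\<close>

lemma C_diff_Suc_imp: "C_diff (Suc k) \<phi> \<Longrightarrow> C_diff k \<phi>"
proof (induction k arbitrary: \<phi>)
  case 0
  then show ?case by (simp add: differentiable_imp_continuous_on)
next
  case (Suc k)
  then show ?case by simp
qed

lemma C_diff_const: "C_diff k (\<lambda>_. c)"
proof (induction k arbitrary: c)
  case (Suc k)
  have "frechet_derivative (\<lambda>_::'a. c) (at x) = (\<lambda>_. 0)" for x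
    by (rule frechet_derivative_at[symmetric]) (rule has_derivative_const)
  then show ?case using Suc by simp
qed simp

lemma C_diff_has_derivative:
  assumes "C_diff (Suc k) \<phi>"
  shows "(\<phi> has_derivative frechet_derivative \<phi> (at x)) (at x)"
  using assms by (simp add: differentiable_on_def flip: frechet_derivative_works)

text \<open>Derivatives on the whole space are unique, so an explicit derivative may replace the
  chosen \<open>frechet_derivative\<close>. Sums, products and \<open>flat_exp\<close> are treated
  by induction on k through this rule.\<close>

lemma C_diff_SucI:
  assumes "\<And>x. (\<phi> has_derivative D x) (at x)" "\<And>v. C_diff k (\<lambda>x. D x v)"
  shows "C_diff (Suc k) \<phi>"
proof -
  have "frechet_derivative \<phi> (at x) = D x" for x
    using frechet_derivative_at[OF assms(1)] by simp
  with assms show ?thesis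
    by (auto simp: differentiable_on_def intro: differentiableI)
qed

lemma C_diff_add: "C_diff k \<phi> \<Longrightarrow> C_diff k \<zeta> \<Longrightarrow> C_diff k (\<lambda>x. \<phi> x + \<zeta> x)"
proof (induction k arbitrary: \<phi> \<zeta>)
  case (Suc k)
  show ?case
  proof (rule C_diff_SucI)
    show "((\<lambda>x. \<phi> x + \<zeta> x) has_derivative
       (\<lambda>v. frechet_derivative \<phi> (at x) v + frechet_derivative \<zeta> (at x) v)) (at x)" for x
      by (intro has_derivative_add C_diff_has_derivative[OF Suc.prems(1)] C_diff_has_derivative[OF Suc.prems(2)])
  qed (use Suc in simp)
qed (simp add: continuous_on_add)

lemma C_diff_mult: "C_diff k \<phi> \<Longrightarrow> C_diff k \<zeta> \<Longrightarrow> C_diff k (\<lambda>x. \<phi> x * \<zeta> x)"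
proof (induction k arbitrary: \<phi> \<zeta>)
  case (Suc k)
  show ?case
  proof (rule C_diff_SucI)
    show "((\<lambda>x. \<phi> x * \<zeta> x) has_derivative
       (\<lambda>v. \<phi> x * frechet_derivative \<zeta> (at x) v + frechet_derivative \<phi> (at x) v * \<zeta> x)) (at x)" for x
      by (intro has_derivative_mult C_diff_has_derivative[OF Suc.prems(1)] C_diff_has_derivative[OF Suc.prems(2)])
    show "C_diff k (\<lambda>x. \<phi> x * frechet_derivative \<zeta> (at x) v + frechet_derivative \<phi> (at x) v * \<zeta> x)" for v
      using Suc C_diff_Suc_imp[of k \<phi>] C_diff_Suc_imp[of k \<zeta>]
      by (intro C_diff_add Suc.IH) auto
  qed
qed (simp add: continuous_on_mult)

lemma smooth_const: "smooth (\<lambda>_. c)"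
  by (simp add: smooth_def C_diff_const)

lemma smooth_add: "smooth \<phi> \<Longrightarrow> smooth \<zeta> \<Longrightarrow> smooth (\<lambda>x. \<phi> x + \<zeta> x)"
  by (simp add: smooth_def C_diff_add)

lemma smooth_mult: "smooth \<phi> \<Longrightarrow> smooth \<zeta> \<Longrightarrow> smooth (\<lambda>x. \<phi> x * \<zeta> x)"
  by (simp add: smooth_def C_diff_mult)

lemma smooth_cmult: "smooth \<phi> \<Longrightarrow> smooth (\<lambda>x. c * \<phi> x)"
  by (intro smooth_mult smooth_const)

lemma smooth_diff: "smooth \<phi> \<Longrightarrow> smooth \<zeta> \<Longrightarrow> smooth (\<lambda>x. \<phi> x - \<zeta> x)"
  using smooth_add[OF _ smooth_cmult[of \<zeta> "-1"]] by simp

lemma smooth_prod: "finite I \<Longrightarrow> (\<And>i. i \<in> I \<Longrightarrow> smooth (\<phi> i)) \<Longrightarrow> smooth (\<lambda>x. \<Prod>i\<in>I. \<phi> i x)"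
  by (induction I rule: finite_induct) (auto intro: smooth_const smooth_mult)

lemma smooth_has_derivative:
  assumes "smooth \<phi>"
  shows "(\<phi> has_derivative (\<lambda>v. grad \<phi> x \<bullet> v)) (at x)"
proof -
  let ?D = "frechet_derivative \<phi> (at x)"
  have D: "(\<phi> has_derivative ?D) (at x)"
    using assms C_diff_has_derivative unfolding smooth_def by blast
  then interpret bounded_linear ?D by (rule has_derivative_bounded_linear)
  have "?D v = grad \<phi> x \<bullet> v" for v
  proof -
    have "?D v = ?D (\<Sum>b\<in>Basis. (v \<bullet> b) *\<^sub>R b)" by (simp add: euclidean_representation)
    also have "\<dots> = (\<Sum>b\<in>Basis. (v \<bullet> b) * ?D b)" by (simp add: sum scaleR)
    also have "\<dots> = grad \<phi> x \<bullet> v"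
      unfolding grad_def inner_sum_left by (simp add: inner_commute mult.commute)
    finally show ?thesis .
  qed
  then have "?D = (\<lambda>v. grad \<phi> x \<bullet> v)" by (rule ext)
  with D show ?thesis by simp
qed

lemma grad_unique:
  assumes "smooth \<phi>" "(\<phi> has_derivative (\<lambda>v. g \<bullet> v)) (at x)"
  shows "grad \<phi> x = g"
proof -
  have "(\<lambda>v. grad \<phi> x \<bullet> v) = (\<lambda>v. g \<bullet> v)"
    using has_derivative_unique[OF smooth_has_derivative[OF assms(1)] assms(2)] .
  then show ?thesis by (metis vector_eq_rdot)
qed

lemma grad_mult:
  assumes "smooth \<phi>" "smooth \<zeta>"
  shows "grad (\<lambda>x. \<phi> x * \<zeta> x) x = \<phi> x *\<^sub>R grad \<zeta> x + \<zeta> x *\<^sub>R grad \<phi> x"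
proof (rule grad_unique)
  show "((\<lambda>x. \<phi> x * \<zeta> x) has_derivative (\<lambda>v. (\<phi> x *\<^sub>R grad \<zeta> x + \<zeta> x *\<^sub>R grad \<phi> x) \<bullet> v)) (at x)"
    using has_derivative_mult[OF smooth_has_derivative[OF assms(1)] smooth_has_derivative[OF assms(2)]]
    by (simp add: inner_add_left mult.commute)
qed (intro smooth_mult assms)

lemma continuous_on_smooth: "smooth \<phi> \<Longrightarrow> continuous_on S \<phi>"
  unfolding smooth_def using C_diff.simps(1) continuous_on_subset by blast

lemma continuous_on_grad: "smooth \<phi> \<Longrightarrow> continuous_on S (grad \<phi>)"
proof -
  assume "smooth \<phi>"
  then have "C_diff (Suc 0) \<phi>" unfolding smooth_def by blast
  then have "continuous_on S (\<lambda>x. frechet_derivative \<phi> (at x) v)" for v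
    using continuous_on_subset by auto
  then show ?thesis
    unfolding grad_def[abs_def] by (intro continuous_intros) auto
qed

lemma borel_measurable_smooth: "smooth \<phi> \<Longrightarrow> \<phi> \<in> borel_measurable borel"
  by (simp add: borel_measurable_continuous_onI continuous_on_smooth)

lemma borel_measurable_grad: "smooth \<phi> \<Longrightarrow> grad \<phi> \<in> borel_measurable borel"
  by (simp add: borel_measurable_continuous_onI continuous_on_grad)


section \<open>Smooth bumps supported in boxes\<close>

definition flat_exp :: "real poly \<Rightarrow> real \<Rightarrow> real" where
  "flat_exp p t = (if t > 0 then poly p (1 / t) * exp (- 1 / t) else 0)"

lemma tendsto_poly_exp: "((\<lambda>y. poly p y * exp (- y)) \<longlongrightarrow> 0) at_top" for p :: "real poly"
proof -
  have "((\<lambda>y. \<Sum>i\<le>degree p. coeff p i * (y ^ i / exp y)) \<longlongrightarrow> (\<Sum>i\<le>degree p. coeff p i * 0)) at_top"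
    by (intro tendsto_intros tendsto_power_div_exp_0)
  moreover have "(\<Sum>i\<le>degree p. coeff p i * (y ^ i / exp y)) = poly p y * exp (- y)" for y
    by (simp add: poly_altdef sum_distrib_right exp_minus divide_inverse mult.assoc)
  ultimately show ?thesis by simp
qed

text \<open>The polynomial factor makes the family closed under differentiation: the two factors
  contribute - p'(1/t) / t^2 and p(1/t) / t^2, whence the new polynomial. Smoothness is then a
  single induction for all p at once.\<close>

lemma flat_exp_has_derivative:
  "(flat_exp p has_real_derivative flat_exp ([:0, 0, 1:] * (p - pderiv p)) t) (at t)"
proof -
  consider "t > 0" | "t < 0" | "t = 0" by linarith
  then show ?thesis
  proof cases
    case 1
    have "((\<lambda>t. 1 / t) has_real_derivative - (1 / t\<^sup>2)) (at t)"
      using 1 by (auto intro!: derivative_eq_intros simp: power2_eq_square)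
    from DERIV_mult[OF DERIV_chain2[OF poly_DERIV[of p] this] DERIV_chain2[OF DERIV_exp DERIV_minus[OF this]]]
    have "((\<lambda>t. poly p (1 / t) * exp (- (1 / t))) has_real_derivative
        flat_exp ([:0, 0, 1:] * (p - pderiv p)) t) (at t)"
      using 1 by (simp add: flat_exp_def algebra_simps power2_eq_square)
    then show ?thesis
      by (rule has_field_derivative_transform_within_open[of _ _ _ "{0<..}"])
        (use 1 in \<open>auto simp: flat_exp_def\<close>)
  next
    case 2
    have "((\<lambda>t. 0) has_real_derivative flat_exp ([:0, 0, 1:] * (p - pderiv p)) t) (at t)"
      using 2 by (simp add: flat_exp_def)
    then show ?thesis
      by (rule has_field_derivative_transform_within_open[of _ _ _ "{..<0}"])
        (use 2 in \<open>auto simp: flat_exp_def\<close>)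
  next
    case 3
    \<comment> \<open>With y = 1/h the difference quotient at 0 is y p(y) exp(-y), whence the extra
      factor \<open>[:0, 1:]\<close>.\<close>
    have "((\<lambda>h. poly ([:0, 1:] * p) (inverse h) * exp (- inverse h)) \<longlongrightarrow> 0) (at_right 0)"
      using tendsto_poly_exp filterlim_inverse_at_top_right by (rule filterlim_compose)
    then have "((\<lambda>h. flat_exp p h / h) \<longlongrightarrow> 0) (at_right 0)"
      by (rule Lim_transform_eventually)
        (auto simp: eventually_at_right_field flat_exp_def field_simps intro!: exI[of _ 1])
    moreover have "((\<lambda>h. flat_exp p h / h) \<longlongrightarrow> 0) (at_left 0)"
      by (rule tendsto_eventually) (auto simp: eventually_at_left_field flat_exp_def intro!: exI[of _ "-1"])
    ultimately have "((\<lambda>h. flat_exp p h / h) \<longlongrightarrow> 0) (at 0)"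
      by (simp add: filterlim_split_at)
    then show ?thesis
      using 3 by (simp add: DERIV_def flat_exp_def)
  qed
qed

lemma smooth_flat_exp:
  fixes b :: "'a::euclidean_space"
  shows "smooth (\<lambda>x. flat_exp p (x \<bullet> b + d))"
  unfolding smooth_def
proof
  fix k
  show "C_diff k (\<lambda>x. flat_exp p (x \<bullet> b + d))"
  proof (induction k arbitrary: p)
    case 0
    have "continuous_on UNIV (flat_exp p)" for p
      using flat_exp_has_derivative by (intro DERIV_continuous_on) (auto intro: DERIV_subset)
    then have "continuous_on UNIV (\<lambda>x::'a. flat_exp p (x \<bullet> b + d))"
      by (rule continuous_on_compose2) (auto intro!: continuous_on_add continuous_on_inner)
    then show ?case by simp
  next
    case (Suc k)
    let ?p' = "[:0, 0, 1:] * (p - pderiv p)"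
    show ?case
    proof (rule C_diff_SucI)
      have "((\<lambda>x. flat_exp p (x \<bullet> b + d)) has_derivative
          (\<lambda>v. flat_exp ?p' (x \<bullet> b + d) * (v \<bullet> b))) (at x)" for x
        by (rule has_derivative_compose[OF _ flat_exp_has_derivative[unfolded has_field_derivative_def]])
          (auto intro!: derivative_eq_intros)
      then show "((\<lambda>x. flat_exp p (x \<bullet> b + d)) has_derivative
          (\<lambda>v. flat_exp ?p' (x \<bullet> b + d) * (v \<bullet> b))) (at x)" for x .
    qed (intro C_diff_mult C_diff_const Suc.IH)
  qed
qed

text \<open>Scaling by n makes each factor exp(-1/(n t)) tend to 1 inside the box, so these products
  approximate the indicator of the open box without any mollification.\<close>

definition box_bump :: "'a::euclidean_space \<Rightarrow> 'a \<Rightarrow> nat \<Rightarrow> 'a \<Rightarrow> real" where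
  "box_bump a b n x =
    (\<Prod>i\<in>Basis. flat_exp 1 (real n * ((x - a) \<bullet> i)) * flat_exp 1 (real n * ((b - x) \<bullet> i)))"

lemma smooth_box_bump: "smooth (box_bump a b n)"
proof -
  have "smooth (\<lambda>x. flat_exp 1 (real n * ((x - a) \<bullet> i)))"
    and "smooth (\<lambda>x. flat_exp 1 (real n * ((b - x) \<bullet> i)))" for i
    using smooth_flat_exp[of 1 "real n *\<^sub>R i" "- (real n * (a \<bullet> i))"]
      smooth_flat_exp[of 1 "- real n *\<^sub>R i" "real n * (b \<bullet> i)"]
    by (simp_all add: inner_diff_left algebra_simps)
  then show ?thesis
    unfolding box_bump_def[abs_def] by (intro smooth_prod smooth_mult) auto
qed

lemma flat_exp_one_bounds: "0 \<le> flat_exp 1 t" "flat_exp 1 t \<le> 1"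
  by (auto simp: flat_exp_def)

lemma box_bump_bounds: "\<bar>box_bump a b n x\<bar> \<le> 1"
proof -
  have "0 \<le> box_bump a b n x"
    unfolding box_bump_def by (intro prod_nonneg mult_nonneg_nonneg flat_exp_one_bounds)
  moreover have "box_bump a b n x \<le> 1"
    unfolding box_bump_def by (intro prod_le_1 conjI mult_nonneg_nonneg mult_le_one flat_exp_one_bounds)
  ultimately show ?thesis by simp
qed

lemma box_bump_eq_0:
  assumes "x \<notin> box a b"
  shows "box_bump a b n x = 0"
proof -
  obtain i where i: "i \<in> Basis" "x \<bullet> i \<le> a \<bullet> i \<or> b \<bullet> i \<le> x \<bullet> i"
    using assms by (auto simp: mem_box not_less)
  then have "flat_exp 1 (real n * ((x - a) \<bullet> i)) * flat_exp 1 (real n * ((b - x) \<bullet> i)) = 0"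
    by (auto simp: flat_exp_def inner_diff_left zero_less_mult_iff)
  with i show ?thesis unfolding box_bump_def by (intro prod_zero) auto
qed

lemma box_bump_tendsto:
  "(\<lambda>n. box_bump a b n x) \<longlonglongrightarrow> indicator (box a b) x"
proof (cases "x \<in> box a b")
  case True
  have *: "(\<lambda>n. flat_exp 1 (real n * t)) \<longlonglongrightarrow> 1" if "t > 0" for t
  proof (rule Lim_transform_eventually)
    have "(\<lambda>n. exp (- ((1 / t) / real n))) \<longlonglongrightarrow> exp (- 0)"
      by (intro tendsto_intros lim_const_over_n)
    then show "(\<lambda>n. exp (- ((1 / t) / real n))) \<longlonglongrightarrow> 1" by simp
    show "\<forall>\<^sub>F n in sequentially. exp (- ((1 / t) / real n)) = flat_exp 1 (real n * t)"
      using eventually_gt_at_top[of 0]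
      by eventually_elim (use that in \<open>auto simp: flat_exp_def field_simps\<close>)
  qed
  have "(\<lambda>n. box_bump a b n x) \<longlonglongrightarrow> (\<Prod>i\<in>(Basis::'a set). 1 * 1)"
    unfolding box_bump_def
    by (intro tendsto_prod tendsto_mult *) (use True in \<open>auto simp: mem_box inner_diff_left\<close>)
  with True show ?thesis by simp
next
  case False
  then show ?thesis by (simp add: box_bump_eq_0)
qed

lemma box_bump_test_function: "cbox a b \<subseteq> D \<Longrightarrow> box_bump a b n \<in> test_functions D"
  unfolding test_functions_def
  using smooth_box_bump[of a b n] box_bump_eq_0[of _ a b n] box_subset_cbox[of a b] compact_cbox[of a b]
  by blast

section \<open>Vanishing integrals against test functions\<close>

lemma (in complete_measure) borel_measurable_cong_AE:
  fixes f g :: "'a \<Rightarrow> 'b::topological_space"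
  assumes "f \<in> borel_measurable M" "AE x in M. f x = g x"
  shows "g \<in> borel_measurable M"
proof (rule measurableI)
  fix B :: "'b set"
  assume "B \<in> sets borel"
  then have "f -` B \<inter> space M \<in> sets M"
    using assms(1) by (rule measurable_sets[rotated])
  moreover have "AE x in M. x \<in> f -` B \<inter> space M \<longleftrightarrow> x \<in> g -` B \<inter> space M"
    using assms(2) by eventually_elim simp
  ultimately show "g -` B \<inter> space M \<in> sets M"
    using in_sets_AE by blast
qed simp

lemma (in complete_measure) integrable_cong_AE_complete:
  fixes f g :: "'a \<Rightarrow> 'b::{banach, second_countable_topology}"
  assumes "integrable M f" "AE x in M. f x = g x"
  shows "integrable M g"
proof (rule integrable_cong_AE_imp[OF assms(1)])
  show "g \<in> borel_measurable M"
    using assms borel_measurable_cong_AE[of f g] by simp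
qed (rule assms(2))

text \<open>No measurability is assumed: by completeness f and g are measurable together, and if
  they are not, both integrals have the default value 0.\<close>

lemma (in complete_measure) integral_cong_AE_complete:
  fixes f g :: "'a \<Rightarrow> 'b::{banach, second_countable_topology}"
  assumes "AE x in M. f x = g x"
  shows "integral\<^sup>L M f = integral\<^sup>L M g"
proof -
  have "AE x in M. g x = f x" using assms by eventually_elim simp
  then have "f \<in> borel_measurable M \<longleftrightarrow> g \<in> borel_measurable M"
    using borel_measurable_cong_AE assms by blast
  then show ?thesis
    using assms integral_cong_AE by (metis borel_measurable_integrable not_integrable_integral_eq)
qed

lemma complete_measure_lebesgue_on:
  assumes "S \<in> sets lebesgue"
  shows "complete_measure (lebesgue_on S)"
proof
  fix A B :: "'a set"
  assume "B \<subseteq> A" "A \<in> null_sets (lebesgue_on S)"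
  then have "A \<in> null_sets lebesgue" "A \<subseteq> S"
    using assms by (auto simp: null_sets_restrict_space)
  then have "B \<in> null_sets lebesgue"
    using \<open>B \<subseteq> A\<close> completion.complete2 by blast
  then show "B \<in> sets (lebesgue_on S)"
    using \<open>A \<subseteq> S\<close> \<open>B \<subseteq> A\<close> assms by (auto simp: sets_restrict_space_iff)
qed

lemma square_integrable_inner:
  fixes f g :: "'a \<Rightarrow> 'b::euclidean_space"
  assumes "square_integrable M f" "square_integrable M g"
  shows "integrable M (\<lambda>x. f x \<bullet> g x)"
proof (rule Bochner_Integration.integrable_bound)
  show "integrable M (\<lambda>x. (norm (f x))\<^sup>2 + (norm (g x))\<^sup>2)"
    and "(\<lambda>x. f x \<bullet> g x) \<in> borel_measurable M"
    using assms by (auto simp: square_integrable_def)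
  have "\<bar>f x \<bullet> g x\<bar> \<le> (norm (f x))\<^sup>2 + (norm (g x))\<^sup>2" for x
    using Cauchy_Schwarz_ineq2[of "f x" "g x"] sum_squares_bound[of "norm (f x)" "norm (g x)"]
      mult_nonneg_nonneg[OF norm_ge_zero[of "f x"] norm_ge_zero[of "g x"]] by linarith
  then show "AE x in M. norm (f x \<bullet> g x) \<le> norm ((norm (f x))\<^sup>2 + (norm (g x))\<^sup>2)"
    by simp
qed

lemma square_integrable_mult:
  fixes f g :: "'a \<Rightarrow> real"
  assumes "square_integrable M f" "square_integrable M g"
  shows "integrable M (\<lambda>x. f x * g x)"
  using square_integrable_inner[OF assms] by simp

lemma square_integrable_lincomb:
  fixes f g :: "'a \<Rightarrow> 'b::euclidean_space"
  assumes "square_integrable M f" "square_integrable M g"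
  shows "square_integrable M (\<lambda>x. a *\<^sub>R f x + b *\<^sub>R g x)"
proof -
  have "(norm (a *\<^sub>R f x + b *\<^sub>R g x))\<^sup>2 =
      a\<^sup>2 * (norm (f x))\<^sup>2 + 2 * (a * b) * (f x \<bullet> g x) + b\<^sup>2 * (norm (g x))\<^sup>2" for x
    unfolding power2_norm_eq_inner
    by (simp add: inner_add_left inner_add_right inner_commute power2_eq_square algebra_simps)
  moreover have "integrable M (\<lambda>x. a\<^sup>2 * (norm (f x))\<^sup>2 + 2 * (a * b) * (f x \<bullet> g x) + b\<^sup>2 * (norm (g x))\<^sup>2)"
    using assms square_integrable_inner[OF assms]
    by (intro Bochner_Integration.integrable_add integrable_mult_right) (auto simp: square_integrable_def)
  ultimately show ?thesis
    using assms by (auto simp: square_integrable_def)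
qed

lemma square_integrable_0: "square_integrable M (\<lambda>_. 0)"
  by (simp add: square_integrable_def)

lemma square_integrable_scaleR:
  fixes f :: "'a \<Rightarrow> real" and g :: "'a \<Rightarrow> 'b::euclidean_space"
  assumes "square_integrable M f" "square_integrable M g"
  shows "integrable M (\<lambda>x. f x *\<^sub>R g x)"
proof (rule Bochner_Integration.integrable_bound)
  show "integrable M (\<lambda>x. (norm (f x))\<^sup>2 + (norm (g x))\<^sup>2)"
    and "(\<lambda>x. f x *\<^sub>R g x) \<in> borel_measurable M"
    using assms by (auto simp: square_integrable_def)
  have "\<bar>f x\<bar> * norm (g x) \<le> (norm (f x))\<^sup>2 + (norm (g x))\<^sup>2" for x
    using sum_squares_bound[of "norm (f x)" "norm (g x)"]
      mult_nonneg_nonneg[OF norm_ge_zero[of "f x"] norm_ge_zero[of "g x"]]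
    unfolding real_norm_def by linarith
  then show "AE x in M. norm (f x *\<^sub>R g x) \<le> norm ((norm (f x))\<^sup>2 + (norm (g x))\<^sup>2)"
    by simp
qed

lemma (in complete_measure) square_integrable_cong_AE:
  fixes f g :: "'a \<Rightarrow> 'b::euclidean_space"
  assumes "square_integrable M f" "AE x in M. f x = g x"
  shows "square_integrable M g"
  unfolding square_integrable_def
proof
  show "g \<in> borel_measurable M"
    using assms borel_measurable_cong_AE by (auto simp: square_integrable_def)
  show "integrable M (\<lambda>x. (norm (g x))\<^sup>2)"
    using assms(1) unfolding square_integrable_def
    by (elim conjE integrable_cong_AE_complete) (use assms(2) in \<open>eventually_elim, simp\<close>)
qed

lemma square_integral_0_imp_AE:
  fixes f :: "'a \<Rightarrow> 'b::euclidean_space"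
  assumes "square_integrable M f" "(LINT x|M. (norm (f x))\<^sup>2) = 0"
  shows "AE x in M. f x = 0"
  using assms integral_nonneg_eq_0_iff_AE[of M "\<lambda>x. (norm (f x))\<^sup>2"]
  by (auto simp: square_integrable_def)

text \<open>The fundamental lemma of the calculus of variations. The bumps converge boundedly to
  indicators of boxes, so G has integral 0 over every closed box inside D; by Lebesgue
  differentiation its value at almost every point is a limit of averages over shrinking
  cubes.\<close>

lemma AE_eq_0_if_test_integrals_0:
  fixes G :: "'a::euclidean_space \<Rightarrow> 'b::euclidean_space"
  assumes "open D" and G: "integrable (lebesgue_on D) G"
    and test: "\<And>\<phi>. \<phi> \<in> test_functions D \<Longrightarrow> (LINT x|lebesgue_on D. \<phi> x *\<^sub>R G x) = 0"
  shows "AE x in lebesgue_on D. G x = 0"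
proof -
  have D: "D \<in> sets lebesgue" using \<open>open D\<close> by simp
  \<comment> \<open>Extension by zero, so that the differentiation theorem can be used on the whole
    space.\<close>
  define F where "F x = indicator D x *\<^sub>R G x" for x
  have F: "integrable lebesgue F"
    using G D by (simp add: F_def[abs_def] integrable_restrict_space)
  have F_box: "set_integrable lebesgue (box a b) F" "set_integrable lebesgue (cbox a b) F" for a b
    using F unfolding set_integrable_def by (auto intro!: integrable_mult_indicator)
  have box0: "integral (cbox a b) F = 0" if "cbox a b \<subseteq> D" for a b
  proof -
    have "(\<lambda>n. LINT x|lebesgue. box_bump a b n x *\<^sub>R F x) \<longlonglongrightarrow>
        (LINT x|lebesgue. indicator (box a b) x *\<^sub>R F x)"
    proof (rule integral_dominated_convergence)
      show "(\<lambda>x. box_bump a b n x *\<^sub>R F x) \<in> borel_measurable lebesgue" for n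
        using F borel_measurable_smooth[OF smooth_box_bump, of a b n]
        by (intro borel_measurable_scaleR) (auto simp: measurable_completion)
      show "(\<lambda>x. indicator (box a b) x *\<^sub>R F x) \<in> borel_measurable lebesgue"
        using F_box(1)[of a b] by (auto simp: set_integrable_def)
      show "integrable lebesgue (\<lambda>x. norm (F x))" using F by simp
      show "AE x in lebesgue. (\<lambda>n. box_bump a b n x *\<^sub>R F x) \<longlonglongrightarrow> indicator (box a b) x *\<^sub>R F x"
        by (intro AE_I2 tendsto_scaleR box_bump_tendsto tendsto_const)
      show "AE x in lebesgue. norm (box_bump a b n x *\<^sub>R F x) \<le> norm (F x)" for n
        using box_bump_bounds[of a b n] by (auto intro!: AE_I2 mult_left_le_one_le)
    qed
    moreover have "(LINT x|lebesgue. box_bump a b n x *\<^sub>R F x) = 0" for n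
      using test[OF box_bump_test_function[OF that, of n]] D
      by (simp add: integral_restrict_space F_def mult.commute)
    ultimately have "(LINT x|lebesgue. indicator (box a b) x *\<^sub>R F x) = 0"
      by (simp add: LIMSEQ_const_iff)
    then show ?thesis
      using set_lebesgue_integral_eq_integral(2)[OF F_box(1)[of a b]]
      by (simp add: set_lebesgue_integral_def integral_open_interval)
  qed
  have "F integrable_on cbox a b" for a b
    using set_lebesgue_integral_eq_integral(1)[OF F_box(2)] .
  then obtain N where N: "negligible N" and lim:
    "\<And>x e. \<lbrakk>x \<notin> N; 0 < e\<rbrakk> \<Longrightarrow> \<exists>d>0. \<forall>h. 0 < h \<and> h < d \<longrightarrow>
        norm (integral (cbox x (x + h *\<^sub>R One)) F /\<^sub>R h ^ DIM('a) - F x) < e"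
    using integrable_ccontinuous_explicit by blast
  have "F x = 0" if x: "x \<in> D" "x \<notin> N" for x
  proof (rule ccontr)
    assume "F x \<noteq> 0"
    then obtain d where d: "d > 0" "\<And>h. 0 < h \<Longrightarrow> h < d \<Longrightarrow>
        norm (integral (cbox x (x + h *\<^sub>R One)) F /\<^sub>R h ^ DIM('a) - F x) < norm (F x)"
      using lim[OF \<open>x \<notin> N\<close>, of "norm (F x)"] by auto
    obtain r where r: "r > 0" "ball x r \<subseteq> D"
      using \<open>open D\<close> x(1) by (auto simp: open_contains_ball)
    \<comment> \<open>The diagonal of a cube of side h has length \<open>h * norm One\<close>; this
      choice keeps the cube inside the ball of radius r.\<close>
    define h where "h = min (d / 2) (r / (2 * norm (One::'a)))"
    have nO: "norm (One::'a) > 0" by (metis One_non_0 zero_less_norm_iff)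
    have h: "0 < h" "h < d" "h * norm (One::'a) < r"
      using d(1) r(1) nO by (auto simp: h_def min_def field_simps)
    have "cbox x (x + h *\<^sub>R One) \<subseteq> ball x r"
    proof
      fix y assume y: "y \<in> cbox x (x + h *\<^sub>R One)"
      have "norm (y - x) \<le> norm (h *\<^sub>R (One::'a))"
        by (rule norm_le_componentwise) (use y h(1) in \<open>auto simp: mem_box inner_diff_left inner_add_left\<close>)
      with h show "y \<in> ball x r"
        by (simp add: dist_norm norm_minus_commute)
    qed
    with r box0 have "integral (cbox x (x + h *\<^sub>R One)) F = 0" by blast
    with d(2)[OF h(1,2)] show False by simp
  qed
  then have "AE x in lebesgue. x \<in> D \<longrightarrow> F x = 0"
    using N by (auto simp: negligible_iff_null_sets eventually_ae_filter intro!: exI[of _ N])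
  then have "AE x in lebesgue. x \<in> D \<longrightarrow> G x = 0"
    by eventually_elim (auto simp: F_def)
  then show ?thesis
    using D by (simp add: AE_restrict_space_iff)
qed

text \<open>Translation invariance makes the integral of every difference quotient vanish.\<close>

lemma integral_grad_eq_0:
  assumes \<phi>: "smooth \<phi>" and K: "compact K" "\<And>x. x \<notin> K \<Longrightarrow> \<phi> x = 0"
  shows "integrable lebesgue (grad \<phi>)" "(LINT x|lebesgue. grad \<phi> x) = 0"
proof -
  note meas [measurable] = borel_measurable_smooth[OF \<phi>] borel_measurable_grad[OF \<phi>]
  have grad0: "grad \<phi> x = 0" if "x \<notin> K" for x
  proof (rule grad_unique[OF \<phi>])
    have "open (- K)" using K by (simp add: compact_imp_closed open_Compl)
    then show "(\<phi> has_derivative (\<lambda>v. 0 \<bullet> v)) (at x)"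
      by (rule has_derivative_transform_within_open[of "\<lambda>_. 0", rotated])
        (use that K in \<open>auto intro!: derivative_eq_intros\<close>)
  qed
  have "bounded (grad \<phi> ` K)"
    using K \<phi> by (intro compact_imp_bounded compact_continuous_image continuous_on_grad)
  then obtain M where M: "\<And>x. x \<in> K \<Longrightarrow> norm (grad \<phi> x) \<le> M"
    by (auto simp: bounded_iff)
  then have M': "norm (grad \<phi> x) \<le> \<bar>M\<bar>" for x
    by (cases "x \<in> K") (use grad0 in force)+
  obtain R where R: "K \<subseteq> cball 0 R"
    using compact_imp_bounded[OF K(1)] by (auto simp: bounded_iff subset_eq)
  \<comment> \<open>Dominating function for the difference quotients: their steps are at most 1, so
    their supports stay within distance 1 of K, and \<phi> is Lipschitz with constant
    \<bar>M\<bar>.\<close>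
  have ind: "integrable lborel (\<lambda>x::'a. \<bar>M\<bar> * indicator (cball 0 (R + 1)) x)"
    by (intro integrable_mult_right integrable_real_indicator)
      (use emeasure_bounded_finite[OF bounded_cball] in \<open>auto simp: less_top\<close>)
  have int: "integrable lborel (grad \<phi>)"
  proof (rule Bochner_Integration.integrable_bound[OF ind])
    show "AE x in lborel. norm (grad \<phi> x) \<le> norm (\<bar>M\<bar> * indicator (cball 0 (R + 1)) x)"
      using M' grad0 R by (fastforce split: split_indicator)
  qed simp
  then show "integrable lebesgue (grad \<phi>)"
    by (simp add: integrable_completion)
  have int\<phi>: "integrable lborel \<phi>"
  proof -
    have "integrable lborel (\<lambda>x. indicator K x *\<^sub>R \<phi> x)"
      using borel_integrable_compact[OF K(1) continuous_on_smooth[OF \<phi>]] .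
    moreover have "(\<lambda>x. indicator K x *\<^sub>R \<phi> x) = \<phi>" using K(2) by (auto split: split_indicator)
    ultimately show ?thesis by simp
  qed
  have "(LINT x|lborel. grad \<phi> x) \<bullet> b = 0" if b: "b \<in> Basis" for b
  proof -
    define h where "h n = inverse (real (Suc n))" for n
    have h: "h n > 0" "h n \<le> 1" for n by (auto simp: h_def field_simps)
    have h0: "h \<longlonglongrightarrow> 0" unfolding h_def[abs_def] by (rule LIMSEQ_inverse_real_of_nat)
    have "(\<lambda>n. LINT x|lborel. (\<phi> (x + h n *\<^sub>R b) - \<phi> x) / h n) \<longlonglongrightarrow> (LINT x|lborel. grad \<phi> x \<bullet> b)"
    proof (rule integral_dominated_convergence[OF _ _ ind])
      show "AE x in lborel. (\<lambda>n. (\<phi> (x + h n *\<^sub>R b) - \<phi> x) / h n) \<longlonglongrightarrow> grad \<phi> x \<bullet> b"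
      proof (rule AE_I2)
        fix x
        have "((\<lambda>t. \<phi> (x + t *\<^sub>R b)) has_derivative (\<lambda>t. grad \<phi> x \<bullet> (t *\<^sub>R b))) (at 0)"
          by (rule has_derivative_compose[of "\<lambda>t. x + t *\<^sub>R b" _ 0 UNIV \<phi>])
            (use smooth_has_derivative[OF \<phi>] in \<open>auto intro!: derivative_eq_intros\<close>)
        then have "((\<lambda>t. \<phi> (x + t *\<^sub>R b)) has_real_derivative grad \<phi> x \<bullet> b) (at 0)"
          unfolding has_field_derivative_def by (rule has_derivative_eq_rhs) (simp add: fun_eq_iff)
        then have "((\<lambda>t. (\<phi> (x + t *\<^sub>R b) - \<phi> x) / t) \<longlongrightarrow> grad \<phi> x \<bullet> b) (at 0)"
          by (simp add: DERIV_def)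
        then show "(\<lambda>n. (\<phi> (x + h n *\<^sub>R b) - \<phi> x) / h n) \<longlonglongrightarrow> grad \<phi> x \<bullet> b"
          by (rule filterlim_compose)
            (use h h0 in \<open>auto simp: filterlim_at less_imp_neq[symmetric]\<close>)
      qed
      have "norm ((\<phi> (x + h n *\<^sub>R b) - \<phi> x) / h n) \<le> \<bar>M\<bar> * indicator (cball 0 (R + 1)) x" for n x
      proof (cases "x \<in> cball 0 (R + 1)")
        case True
        have "norm (\<phi> (x + h n *\<^sub>R b) - \<phi> x) \<le> \<bar>M\<bar> * norm (x + h n *\<^sub>R b - x)"
        proof (rule differentiable_bound[of UNIV])
          show "(\<phi> has_derivative (\<lambda>v. grad \<phi> y \<bullet> v)) (at y within UNIV)" for y
            using smooth_has_derivative[OF \<phi>] by simp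
          show "onorm (\<lambda>v. grad \<phi> y \<bullet> v) \<le> \<bar>M\<bar>" for y
            using M'[of y] Cauchy_Schwarz_ineq2[of "grad \<phi> y"]
            by (intro onorm_le) (metis mult_right_mono norm_ge_zero order_trans real_norm_def)
        qed auto
        then have "\<bar>\<phi> (x + h n *\<^sub>R b) - \<phi> x\<bar> \<le> \<bar>M\<bar> * h n"
          using h[of n] b by simp
        then show ?thesis
          using h[of n] True by (simp add: divide_le_eq)
      next
        case False
        have "norm x \<le> norm (x + h n *\<^sub>R b) + norm (h n *\<^sub>R b)"
          by (metis add_diff_cancel norm_triangle_ineq4)
        then have "x + h n *\<^sub>R b \<notin> K" "x \<notin> K"
          using False R h[of n] b by (auto simp: subset_eq)
        then show ?thesis using K(2) by simp
      qed
      then show "AE x in lborel. norm ((\<phi> (x + h n *\<^sub>R b) - \<phi> x) / h n) \<le>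
          \<bar>M\<bar> * indicator (cball 0 (R + 1)) x" for n by simp
    qed measurable
    note lim = this
    have eq0: "(LINT x|lborel. (\<phi> (x + h n *\<^sub>R b) - \<phi> x) / h n) = 0" for n
    proof -
      have "integrable lborel (\<lambda>x. \<phi> (h n *\<^sub>R b + x))"
        using int\<phi> integrable_distr_eq[of "(+) (h n *\<^sub>R b)" lborel borel \<phi>] by (simp add: lborel_distr_plus)
      moreover have "(LINT x|lborel. \<phi> (h n *\<^sub>R b + x)) = (LINT x|lborel. \<phi> x)"
        using integral_distr[of "(+) (h n *\<^sub>R b)" lborel borel \<phi>] by (simp add: lborel_distr_plus)
      ultimately show ?thesis
        using int\<phi> by (simp add: add.commute)
    qed
    have "(LINT x|lborel. grad \<phi> x \<bullet> b) = 0"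
      using LIMSEQ_unique[OF lim[unfolded eq0] tendsto_const] .
    then show ?thesis using int by simp
  qed
  then have "(LINT x|lborel. grad \<phi> x) = 0"
    by (metis euclidean_eqI inner_zero_left)
  then show "(LINT x|lebesgue. grad \<phi> x) = 0"
    by (simp add: integral_completion)
qed

section \<open>The inner product of \<open>H\<^sup>1\<close>\<close>

lemma test_function_smooth: "\<phi> \<in> test_functions D \<Longrightarrow> smooth \<phi>"
  by (simp add: test_functions_def)

section \<open>Semi-definite inner products on spaces of functions\<close>

lemma discriminant_nonneg_form:
  fixes a b c :: real
  assumes "\<And>t. 0 \<le> c * t\<^sup>2 + 2 * b * t + a" and "0 \<le> c"
  shows "b\<^sup>2 \<le> a * c"
proof (cases "c = 0")
  case True
  have "b = 0"
  proof (rule ccontr)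
    assume "b \<noteq> 0"
    then have "2 * b * (- (a + 1) / (2 * b)) + a = - 1" by (simp add: field_simps)
    with assms(1)[of "- (a + 1) / (2 * b)"] True show False by simp
  qed
  with True show ?thesis by simp
next
  case False
  with assms(2) have "c > 0" by simp
  have "0 \<le> c * (c * (- b / c)\<^sup>2 + 2 * b * (- b / c) + a)"
    using assms by (intro mult_nonneg_nonneg)
  also have "\<dots> = a * c - b\<^sup>2" using \<open>c > 0\<close> by (simp add: field_simps power2_eq_square)
  finally show ?thesis by simp
qed

text \<open>Shared by \<open>H1\<close> and by W with its L^2 product. Definiteness is left out
  because a function in \<open>H1\<close> of norm zero vanishes only almost everywhere.\<close>

locale semi_inner_product =
  fixes V :: "('a \<Rightarrow> real) set" and ip :: "('a \<Rightarrow> real) \<Rightarrow> ('a \<Rightarrow> real) \<Rightarrow> real"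
  assumes zero_in: "(\<lambda>_. 0) \<in> V"
    and lincomb_in: "u \<in> V \<Longrightarrow> v \<in> V \<Longrightarrow> (\<lambda>x. a * u x + b * v x) \<in> V"
    and commute: "ip u v = ip v u"
    and lincomb_left: "u \<in> V \<Longrightarrow> v \<in> V \<Longrightarrow> w \<in> V \<Longrightarrow> ip (\<lambda>x. a * u x + b * v x) w = a * ip u w + b * ip v w"
    and self_nonneg: "0 \<le> ip u u"
begin

lemma diff_in: "u \<in> V \<Longrightarrow> v \<in> V \<Longrightarrow> (\<lambda>x. u x - v x) \<in> V"
  using lincomb_in[of u v 1 "-1"] by simp

lemma cmult_in: "u \<in> V \<Longrightarrow> (\<lambda>x. a * u x) \<in> V"
  using lincomb_in[of u u a 0] by simp

lemma sum_in: "(\<And>k. k \<in> I \<Longrightarrow> u k \<in> V) \<Longrightarrow> (\<lambda>x. \<Sum>k\<in>I. c k * u k x) \<in> V"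
proof (induction I rule: infinite_finite_induct)
  case (insert k I)
  then show ?case using lincomb_in[of "u k" "\<lambda>x. \<Sum>k\<in>I. c k * u k x" "c k" 1] by simp
qed (simp_all add: zero_in)

lemma lincomb_right:
  "u \<in> V \<Longrightarrow> v \<in> V \<Longrightarrow> w \<in> V \<Longrightarrow> ip w (\<lambda>x. a * u x + b * v x) = a * ip w u + b * ip w v"
  using lincomb_left[of u v w a b] by (simp add: commute)

lemma cmult_left: "u \<in> V \<Longrightarrow> w \<in> V \<Longrightarrow> ip (\<lambda>x. a * u x) w = a * ip u w"
  using lincomb_left[of u u w a 0] by simp

lemma cmult_right: "u \<in> V \<Longrightarrow> w \<in> V \<Longrightarrow> ip w (\<lambda>x. a * u x) = a * ip w u"
  using cmult_left[of u w a] by (simp add: commute)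

lemma zero_left: "w \<in> V \<Longrightarrow> ip (\<lambda>_. 0) w = 0"
  using cmult_left[of w w 0] by simp

lemma sum_left:
  assumes "\<And>k. k \<in> I \<Longrightarrow> u k \<in> V" "w \<in> V"
  shows "ip (\<lambda>x. \<Sum>k\<in>I. c k * u k x) w = (\<Sum>k\<in>I. c k * ip (u k) w)"
  using assms(1)
proof (induction I rule: infinite_finite_induct)
  case (insert k I)
  then have "u k \<in> V" "(\<lambda>x. \<Sum>k\<in>I. c k * u k x) \<in> V" by (auto intro: sum_in)
  from lincomb_left[OF this assms(2), of "c k" 1] insert show ?case by simp
qed (simp_all add: zero_left assms)

lemma sum_right:
  assumes "\<And>k. k \<in> I \<Longrightarrow> u k \<in> V" "w \<in> V"
  shows "ip w (\<lambda>x. \<Sum>k\<in>I. c k * u k x) = (\<Sum>k\<in>I. c k * ip w (u k))"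
  using sum_left[OF assms] by (simp add: commute)

lemma sum_sum:
  assumes "\<And>l. l \<in> I \<Longrightarrow> u l \<in> V" "\<And>m. m \<in> J \<Longrightarrow> v m \<in> V"
  shows "ip (\<lambda>x. \<Sum>l\<in>I. c l * u l x) (\<lambda>x. \<Sum>m\<in>J. d m * v m x) = (\<Sum>l\<in>I. \<Sum>m\<in>J. c l * d m * ip (u l) (v m))"
proof -
  have "ip (\<lambda>x. \<Sum>l\<in>I. c l * u l x) (\<lambda>x. \<Sum>m\<in>J. d m * v m x) =
      (\<Sum>l\<in>I. c l * ip (u l) (\<lambda>x. \<Sum>m\<in>J. d m * v m x))"
    by (intro sum_left sum_in assms)
  also have "\<dots> = (\<Sum>l\<in>I. c l * (\<Sum>m\<in>J. d m * ip (u l) (v m)))"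
    by (intro sum.cong refl arg_cong[of _ _ "(*) _"] sum_right assms)
  finally show ?thesis by (simp add: sum_distrib_left mult.assoc)
qed

text \<open>The coefficient 1 is kept so that the expression has the shape required by the rules for
  linear combinations.\<close>

lemma lincomb_self:
  assumes "u \<in> V" "v \<in> V"
  shows "ip (\<lambda>x. 1 * u x + t * v x) (\<lambda>x. 1 * u x + t * v x) = ip v v * t\<^sup>2 + 2 * ip u v * t + ip u u"
  unfolding lincomb_left[OF assms lincomb_in[OF assms]] lincomb_right[OF assms assms(1)] lincomb_right[OF assms assms(2)]
  by (simp add: commute[of v u] power2_eq_square algebra_simps)

lemma Cauchy_Schwarz:
  assumes "u \<in> V" "v \<in> V"
  shows "\<bar>ip u v\<bar> \<le> sqrt (ip u u) * sqrt (ip v v)"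
proof -
  have "0 \<le> ip v v * t\<^sup>2 + 2 * ip u v * t + ip u u" for t
    using self_nonneg[of "\<lambda>x. 1 * u x + t * v x"] by (simp only: lincomb_self[OF assms])
  then have "(ip u v)\<^sup>2 \<le> ip u u * ip v v"
    using self_nonneg by (rule discriminant_nonneg_form)
  then have "sqrt ((ip u v)\<^sup>2) \<le> sqrt (ip u u * ip v v)"
    by (rule real_sqrt_le_mono)
  then show ?thesis by (simp add: real_sqrt_mult)
qed

text \<open>Expand the nonnegative square of b minus its projection p onto the orthonormal
  family.\<close>

lemma Bessel:
  fixes r :: nat
  assumes a: "\<And>k. k < r \<Longrightarrow> a k \<in> V"
    and orth: "\<And>j k. j < r \<Longrightarrow> k < r \<Longrightarrow> ip (a j) (a k) = of_bool (j = k)" and b: "b \<in> V"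
  shows "(\<Sum>k<r. (ip (a k) b)\<^sup>2) \<le> ip b b"
proof -
  define c where "c k = ip (a k) b" for k
  define p where "p x = (\<Sum>k<r. c k * a k x)" for x
  have p: "p \<in> V" unfolding p_def[abs_def] using a by (intro sum_in) auto
  have pb: "ip b p = (\<Sum>k<r. (c k)\<^sup>2)"
    unfolding p_def[abs_def] using a b
    by (subst sum_right) (auto simp: c_def commute[of b] power2_eq_square)
  have "ip p p = (\<Sum>l<r. \<Sum>m<r. c l * c m * ip (a l) (a m))"
    unfolding p_def[abs_def] using a by (intro sum_sum) auto
  also have "\<dots> = (\<Sum>l<r. \<Sum>m<r. if m = l then (c l)\<^sup>2 else 0)"
    using orth by (intro sum.cong) (auto simp: power2_eq_square)
  finally have pp: "ip p p = (\<Sum>k<r. (c k)\<^sup>2)" by (simp add: sum.delta)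
  have "0 \<le> ip p p * (-1)\<^sup>2 + 2 * ip b p * (-1) + ip b b"
    using self_nonneg[of "\<lambda>x. 1 * b x + (-1) * p x"] by (simp only: lincomb_self[OF b p])
  then show ?thesis by (simp add: pb pp c_def)
qed

end

section \<open>Weak gradients and the H^1 product on a bounded open set\<close>

locale bounded_open =
  fixes D :: "'a::euclidean_space set"
  assumes open_domain: "open D" and bounded_domain: "bounded D"
begin

lemma sets_domain: "D \<in> sets lebesgue"
  using open_domain by simp

sublocale leb: complete_measure "lebesgue_on D"
  by (rule complete_measure_lebesgue_on[OF sets_domain])

sublocale leb: finite_measure "lebesgue_on D"
  using bounded_domain sets_domain by (intro finite_measure_lebesgue_on bounded_set_imp_lmeasurable)

lemma square_integrable_continuous:
  fixes g :: "'a \<Rightarrow> 'b::euclidean_space"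
  assumes "continuous_on (closure D) g"
  shows "square_integrable (lebesgue_on D) g"
proof -
  have "bounded (g ` closure D)"
    using assms bounded_domain by (intro compact_imp_bounded compact_continuous_image) auto
  then obtain B where B: "\<And>x. x \<in> D \<Longrightarrow> norm (g x) \<le> B"
    using closure_subset unfolding bounded_iff by blast
  have meas: "g \<in> borel_measurable (lebesgue_on D)"
    using assms sets_domain continuous_on_subset[OF _ closure_subset]
    by (blast intro: continuous_imp_measurable_on_sets_lebesgue)
  moreover have "integrable (lebesgue_on D) (\<lambda>x. (norm (g x))\<^sup>2)"
  proof (rule leb.integrable_const_bound)
    show "AE x in lebesgue_on D. norm ((norm (g x))\<^sup>2) \<le> B\<^sup>2"
      using B by (auto intro!: AE_I2 power_mono)
  qed (use meas in measurable)
  ultimately show ?thesis by (simp add: square_integrable_def)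
qed

lemma square_integrable_smooth:
  "smooth \<phi> \<Longrightarrow> square_integrable (lebesgue_on D) \<phi>"
  "smooth \<phi> \<Longrightarrow> square_integrable (lebesgue_on D) (grad \<phi>)"
  by (auto intro!: square_integrable_continuous continuous_on_smooth continuous_on_grad)

lemma square_integrable_imp_integrable:
  fixes g :: "'a \<Rightarrow> 'b::euclidean_space"
  assumes "square_integrable (lebesgue_on D) g"
  shows "integrable (lebesgue_on D) g"
  using square_integrable_scaleR[OF square_integrable_smooth(1)[OF smooth_const[of 1]] assms] by simp

text \<open>This makes the chosen \<open>weak_grad\<close> linear up to null sets, and hence
  \<open>H1_inner\<close> bilinear.\<close>

lemma is_weak_grad_unique:
  assumes "is_weak_grad D u G" "is_weak_grad D u G'"
  shows "AE x in lebesgue_on D. G x = G' x"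
proof -
  have sq: "square_integrable (lebesgue_on D) G" "square_integrable (lebesgue_on D) G'"
    using assms by (auto simp: is_weak_grad_def)
  have "AE x in lebesgue_on D. G x - G' x = 0"
  proof (rule AE_eq_0_if_test_integrals_0[OF open_domain])
    show "integrable (lebesgue_on D) (\<lambda>x. G x - G' x)"
      by (intro Bochner_Integration.integrable_diff square_integrable_imp_integrable sq)
    fix \<phi> assume \<phi>: "\<phi> \<in> test_functions D"
    have "integrable (lebesgue_on D) (\<lambda>x. \<phi> x *\<^sub>R G x)" "integrable (lebesgue_on D) (\<lambda>x. \<phi> x *\<^sub>R G' x)"
      using \<phi> by (auto intro!: square_integrable_scaleR square_integrable_smooth test_function_smooth sq)
    moreover have "(LINT x|lebesgue_on D. \<phi> x *\<^sub>R G x) = (LINT x|lebesgue_on D. \<phi> x *\<^sub>R G' x)"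
      using assms \<phi> unfolding is_weak_grad_def by (metis neg_equal_iff_equal)
    ultimately show "(LINT x|lebesgue_on D. \<phi> x *\<^sub>R (G x - G' x)) = 0"
      by (simp add: scaleR_diff_right)
  qed
  then show ?thesis by eventually_elim simp
qed

lemma H1_square_integrable: "u \<in> H1 D \<Longrightarrow> square_integrable (lebesgue_on D) u"
  by (simp add: H1_def)

lemma H1_weak_grad: "u \<in> H1 D \<Longrightarrow> is_weak_grad D u (weak_grad D u)"
  unfolding H1_def weak_grad_def using someI_ex[of "is_weak_grad D u"] by simp

lemma weak_grad_square_integrable: "u \<in> H1 D \<Longrightarrow> square_integrable (lebesgue_on D) (weak_grad D u)"
  using H1_weak_grad by (simp add: is_weak_grad_def)

lemma weak_grad_AE_eqI:
  assumes "is_weak_grad D u G"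
  shows "AE x in lebesgue_on D. weak_grad D u x = G x"
proof -
  have "is_weak_grad D u (weak_grad D u)"
    unfolding weak_grad_def using someI[of "is_weak_grad D u", OF assms] .
  then show ?thesis using assms by (rule is_weak_grad_unique)
qed

text \<open>Integration by parts: \<phi> need not vanish at the boundary, but its product with a
  test function has compact support in D, so the integral of the gradient of the product is 0 and
  the product rule separates the two terms.\<close>

lemma is_weak_grad_smooth:
  assumes \<phi>: "smooth \<phi>"
  shows "is_weak_grad D \<phi> (grad \<phi>)"
  unfolding is_weak_grad_def
proof (intro conjI ballI)
  fix \<eta> assume \<eta>: "\<eta> \<in> test_functions D"
  then obtain K where K: "compact K" "K \<subseteq> D" "\<And>x. x \<notin> K \<Longrightarrow> \<eta> x = 0"
    by (auto simp: test_functions_def)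
  note [simp] = test_function_smooth[OF \<eta>]
  let ?g = "grad (\<lambda>x. \<phi> x * \<eta> x)"
  have g: "?g x = \<phi> x *\<^sub>R grad \<eta> x + \<eta> x *\<^sub>R grad \<phi> x" for x
    using \<phi> by (simp add: grad_mult)
  have "?g x = 0" if "x \<notin> D" for x
  proof (rule grad_unique)
    have "open (- K)" using K by (simp add: compact_imp_closed open_Compl)
    then show "((\<lambda>x. \<phi> x * \<eta> x) has_derivative (\<lambda>v. 0 \<bullet> v)) (at x)"
      by (rule has_derivative_transform_within_open[of "\<lambda>_. 0", rotated])
        (use that K in \<open>auto intro!: derivative_eq_intros\<close>)
  qed (use \<phi> in \<open>simp add: smooth_mult\<close>)
  then have "indicator D x *\<^sub>R ?g x = ?g x" for x
    by (auto split: split_indicator)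
  then have "(LINT x|lebesgue_on D. ?g x) = (LINT x|lebesgue. ?g x)"
    using sets_domain by (simp add: integral_restrict_space)
  also have "\<dots> = 0"
    using \<phi> K by (intro integral_grad_eq_0[OF _ K(1)]) (auto simp: smooth_mult)
  finally have "(LINT x|lebesgue_on D. \<phi> x *\<^sub>R grad \<eta> x + \<eta> x *\<^sub>R grad \<phi> x) = 0"
    unfolding g .
  then show "(LINT x|lebesgue_on D. \<phi> x *\<^sub>R grad \<eta> x) = - (LINT x|lebesgue_on D. \<eta> x *\<^sub>R grad \<phi> x)"
    using \<phi> by (subst (asm) Bochner_Integration.integral_add)
      (auto intro!: square_integrable_scaleR square_integrable_smooth simp: eq_neg_iff_add_eq_0)
qed (rule square_integrable_smooth(2)[OF \<phi>])

lemma smooth_in_H1: "smooth \<phi> \<Longrightarrow> \<phi> \<in> H1 D"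
  unfolding H1_def using is_weak_grad_smooth square_integrable_smooth(1) by blast

lemma is_weak_grad_lincomb:
  assumes "u \<in> H1 D" "v \<in> H1 D" "is_weak_grad D u G" "is_weak_grad D v G'"
  shows "is_weak_grad D (\<lambda>x. a * u x + b * v x) (\<lambda>x. a *\<^sub>R G x + b *\<^sub>R G' x)"
  unfolding is_weak_grad_def
proof (intro conjI ballI)
  have sq: "square_integrable (lebesgue_on D) G" "square_integrable (lebesgue_on D) G'"
    using assms by (auto simp: is_weak_grad_def)
  then show "square_integrable (lebesgue_on D) (\<lambda>x. a *\<^sub>R G x + b *\<^sub>R G' x)"
    by (rule square_integrable_lincomb)
  fix \<phi> assume \<phi>: "\<phi> \<in> test_functions D"
  note sm = square_integrable_smooth[OF test_function_smooth[OF \<phi>]]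
  have 1: "integrable (lebesgue_on D) (\<lambda>x. u x *\<^sub>R grad \<phi> x)" "integrable (lebesgue_on D) (\<lambda>x. v x *\<^sub>R grad \<phi> x)"
    using assms H1_square_integrable by (auto intro!: square_integrable_scaleR sm)
  have 2: "integrable (lebesgue_on D) (\<lambda>x. \<phi> x *\<^sub>R G x)" "integrable (lebesgue_on D) (\<lambda>x. \<phi> x *\<^sub>R G' x)"
    by (auto intro!: square_integrable_scaleR sm sq)
  have "(LINT x|lebesgue_on D. (a * u x + b * v x) *\<^sub>R grad \<phi> x) =
      (LINT x|lebesgue_on D. a *\<^sub>R (u x *\<^sub>R grad \<phi> x) + b *\<^sub>R (v x *\<^sub>R grad \<phi> x))"
    by (simp add: scaleR_add_left)
  also have "\<dots> = a *\<^sub>R (LINT x|lebesgue_on D. u x *\<^sub>R grad \<phi> x) + b *\<^sub>R (LINT x|lebesgue_on D. v x *\<^sub>R grad \<phi> x)"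
    using 1 by (simp del: scaleR_scaleR)
  also have "\<dots> = - (a *\<^sub>R (LINT x|lebesgue_on D. \<phi> x *\<^sub>R G x) + b *\<^sub>R (LINT x|lebesgue_on D. \<phi> x *\<^sub>R G' x))"
    using assms \<phi> by (simp add: is_weak_grad_def)
  also have "\<dots> = - (LINT x|lebesgue_on D. a *\<^sub>R (\<phi> x *\<^sub>R G x) + b *\<^sub>R (\<phi> x *\<^sub>R G' x))"
    using 2 by (simp del: scaleR_scaleR)
  finally show "(LINT x|lebesgue_on D. (a * u x + b * v x) *\<^sub>R grad \<phi> x) =
      - (LINT x|lebesgue_on D. \<phi> x *\<^sub>R (a *\<^sub>R G x + b *\<^sub>R G' x))"
    by (simp add: scaleR_add_right mult.commute)
qed

lemma H1_lincomb:
  assumes "u \<in> H1 D" "v \<in> H1 D"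
  shows "(\<lambda>x. a * u x + b * v x) \<in> H1 D"
  using is_weak_grad_lincomb[OF assms H1_weak_grad[OF assms(1)] H1_weak_grad[OF assms(2)]]
    square_integrable_lincomb[OF assms[THEN H1_square_integrable]]
  unfolding H1_def by (auto simp only: mem_Collect_eq real_scaleR_def)

lemma H1_0: "(\<lambda>_. 0) \<in> H1 D"
  using smooth_in_H1[OF smooth_const] .

text \<open>The function enters only under an integral. Because the two predicates are equal, the
  choice \<open>weak_grad\<close> returns literally the same function for u and v.\<close>

lemma is_weak_grad_cong_AE:
  assumes "AE x in lebesgue_on D. u x = v x"
  shows "is_weak_grad D u = is_weak_grad D v"
proof -
  have "(LINT x|lebesgue_on D. u x *\<^sub>R grad \<phi> x) = (LINT x|lebesgue_on D. v x *\<^sub>R grad \<phi> x)" for \<phi>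
    by (intro leb.integral_cong_AE_complete) (use assms in \<open>eventually_elim, simp\<close>)
  then show ?thesis
    unfolding is_weak_grad_def by simp
qed

lemma H1_cong_AE:
  assumes "u \<in> H1 D" "AE x in lebesgue_on D. u x = v x"
  shows "v \<in> H1 D"
  using assms leb.square_integrable_cong_AE[OF _ assms(2)] is_weak_grad_cong_AE[OF assms(2)]
  by (auto simp: H1_def)

lemma H1_inner_cong_AE:
  assumes "AE x in lebesgue_on D. u x = v x"
  shows "H1_inner D v w = H1_inner D u w"
proof -
  have "L2_inner D v w = L2_inner D u w"
    unfolding L2_inner_def
    by (intro leb.integral_cong_AE_complete) (use assms in \<open>eventually_elim, simp\<close>)
  then show ?thesis
    by (simp add: H1_inner_def grad_inner_def weak_grad_def is_weak_grad_cong_AE[OF assms])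
qed

lemma H1_inner_commute: "H1_inner D u v = H1_inner D v u"
  by (simp add: H1_inner_def L2_inner_def grad_inner_def mult.commute inner_commute)

lemma H1_inner_lincomb_left:
  assumes "u \<in> H1 D" "v \<in> H1 D" "w \<in> H1 D"
  shows "H1_inner D (\<lambda>x. a * u x + b * v x) w = a * H1_inner D u w + b * H1_inner D v w"
proof -
  have "L2_inner D (\<lambda>x. a * u x + b * v x) w = (LINT x|lebesgue_on D. a * (u x * w x) + b * (v x * w x))"
    by (simp add: L2_inner_def algebra_simps)
  also have "\<dots> = a * L2_inner D u w + b * L2_inner D v w"
    using assms[THEN H1_square_integrable] by (simp add: L2_inner_def square_integrable_mult)
  finally have 1: "L2_inner D (\<lambda>x. a * u x + b * v x) w = a * L2_inner D u w + b * L2_inner D v w" .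
  have "AE x in lebesgue_on D. weak_grad D (\<lambda>x. a * u x + b * v x) x =
      a *\<^sub>R weak_grad D u x + b *\<^sub>R weak_grad D v x"
    using assms by (intro weak_grad_AE_eqI is_weak_grad_lincomb H1_weak_grad)
  note AE_lin = this
  have "grad_inner D (\<lambda>x. a * u x + b * v x) w =
      (LINT x|lebesgue_on D. a * (weak_grad D u x \<bullet> weak_grad D w x) + b * (weak_grad D v x \<bullet> weak_grad D w x))"
    unfolding grad_inner_def
    by (intro leb.integral_cong_AE_complete) (use AE_lin in \<open>eventually_elim, simp add: inner_add_left\<close>)
  also have "\<dots> = a * grad_inner D u w + b * grad_inner D v w"
    using assms[THEN weak_grad_square_integrable] by (simp add: grad_inner_def square_integrable_inner)
  finally show ?thesis
    using 1 by (simp add: H1_inner_def algebra_simps)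
qed

lemma H1_inner_self:
  "H1_inner D u u = (LINT x|lebesgue_on D. (norm (u x))\<^sup>2) + (LINT x|lebesgue_on D. (norm (weak_grad D u x))\<^sup>2)"
  by (simp add: H1_inner_def L2_inner_def grad_inner_def power2_norm_eq_inner flip: power2_eq_square)

lemma H1_inner_self_nonneg: "H1_inner D u u \<ge> 0"
  by (simp add: H1_inner_self)

sublocale H1: semi_inner_product "H1 D" "H1_inner D"
  by unfold_locales
    (use H1_0 H1_lincomb H1_inner_commute H1_inner_lincomb_left H1_inner_self_nonneg in auto)

lemma H1_norm_nonneg: "H1_norm D u \<ge> 0"
  by (simp add: H1_norm_def H1_inner_self_nonneg)

lemma H1_norm_power2: "(H1_norm D u)\<^sup>2 = H1_inner D u u"
  by (simp add: H1_norm_def H1_inner_self_nonneg)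

lemma H1_norm_eq_0_imp_AE:
  assumes "u \<in> H1 D" "H1_norm D u = 0"
  shows "AE x in lebesgue_on D. u x = 0"
proof -
  have "H1_inner D u u = 0"
    using assms(2) H1_norm_power2[of u] by simp
  then have "(LINT x|lebesgue_on D. (norm (u x))\<^sup>2) = 0"
    using H1_inner_self[of u] by (simp add: add_nonneg_eq_0_iff)
  then show ?thesis
    using square_integral_0_imp_AE H1_square_integrable[OF assms(1)] by blast
qed

lemma H1_norm_cmult:
  assumes "u \<in> H1 D"
  shows "H1_norm D (\<lambda>x. a * u x) = \<bar>a\<bar> * H1_norm D u"
  unfolding H1_norm_def
  using assms by (simp add: H1.cmult_left H1.cmult_right H1.cmult_in real_sqrt_mult flip: mult.assoc)

lemma H1_Cauchy_Schwarz: "u \<in> H1 D \<Longrightarrow> v \<in> H1 D \<Longrightarrow> \<bar>H1_inner D u v\<bar> \<le> H1_norm D u * H1_norm D v"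
  unfolding H1_norm_def by (rule H1.Cauchy_Schwarz)

lemma H1_norm_triangle:
  assumes "u \<in> H1 D" "v \<in> H1 D"
  shows "H1_norm D (\<lambda>x. u x - v x) \<le> H1_norm D u + H1_norm D v"
proof (rule power2_le_imp_le)
  have "(H1_norm D (\<lambda>x. u x - v x))\<^sup>2 = H1_inner D u u - 2 * H1_inner D u v + H1_inner D v v"
    using H1.lincomb_self[OF assms, of "-1"] by (simp add: H1_norm_power2)
  also have "\<dots> \<le> (H1_norm D u + H1_norm D v)\<^sup>2"
    using H1_Cauchy_Schwarz[OF assms] by (simp add: power2_sum H1_norm_power2 abs_le_iff)
  finally show "(H1_norm D (\<lambda>x. u x - v x))\<^sup>2 \<le> (H1_norm D u + H1_norm D v)\<^sup>2" .
qed (simp add: H1_norm_nonneg)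

end

section \<open>Hausdorff measure on Lipschitz graphs\<close>

lemma sets_hausdorff_measure [measurable_cong]: "sets (hausdorff_measure s) = sets borel"
  unfolding hausdorff_measure_def by (simp add: sets_measure_of_conv sets.sigma_sets_eq[of borel, simplified])

text \<open>
  Only upper bounds of the Hausdorff measure are needed, so its countable additivity on Borel sets
  (without which \<^const>\<open>measure_of\<close> would return the zero measure) never has to be proved.
\<close>

lemma emeasure_hausdorff_measure_le:
  "emeasure (hausdorff_measure s) A \<le> (SUP \<delta>\<in>{0<..}. hausdorff_pre s \<delta> A)"
  by (simp add: hausdorff_measure_def emeasure_measure_of_conv)

section \<open>Geometry above a Lipschitz graph\<close>

locale lipschitz_graph =
  fixes e :: "'a::euclidean_space" and L :: real and \<psi> :: "'a \<Rightarrow> real" and p :: 'a and \<rho> \<tau> :: real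
  assumes norm_e: "norm e = 1" and lipschitz: "L-lipschitz_on UNIV \<psi>" and \<tau>_pos: "0 < \<tau>"
begin

text \<open>Signed distance to the graph of \<psi>, measured along e; \<open>foot\<close> is the
  projection onto the graph in direction e.\<close>

definition height :: "'a \<Rightarrow> real" where
  "height z = z \<bullet> e - \<psi> (z - (z \<bullet> e) *\<^sub>R e)"

definition foot :: "'a \<Rightarrow> 'a" where
  "foot z = z - height z *\<^sub>R e"

definition slab :: "'a set" where
  "slab = {z. 0 < height z \<and> height z < \<tau> \<and> foot z \<in> ball p \<rho>}"

lemma e_inner: "e \<bullet> e = 1"
  using norm_e by (simp add: norm_eq_1)

lemma height_shift: "height (z + s *\<^sub>R e) = height z + s"
  by (simp add: height_def inner_add_left e_inner scaleR_add_left)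

lemma foot_shift: "foot (z + s *\<^sub>R e) = foot z"
  by (simp add: foot_def height_shift scaleR_add_left)

lemma foot_eq: "height x = 0 \<Longrightarrow> foot x = x"
  by (simp add: foot_def)

lemma L_nonneg: "0 \<le> L"
  using lipschitz by (rule lipschitz_on_nonneg)

text \<open>The component along e contributes 1. Removing that component does not increase norms, so
  \<psi> contributes L.\<close>

lemma height_lipschitz: "\<bar>height z - height w\<bar> \<le> (1 + L) * dist z w"
proof -
  define v where "v = z - w"
  have "(norm (v - (v \<bullet> e) *\<^sub>R e))\<^sup>2 = (norm v)\<^sup>2 - (v \<bullet> e)\<^sup>2"
    unfolding power2_norm_eq_inner
    by (simp add: inner_diff_left inner_diff_right e_inner inner_commute power2_eq_square)
  then have "(norm (v - (v \<bullet> e) *\<^sub>R e))\<^sup>2 \<le> (norm v)\<^sup>2" by simp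
  then have "norm (v - (v \<bullet> e) *\<^sub>R e) \<le> norm v"
    using norm_ge_zero by (rule power2_le_imp_le)
  moreover have "v - (v \<bullet> e) *\<^sub>R e = (z - (z \<bullet> e) *\<^sub>R e) - (w - (w \<bullet> e) *\<^sub>R e)"
    by (simp add: v_def inner_diff_left scaleR_diff_left)
  ultimately have "\<bar>\<psi> (z - (z \<bullet> e) *\<^sub>R e) - \<psi> (w - (w \<bullet> e) *\<^sub>R e)\<bar> \<le> L * norm v"
    using lipschitz_onD[OF lipschitz, of "z - (z \<bullet> e) *\<^sub>R e" "w - (w \<bullet> e) *\<^sub>R e"] L_nonneg
      mult_left_mono[of _ _ L] by (force simp: dist_norm)
  moreover have "\<bar>v \<bullet> e\<bar> \<le> norm v"
    using Cauchy_Schwarz_ineq2[of v e] norm_e by simp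
  ultimately show ?thesis
    by (simp add: height_def v_def inner_diff_left dist_norm algebra_simps)
qed

lemma foot_lipschitz: "dist (foot z) (foot w) \<le> (2 + L) * dist z w"
proof -
  have "foot z - foot w = (z - w) - (height z - height w) *\<^sub>R e"
    by (simp add: foot_def scaleR_diff_left)
  then have "dist (foot z) (foot w) \<le> norm (z - w) + \<bar>height z - height w\<bar>"
    using norm_triangle_ineq4[of "z - w" "(height z - height w) *\<^sub>R e"] norm_e by (simp add: dist_norm)
  with height_lipschitz[of z w] show ?thesis
    by (simp add: dist_norm algebra_simps)
qed

lemma continuous_on_height [continuous_intros]: "continuous_on S height"
  by (rule lipschitz_on_continuous_on[of "1 + L"])
    (use L_nonneg height_lipschitz in \<open>auto intro!: lipschitz_onI simp: dist_real_def\<close>)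

lemma continuous_on_foot [continuous_intros]: "continuous_on S foot"
  by (rule lipschitz_on_continuous_on[of "2 + L"])
    (use L_nonneg foot_lipschitz in \<open>auto intro!: lipschitz_onI\<close>)

lemma measurable_foot [measurable]: "foot \<in> borel_measurable borel"
  by (intro borel_measurable_continuous_onI continuous_intros)

lemma open_slab: "open slab"
proof -
  have "slab = height -` {0<..<\<tau>} \<inter> foot -` ball p \<rho>"
    by (auto simp: slab_def)
  then show ?thesis
    by (auto intro!: open_vimage continuous_intros)
qed

lemma slab_borel [measurable]: "slab \<in> sets borel"
  using open_slab by simp

lemma slab_subset: "slab \<subseteq> ball p (\<rho> + \<tau>)"
proof
  fix z assume "z \<in> slab"
  then have "dist p (foot z) < \<rho>" "dist (foot z) z < \<tau>"
    using norm_e by (auto simp: slab_def foot_def dist_norm)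
  then show "z \<in> ball p (\<rho> + \<tau>)"
    using dist_triangle[of p z "foot z"] by simp
qed

text \<open>Lebesgue measure of the slab pushed down to the graph, in effect \<tau> times the volume
  of the shadow of a set in direction e. It is the finite Borel measure with which the Hausdorff
  measure is compared.\<close>

definition graph_measure :: "'a measure" where
  "graph_measure = distr (density lborel (indicator slab)) borel foot"

lemma sets_graph_measure [simp, measurable_cong]: "sets graph_measure = sets borel"
  by (simp add: graph_measure_def)

lemma emeasure_graph_measure:
  assumes [measurable]: "A \<in> sets borel"
  shows "emeasure graph_measure A = emeasure lborel (slab \<inter> foot -` A)"
proof -
  have [measurable]: "foot -` A \<in> sets borel"
    using measurable_sets[OF measurable_foot assms] by simp
  show ?thesis
    unfolding graph_measure_def
    by (simp add: emeasure_distr emeasure_density flip: indicator_inter_arith) 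
qed

lemma nn_integral_graph_measure:
  assumes [measurable]: "g \<in> borel_measurable borel"
  shows "(\<integral>\<^sup>+x. g x \<partial>graph_measure) = (\<integral>\<^sup>+z. g (foot z) * indicator slab z \<partial>lborel)"
  unfolding graph_measure_def
  by (simp add: nn_integral_distr nn_integral_density mult.commute)

lemma graph_measure_finite: "emeasure graph_measure A < \<infinity>"
proof -
  have "emeasure graph_measure A \<le> emeasure graph_measure UNIV"
    using emeasure_space[of graph_measure A] by (simp add: sets_eq_imp_space_eq[OF sets_graph_measure])
  also have "\<dots> \<le> emeasure lborel (ball p (\<rho> + \<tau>))"
    using slab_subset by (simp add: emeasure_graph_measure emeasure_mono)
  also have "\<dots> < \<infinity>"
    by (rule emeasure_bounded_finite) simp
  finally show ?thesis .
qed

text \<open>The total volume of \<tau> / (4 t) balls of radius t / (2 + L), divided by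
  t^(d-1).\<close>

definition density_const :: real where
  "density_const = \<tau> / 4 * (1 / (2 + L)) ^ DIM('a) * unit_ball_vol (real DIM('a))"

lemma density_const_pos: "0 < density_const"
  using \<tau>_pos L_nonneg by (simp add: density_const_def)

text \<open>
  The part of the slab above a ball of radius \<open>t\<close> contains about \<open>\<tau> / t\<close> disjoint balls of radius
  comparable to \<open>t\<close>, stacked in direction \<open>e\<close>.
\<close>

lemma graph_measure_ball_ge:
  assumes x: "height x = 0" and t: "0 < t" "4 * t \<le> \<tau>" and sub: "ball x t \<subseteq> ball p \<rho>"
  shows "ennreal (density_const * (t ^ DIM('a) / t)) \<le> emeasure graph_measure (ball x t)"
proof -
  define \<kappa> where "\<kappa> = 1 / (2 + L)"
  have \<kappa>: "0 < \<kappa>" "(2 + L) * \<kappa> = 1" using L_nonneg by (auto simp: \<kappa>_def)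
  \<comment> \<open>Each ball gets a layer of height 2 t. Rounding down costs at most a factor 2,
    because \<open>4 * t \<le> \<tau>\<close>.\<close>
  define M where "M = nat \<lfloor>\<tau> / (2 * t)\<rfloor>"
  have M: "real M \<le> \<tau> / (2 * t)" "\<tau> / (4 * t) \<le> real M"
  proof -
    have "\<tau> / (4 * t) \<ge> 1" using t by (simp add: field_simps)
    moreover have "\<tau> / (2 * t) = 2 * (\<tau> / (4 * t))" by simp
    ultimately show "real M \<le> \<tau> / (2 * t)" "\<tau> / (4 * t) \<le> real M"
      unfolding M_def by linarith+
  qed
  \<comment> \<open>Centred in the middle of the m-th layer above x. The radius is small enough for
    the Lipschitz bounds to keep heights within the layer and feet within
    \<open>ball x t\<close>.\<close>
  define B where "B m = ball (x + (t * (2 * real m + 1)) *\<^sub>R e) (\<kappa> * t)" for m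
  have B: "2 * real m * t < height z \<and> height z < (2 * real m + 2) * t \<and> foot z \<in> ball x t"
    if "z \<in> B m" for z m
  proof -
    define y where "y = x + (t * (2 * real m + 1)) *\<^sub>R e"
    have d: "dist y z < \<kappa> * t" using that by (simp add: B_def y_def)
    have "(2 + L) * dist y z < (2 + L) * (\<kappa> * t)"
      using d L_nonneg by (intro mult_strict_left_mono) auto
    then have *: "(2 + L) * dist y z < t" using \<kappa>(2) by (simp flip: mult.assoc)
    have "foot y = x" "height y = t * (2 * real m + 1)"
      using x by (simp_all add: y_def foot_shift height_shift foot_eq)
    moreover have "(1 + L) * dist y z \<le> (2 + L) * dist y z"
      by (intro mult_right_mono) auto
    ultimately have "dist x (foot z) < t" "\<bar>t * (2 * real m + 1) - height z\<bar> < t"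
      using * foot_lipschitz[of y z] height_lipschitz[of y z] by (auto simp del: zero_le_dist)
    then show ?thesis by (auto simp: algebra_simps abs_less_iff)
  qed
  have B_sets: "B m \<in> sets lborel" for m by (simp add: B_def)
  have disj: "disjoint_family_on B {..<M}"
  proof -
    have "False" if "m < n" "z \<in> B m" "z \<in> B n" for m n z
    proof -
      have "(2 * real m + 2) * t \<le> 2 * real n * t"
        using that(1) t(1) by (intro mult_right_mono) auto
      with B[OF that(2)] B[OF that(3)] show False by linarith
    qed
    then have "B m \<inter> B n = {}" if "m \<noteq> n" for m n
      using that by (metis disjoint_iff linorder_neqE_nat)
    then show ?thesis by (simp add: disjoint_family_on_def)
  qed
  have sub': "(\<Union>m<M. B m) \<subseteq> slab \<inter> foot -` ball x t"
  proof
    fix z assume "z \<in> (\<Union>m<M. B m)"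
    then obtain m where m: "m < M" "z \<in> B m" by auto
    have "(2 * real m + 2) * t \<le> 2 * real M * t"
      using m(1) t(1) by (intro mult_right_mono) auto
    also have "\<dots> \<le> \<tau>" using M(1) t(1) by (simp add: field_simps)
    finally have "height z < \<tau>" using B[OF m(2)] by linarith
    moreover have "0 \<le> 2 * real m * t" using t(1) by simp
    then have "0 < height z" using B[OF m(2)] by linarith
    ultimately show "z \<in> slab \<inter> foot -` ball x t"
      using B[OF m(2)] sub by (auto simp: slab_def)
  qed
  have "density_const * (t ^ DIM('a) / t) = \<tau> / (4 * t) * (unit_ball_vol (real DIM('a)) * (\<kappa> * t) ^ DIM('a))"
    using t(1) by (simp add: density_const_def \<kappa>_def power_mult_distrib field_simps)
  also have "\<dots> \<le> real M * (unit_ball_vol (real DIM('a)) * (\<kappa> * t) ^ DIM('a))"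
    using M(2) \<kappa>(1) t(1) by (intro mult_right_mono) auto
  finally have "ennreal (density_const * (t ^ DIM('a) / t)) \<le> ennreal (real M * (unit_ball_vol (real DIM('a)) * (\<kappa> * t) ^ DIM('a)))"
    by (rule ennreal_leI)
  also have "\<dots> = (\<Sum>m<M. emeasure lborel (B m))"
    using \<kappa>(1) t(1) by (simp add: B_def emeasure_ball ennreal_mult' ennreal_of_nat_eq_real_of_nat)
  also have "\<dots> = emeasure lborel (\<Union>m<M. B m)"
    using disj B_sets by (intro sum_emeasure) auto
  also have "\<dots> \<le> emeasure lborel (slab \<inter> foot -` ball x t)"
    using sub' measurable_sets[OF measurable_foot, of "ball x t"] by (intro emeasure_mono) auto
  finally show ?thesis by (simp add: emeasure_graph_measure)
qed

text \<open>The 5 is the dilation factor of the Vitali covering; dividing by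
  \<open>density_const\<close> trades t^(d-1) for the graph measure of a ball of radius t.\<close>

definition hausdorff_const :: real where
  "hausdorff_const = unit_ball_vol (real DIM('a) - 1) * 5 powr (real DIM('a) - 1) / density_const"

lemma hausdorff_const_nonneg: "0 \<le> hausdorff_const"
  using density_const_pos by (simp add: hausdorff_const_def)

text \<open>Vitali selects disjoint small balls in U whose fivefold dilates cover A. The dilates
  bound the Hausdorff sum, and each term is controlled by the graph measure of the undilated ball;
  these measures add up to at most that of U.\<close>

lemma hausdorff_pre_le:
  assumes U: "open U" "U \<subseteq> ball p \<rho>" and A: "A \<subseteq> U" "\<And>x. x \<in> A \<Longrightarrow> height x = 0" and \<delta>: "0 < \<delta>"
  shows "hausdorff_pre (real DIM('a) - 1) \<delta> A \<le> ennreal hausdorff_const * emeasure graph_measure U"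
proof -
  let ?s = "real DIM('a) - 1"
  \<comment> \<open>\<open>4 * t \<le> \<tau>\<close> is for the density estimate,
    \<open>10 * t \<le> \<delta>\<close> bounds the diameter of the dilated ball.\<close>
  have "\<exists>t>0. ball x t \<subseteq> U \<and> 4 * t \<le> \<tau> \<and> 10 * t \<le> \<delta>" if "x \<in> A" for x
  proof -
    obtain r where r: "r > 0" "ball x r \<subseteq> U"
      using U(1) A(1) \<open>x \<in> A\<close> by (meson open_contains_ball subsetD)
    show ?thesis
      by (rule exI[of _ "min r (min (\<tau> / 4) (\<delta> / 10))"]) (use r \<tau>_pos \<delta> in auto)
  qed
  then obtain t where t: "\<And>x. x \<in> A \<Longrightarrow> 0 < t x \<and> ball x (t x) \<subseteq> U \<and> 4 * t x \<le> \<tau> \<and> 10 * t x \<le> \<delta>"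
    by metis
  have cover: "A \<subseteq> (\<Union>x\<in>A. ball x (t x))" using t by fastforce
  have radii: "0 < t x \<and> t x \<le> \<tau>" if "x \<in> A" for x using t[OF that] by auto
  obtain C where C: "countable C" "C \<subseteq> A"
    "pairwise (\<lambda>x y. disjnt (ball x (t x)) (ball y (t y))) C" "A \<subseteq> (\<Union>x\<in>C. ball x (5 * t x))"
    by (rule Vitali_covering_lemma_balls[OF cover radii]) (auto intro: that)
  \<comment> \<open>The definition asks for a sequence of covering sets, while C may be finite: the
    remaining indices get the empty set, which contributes 0.\<close>
  define J where "J = to_nat_on C ` C"
  define c where "c = from_nat_into C"
  have c: "c j \<in> C" if "j \<in> J" for j
    using that by (auto simp: J_def c_def C(1))
  have c_inj: "i = j" if "i \<in> J" "j \<in> J" "c i = c j" for i j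
    using that by (auto simp: J_def c_def C(1))
  define V where "V j = (if j \<in> J then ball (c j) (5 * t (c j)) else {})" for j
  define B where "B j = (if j \<in> J then ball (c j) (t (c j)) else {})" for j
  have cover_V: "A \<subseteq> (\<Union>j. V j)"
  proof
    fix x assume "x \<in> A"
    then obtain y where y: "y \<in> C" "x \<in> ball y (5 * t y)" using C(4) by blast
    then have "to_nat_on C y \<in> J" "c (to_nat_on C y) = y"
      using C(1) by (auto simp: J_def c_def)
    with y have "x \<in> V (to_nat_on C y)" by (simp add: V_def)
    then show "x \<in> (\<Union>j. V j)" by blast
  qed
  have diam: "diameter (ball y (5 * t y)) \<le> 10 * t y" if "y \<in> C" for y
    using t[of y] that C(2) by (auto simp: diameter_ball)
  have V: "bounded (V j)" "diameter (V j) \<le> \<delta>" for j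
    using diam[of "c j"] c[of j] t[of "c j"] C(2) \<delta> by (auto simp: V_def subset_eq)
  have "hausdorff_pre ?s \<delta> A \<le> (\<Sum>j. ennreal (unit_ball_vol ?s * (diameter (V j) / 2) powr ?s))"
    unfolding hausdorff_pre_def by (rule INF_lower) (use cover_V V in auto)
  also have "\<dots> \<le> (\<Sum>j. ennreal hausdorff_const * emeasure graph_measure (B j))"
  proof (rule suminf_le)
    fix j
    show "ennreal (unit_ball_vol ?s * (diameter (V j) / 2) powr ?s) \<le> ennreal hausdorff_const * emeasure graph_measure (B j)"
    proof (cases "j \<in> J")
      case True
      define y where "y = c j"
      have y: "y \<in> C" "y \<in> A" using True c C(2) by (auto simp: y_def)
      have ty: "0 < t y" "ball y (t y) \<subseteq> ball p \<rho>" "4 * t y \<le> \<tau>"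
        using t[OF y(2)] U(2) by auto
      have "(diameter (ball y (5 * t y)) / 2) powr ?s \<le> (5 * t y) powr ?s"
        using diam[OF y(1)] DIM_positive[where 'a='a]
        by (intro powr_mono2) (auto simp: diameter_ge_0 Suc_le_eq)
      also have "\<dots> = 5 powr ?s * (t y ^ DIM('a) / t y)"
        using ty(1) by (simp add: powr_mult powr_diff powr_realpow)
      finally have "unit_ball_vol ?s * (diameter (V j) / 2) powr ?s \<le>
          unit_ball_vol ?s * (5 powr ?s * (t y ^ DIM('a) / t y))"
        using True DIM_positive[where 'a='a] by (intro mult_left_mono) (auto simp: V_def y_def)
      also have "\<dots> = hausdorff_const * (density_const * (t y ^ DIM('a) / t y))"
        using density_const_pos by (simp add: hausdorff_const_def)
      finally have "ennreal (unit_ball_vol ?s * (diameter (V j) / 2) powr ?s) \<le>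
          ennreal hausdorff_const * ennreal (density_const * (t y ^ DIM('a) / t y))"
        using hausdorff_const_nonneg by (metis ennreal_leI ennreal_mult')
      also have "\<dots> \<le> ennreal hausdorff_const * emeasure graph_measure (B j)"
        using graph_measure_ball_ge[OF A(2)[OF y(2)] ty(1,3,2)] True
        by (intro mult_left_mono) (auto simp: B_def y_def)
      finally show ?thesis .
    qed (simp add: V_def)
  qed auto
  also have "\<dots> = ennreal hausdorff_const * emeasure graph_measure (\<Union>j. B j)"
  proof -
    have "disjoint_family B"
      unfolding disjoint_family_on_def
    proof (intro ballI impI)
      fix i j :: nat assume "i \<noteq> j"
      show "B i \<inter> B j = {}"
      proof (cases "i \<in> J \<and> j \<in> J")
        case True
        then have "c i \<noteq> c j" using c_inj \<open>i \<noteq> j\<close> by blast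
        then have "disjnt (ball (c i) (t (c i))) (ball (c j) (t (c j)))"
          using pairwiseD[OF C(3) c c] True by blast
        with True show ?thesis by (simp add: B_def disjnt_def)
      qed (auto simp: B_def)
    qed
    then show ?thesis
      by (subst ennreal_suminf_cmult, subst suminf_emeasure) (auto simp: B_def)
  qed
  also have "\<dots> \<le> ennreal hausdorff_const * emeasure graph_measure U"
    using t c C(2) U(1) by (intro mult_left_mono emeasure_mono) (auto simp: B_def split: if_splits)
  finally show ?thesis .
qed

text \<open>Outer regularity of \<open>graph_measure\<close> replaces the open neighbourhood U by A
  itself. The bound does not depend on \<delta>, so it passes to the supremum.\<close>

lemma emeasure_hausdorff_le:
  assumes A: "A \<in> sets borel" "A \<subseteq> ball p \<rho>" "\<And>x. x \<in> A \<Longrightarrow> height x = 0"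
  shows "emeasure (hausdorff_measure (real DIM('a) - 1)) A \<le> ennreal hausdorff_const * emeasure graph_measure A"
proof -
  have "hausdorff_pre (real DIM('a) - 1) \<delta> A \<le> ennreal hausdorff_const * emeasure graph_measure A"
    if "\<delta> > 0" for \<delta>
  proof -
    have step: "hausdorff_pre (real DIM('a) - 1) \<delta> A \<le> ennreal hausdorff_const * emeasure graph_measure U"
      if U: "A \<subseteq> U" "open U" for U
    proof -
      have "hausdorff_pre (real DIM('a) - 1) \<delta> A \<le> ennreal hausdorff_const * emeasure graph_measure (U \<inter> ball p \<rho>)"
        using U A \<open>\<delta> > 0\<close> by (intro hausdorff_pre_le) auto
      also have "\<dots> \<le> ennreal hausdorff_const * emeasure graph_measure U"
        using U by (intro mult_left_mono emeasure_mono) auto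
      finally show ?thesis .
    qed
    have "emeasure graph_measure (space graph_measure) \<noteq> \<infinity>"
      using graph_measure_finite by (metis less_irrefl)
    then have INF: "emeasure graph_measure A = (INF U\<in>{U. A \<subseteq> U \<and> open U}. emeasure graph_measure U)"
      using A(1) by (intro outer_regular) auto
    show ?thesis
    proof (rule ennreal_le_epsilon)
      fix \<epsilon> :: real assume "0 < \<epsilon>"
      \<comment> \<open>The added 1 guards against division by zero.\<close>
      define \<eta> where "\<eta> = \<epsilon> / (hausdorff_const + 1)"
      have \<eta>: "0 < \<eta>" "hausdorff_const * \<eta> \<le> \<epsilon>"
        using \<open>0 < \<epsilon>\<close> hausdorff_const_nonneg by (auto simp: \<eta>_def field_simps)
      have "(INF U\<in>{U. A \<subseteq> U \<and> open U}. emeasure graph_measure U) < emeasure graph_measure A + ennreal \<eta>"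
        using graph_measure_finite[of A] \<eta>(1) unfolding INF[symmetric] by (cases "emeasure graph_measure A") (auto simp: ennreal_less_iff simp flip: ennreal_plus)
      then obtain U where U: "A \<subseteq> U" "open U" "emeasure graph_measure U < emeasure graph_measure A + ennreal \<eta>"
        by (auto simp: INF_less_iff)
      have "hausdorff_pre (real DIM('a) - 1) \<delta> A \<le> ennreal hausdorff_const * (emeasure graph_measure A + ennreal \<eta>)"
        using U(3) by (intro order_trans[OF step[OF U(1,2)]] mult_left_mono) auto
      also have "\<dots> = ennreal hausdorff_const * emeasure graph_measure A + ennreal (hausdorff_const * \<eta>)"
        using hausdorff_const_nonneg by (simp add: distrib_left ennreal_mult')
      also have "\<dots> \<le> ennreal hausdorff_const * emeasure graph_measure A + ennreal \<epsilon>"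
        using \<eta>(2) by (intro add_left_mono ennreal_leI)
      finally show "hausdorff_pre (real DIM('a) - 1) \<delta> A \<le> ennreal hausdorff_const * emeasure graph_measure A + ennreal \<epsilon>" .
    qed
  qed
  then show ?thesis
    using emeasure_hausdorff_measure_le[of "real DIM('a) - 1" A]
    by (meson SUP_least greaterThan_iff order_trans)
qed

text \<open>The estimate on Borel subsets of S is an inequality between measures, so it passes to
  integrals; pulling back along \<open>foot\<close> turns the bound into a volume integral.\<close>

lemma nn_integral_hausdorff_le:
  assumes S: "S \<in> sets borel" "S \<subseteq> ball p \<rho>" "\<And>x. x \<in> S \<Longrightarrow> height x = 0"
    and [measurable]: "g \<in> borel_measurable borel"
  shows "(\<integral>\<^sup>+x. g x * indicator S x \<partial>hausdorff_measure (real DIM('a) - 1)) \<le>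
    ennreal hausdorff_const * (\<integral>\<^sup>+z. g (foot z) * indicator slab z \<partial>lborel)"
proof -
  let ?H = "hausdorff_measure (real DIM('a) - 1) :: 'a measure"
  note [measurable] = S(1)
  have "(\<integral>\<^sup>+x. g x * indicator S x \<partial>?H) = (\<integral>\<^sup>+x. g x \<partial>density ?H (indicator S))"
    by (simp add: nn_integral_density mult.commute)
  also have "\<dots> \<le> (\<integral>\<^sup>+x. g x \<partial>scale_measure (ennreal hausdorff_const) graph_measure)"
  proof (rule nn_integral_mono_measure)
    show "density ?H (indicator S) \<le> scale_measure (ennreal hausdorff_const) graph_measure"
    proof -
      have "emeasure (density ?H (indicator S)) A \<le> emeasure (scale_measure (ennreal hausdorff_const) graph_measure) A"
        if "A \<in> sets (density ?H (indicator S))" for A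
      proof -
        have [measurable]: "A \<in> sets borel" using that by (simp add: sets_hausdorff_measure)
        have "emeasure (density ?H (indicator S)) A = emeasure ?H (S \<inter> A)"
          by (simp add: emeasure_density flip: indicator_inter_arith)
        also have "\<dots> \<le> ennreal hausdorff_const * emeasure graph_measure (S \<inter> A)"
          using S by (intro emeasure_hausdorff_le) auto
        also have "\<dots> \<le> ennreal hausdorff_const * emeasure graph_measure A"
          by (intro mult_left_mono emeasure_mono) auto
        finally show ?thesis by simp
      qed
      then show ?thesis
        by (subst le_measure) (auto simp: sets_hausdorff_measure)
    qed
  qed (simp add: sets_hausdorff_measure)
  also have "\<dots> = ennreal hausdorff_const * (\<integral>\<^sup>+x. g x \<partial>graph_measure)"
    by (rule nn_integral_scale_measure) simp
  finally show ?thesis by (simp add: nn_integral_graph_measure)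
qed

text \<open>Fundamental theorem of calculus for \<phi>^2 on the segment from \<open>foot z\<close>
  up to z, with 2 \<bar>\<phi>\<bar> \<bar>grad \<phi>\<bar> at most k. The range of s is then
  widened to an interval independent of z, which prepares for Fubini.\<close>

lemma square_foot_le:
  assumes \<phi>: "smooth \<phi>" and z: "z \<in> slab"
  defines "k \<equiv> \<lambda>x. (\<phi> x)\<^sup>2 + (norm (grad \<phi> x))\<^sup>2"
  shows "ennreal ((\<phi> (foot z))\<^sup>2) \<le>
    ennreal ((\<phi> z)\<^sup>2) + (\<integral>\<^sup>+s. ennreal (k (z + s *\<^sub>R e)) * indicator slab (z + s *\<^sub>R e) * indicator {-\<tau><..<0} s \<partial>lborel)"
proof -
  define h where "h = height z"
  have h: "0 < h" "h < \<tau>" using z by (auto simp: slab_def h_def)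
  let ?y = "\<lambda>s. z + s *\<^sub>R e"
  have "((\<lambda>s. (\<phi> (?y s))\<^sup>2) has_real_derivative 2 * \<phi> (?y s) * (grad \<phi> (?y s) \<bullet> e)) (at s within S)" for s S
  proof -
    have "((\<lambda>s. \<phi> (?y s)) has_derivative (\<lambda>t. grad \<phi> (?y s) \<bullet> (t *\<^sub>R e))) (at s)"
      by (rule has_derivative_compose[of ?y _ s UNIV \<phi>])
        (use smooth_has_derivative[OF \<phi>] in \<open>auto intro!: derivative_eq_intros\<close>)
    then have "((\<lambda>s. \<phi> (?y s)) has_real_derivative grad \<phi> (?y s) \<bullet> e) (at s)"
      unfolding has_field_derivative_def by (rule has_derivative_eq_rhs) (simp add: fun_eq_iff)
    from DERIV_power[OF this, of 2]
    have "((\<lambda>s. (\<phi> (?y s))\<^sup>2) has_real_derivative 2 * \<phi> (?y s) * (grad \<phi> (?y s) \<bullet> e)) (at s)"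
      by (simp add: mult_ac)
    then show ?thesis by (rule has_field_derivative_at_within)
  qed
  then have FTC: "((\<lambda>s. 2 * \<phi> (?y s) * (grad \<phi> (?y s) \<bullet> e)) has_integral (\<phi> (?y 0))\<^sup>2 - (\<phi> (?y (-h)))\<^sup>2) {-h..0}"
    using h by (intro fundamental_theorem_of_calculus) (auto simp: has_real_derivative_iff_has_vector_derivative)
  have "continuous_on {-h..0} (\<lambda>s. k (?y s))"
    unfolding k_def
    by (intro continuous_intros continuous_on_compose2[OF continuous_on_smooth[OF \<phi>]]
        continuous_on_compose2[OF continuous_on_grad[OF \<phi>]]) auto
  then have "(\<lambda>s. k (?y s)) integrable_on {-h..0}" by (rule integrable_continuous_real)
  then obtain I where I: "((\<lambda>s. k (?y s)) has_integral I) {-h..0}" by blast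
  have "- (2 * \<phi> x * (grad \<phi> x \<bullet> e)) \<le> k x" for x
  proof -
    have "\<bar>grad \<phi> x \<bullet> e\<bar> \<le> norm (grad \<phi> x)"
      using Cauchy_Schwarz_ineq2[of "grad \<phi> x" e] norm_e by simp
    then have "(grad \<phi> x \<bullet> e)\<^sup>2 \<le> (norm (grad \<phi> x))\<^sup>2"
      by (simp add: abs_le_square_iff[symmetric])
    moreover have "0 \<le> (\<phi> x + grad \<phi> x \<bullet> e)\<^sup>2" by simp
    ultimately show ?thesis by (simp add: k_def power2_sum)
  qed
  then have "- ((\<phi> (?y 0))\<^sup>2 - (\<phi> (?y (-h)))\<^sup>2) \<le> I"
    using has_integral_le[OF has_integral_neg[OF FTC] I] by simp
  then have "(\<phi> (foot z))\<^sup>2 \<le> (\<phi> z)\<^sup>2 + I"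
    by (simp add: foot_def h_def)
  then have "ennreal ((\<phi> (foot z))\<^sup>2) \<le> ennreal ((\<phi> z)\<^sup>2 + I)"
    by (rule ennreal_leI)
  also have "\<dots> = ennreal ((\<phi> z)\<^sup>2) + ennreal I"
    using has_integral_nonneg[OF I] by (intro ennreal_plus) (auto simp: k_def)
  also have "ennreal I = (\<integral>\<^sup>+s. ennreal (indicator {-h..0} s * k (?y s)) \<partial>lborel)"
    by (rule nn_integral_has_integral_lebesgue[symmetric, OF _ I]) (simp add: k_def)
  also have "\<dots> \<le> (\<integral>\<^sup>+s. ennreal (k (?y s)) * indicator slab (?y s) * indicator {-\<tau><..<0} s \<partial>lborel)"
  proof (rule nn_integral_mono_AE)
    \<comment> \<open>The two endpoints are discarded because the slab and the interval of s are
      both defined by strict inequalities.\<close>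
    have "AE s in lborel. s \<noteq> -h \<and> s \<noteq> (0::real)"
      by (intro AE_conjI AE_lborel_singleton)
    then show "AE s in lborel. ennreal (indicator {-h..0} s * k (?y s)) \<le>
        ennreal (k (?y s)) * indicator slab (?y s) * indicator {-\<tau><..<0} s"
    proof eventually_elim
      case (elim s)
      show ?case
      proof (cases "s \<in> {-h..0}")
        case True
        with elim h have "s \<in> {-\<tau><..<0}" "?y s \<in> slab"
          using z by (auto simp: slab_def height_shift foot_shift h_def)
        then show ?thesis using True by simp
      qed simp
    qed
  qed
  finally show ?thesis by (simp add: add_left_mono)
qed

text \<open>Integrate \<open>square_foot_le\<close> over the slab. After Fubini, translation
  invariance turns the integral in z for each s into the full slab integral; the interval of s has
  length \<tau>, and the term \<phi>^2 accounts for the 1 in 1 + \<tau>.\<close>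

theorem local_trace_inequality:
  assumes S: "S \<in> sets borel" "S \<subseteq> ball p \<rho>" "\<And>x. x \<in> S \<Longrightarrow> height x = 0" and \<phi>: "smooth \<phi>"
  shows "(\<integral>\<^sup>+x. ennreal ((\<phi> x)\<^sup>2) * indicator S x \<partial>hausdorff_measure (real DIM('a) - 1)) \<le>
    ennreal (hausdorff_const * (1 + \<tau>)) *
      (\<integral>\<^sup>+z. ennreal ((\<phi> z)\<^sup>2 + (norm (grad \<phi> z))\<^sup>2) * indicator slab z \<partial>lborel)"
proof -
  note [measurable] = borel_measurable_smooth[OF \<phi>] borel_measurable_grad[OF \<phi>]
  define k where "k x = (\<phi> x)\<^sup>2 + (norm (grad \<phi> x))\<^sup>2" for x
  have [measurable]: "k \<in> borel_measurable borel" unfolding k_def[abs_def] by measurable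
  let ?K = "\<lambda>z. ennreal (k z) * indicator slab z"
  let ?I = "\<integral>\<^sup>+z. ?K z \<partial>lborel"
  have "(\<integral>\<^sup>+z. ennreal ((\<phi> (foot z))\<^sup>2) * indicator slab z \<partial>lborel) \<le>
      (\<integral>\<^sup>+z. ?K z + (\<integral>\<^sup>+s. ?K (z + s *\<^sub>R e) * indicator {-\<tau><..<0} s \<partial>lborel) \<partial>lborel)"
  proof (rule nn_integral_mono)
    fix z
    have "ennreal ((\<phi> z)\<^sup>2) \<le> ennreal (k z)" by (rule ennreal_leI) (simp add: k_def)
    then show "ennreal ((\<phi> (foot z))\<^sup>2) * indicator slab z \<le>
        ?K z + (\<integral>\<^sup>+s. ?K (z + s *\<^sub>R e) * indicator {-\<tau><..<0} s \<partial>lborel)"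
      using square_foot_le[OF \<phi>, of z] unfolding k_def[symmetric]
      by (auto split: split_indicator intro: order_trans add_right_mono)
  qed
  also have "\<dots> = ?I + (\<integral>\<^sup>+z. \<integral>\<^sup>+s. ?K (z + s *\<^sub>R e) * indicator {-\<tau><..<0} s \<partial>lborel \<partial>lborel)"
    by (intro nn_integral_add) measurable
  also have "(\<integral>\<^sup>+z. \<integral>\<^sup>+s. ?K (z + s *\<^sub>R e) * indicator {-\<tau><..<0} s \<partial>lborel \<partial>lborel) =
      (\<integral>\<^sup>+s. \<integral>\<^sup>+z. ?K (z + s *\<^sub>R e) * indicator {-\<tau><..<0} s \<partial>lborel \<partial>lborel)"
    by (rule lborel_pair.Fubini') measurable
  also have "\<dots> = (\<integral>\<^sup>+s. ?I * indicator {-\<tau><..<0} s \<partial>lborel)"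
  proof (rule nn_integral_cong)
    fix s :: real
    have "(\<integral>\<^sup>+z. ?K (s *\<^sub>R e + z) \<partial>lborel) = ?I"
      using nn_integral_distr[of "(+) (s *\<^sub>R e)" lborel borel ?K] by (simp add: lborel_distr_plus)
    then show "(\<integral>\<^sup>+z. ?K (z + s *\<^sub>R e) * indicator {-\<tau><..<0} s \<partial>lborel) = ?I * indicator {-\<tau><..<0} s"
      by (subst nn_integral_multc) (auto simp: add.commute)
  qed
  also have "\<dots> = ?I * ennreal \<tau>"
    using \<tau>_pos by (simp add: nn_integral_cmult_indicator)
  also have "?I + ?I * ennreal \<tau> = ennreal (1 + \<tau>) * ?I"
    using \<tau>_pos by (simp add: ennreal_plus[of 1 \<tau>, simplified] distrib_right mult.commute)
  finally have "ennreal hausdorff_const * (\<integral>\<^sup>+z. ennreal ((\<phi> (foot z))\<^sup>2) * indicator slab z \<partial>lborel) \<le>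
      ennreal hausdorff_const * (ennreal (1 + \<tau>) * ?I)"
    by (rule mult_left_mono) simp
  also have "\<dots> = ennreal (hausdorff_const * (1 + \<tau>)) * ?I"
    using hausdorff_const_nonneg by (simp add: ennreal_mult' mult.assoc)
  finally show ?thesis
    using order_trans[OF nn_integral_hausdorff_le[OF S, of "\<lambda>x. ennreal ((\<phi> x)\<^sup>2)"]]
    by (simp add: k_def)
qed

end

section \<open>The trace inequality and uniqueness of traces\<close>

locale lipschitz_domain =
  fixes D :: "'a::euclidean_space set"
  assumes lipschitz_domain: "bounded_lipschitz_domain D"
begin

sublocale bounded_open D
  using lipschitz_domain by unfold_locales (auto simp: bounded_lipschitz_domain_def)

sublocale surf: complete_measure "surface_measure D"
  unfolding surface_measure_def by (rule completion.complete_measure_axioms)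

lemma compact_frontier_domain: "compact (frontier D)"
  using bounded_domain by (rule compact_frontier_bounded)

lemma frontier_borel [measurable]: "frontier D \<in> sets borel"
  using compact_frontier_domain by (simp add: compact_imp_closed)

lemma space_surface_measure: "space (surface_measure D) = frontier D"
  by (simp add: surface_measure_def space_restrict_space)

lemma AE_surface_frontier: "AE x in surface_measure D. x \<in> frontier D"
  by (rule AE_I2) (simp add: space_surface_measure)

lemma borel_measurable_surface: "g \<in> borel_measurable borel \<Longrightarrow> g \<in> borel_measurable (surface_measure D)"
  unfolding surface_measure_def
  by (intro measurable_completion measurable_restrict_space1) (simp add: measurable_cong_sets[OF sets_hausdorff_measure refl])

lemma nn_integral_surface:
  fixes g :: "'a \<Rightarrow> ennreal"
  shows "(\<integral>\<^sup>+x. g x \<partial>surface_measure D) =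
    (\<integral>\<^sup>+x. g x * indicator (frontier D) x \<partial>hausdorff_measure (real DIM('a) - 1))"
  unfolding surface_measure_def
  by (simp add: nn_integral_completion nn_integral_restrict_space sets_hausdorff_measure)

text \<open>Links the classical gradient of the trace estimate with \<open>H1_norm\<close>, which is
  built on the chosen weak gradient.\<close>

lemma nn_integral_smooth_H1:
  assumes \<phi>: "smooth \<phi>"
  shows "(\<integral>\<^sup>+z. ennreal ((\<phi> z)\<^sup>2 + (norm (grad \<phi> z))\<^sup>2) * indicator D z \<partial>lborel) = ennreal ((H1_norm D \<phi>)\<^sup>2)"
proof -
  note sq = square_integrable_smooth[OF \<phi>]
  have int: "integrable (lebesgue_on D) (\<lambda>z. (norm (\<phi> z))\<^sup>2)" "integrable (lebesgue_on D) (\<lambda>z. (norm (grad \<phi> z))\<^sup>2)"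
    using sq by (auto simp: square_integrable_def)
  have "(LINT z|lebesgue_on D. (norm (weak_grad D \<phi> z))\<^sup>2) = (LINT z|lebesgue_on D. (norm (grad \<phi> z))\<^sup>2)"
    by (intro leb.integral_cong_AE_complete)
      (use weak_grad_AE_eqI[OF is_weak_grad_smooth[OF \<phi>]] in \<open>eventually_elim, simp\<close>)
  then have "(H1_norm D \<phi>)\<^sup>2 = (LINT z|lebesgue_on D. (norm (\<phi> z))\<^sup>2 + (norm (grad \<phi> z))\<^sup>2)"
    using int by (simp add: H1_norm_power2 H1_inner_self)
  also have "ennreal \<dots> = (\<integral>\<^sup>+z. ennreal ((norm (\<phi> z))\<^sup>2 + (norm (grad \<phi> z))\<^sup>2) \<partial>lebesgue_on D)"
    using int by (intro nn_integral_eq_integral[symmetric]) auto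
  also have "\<dots> = (\<integral>\<^sup>+z. ennreal ((\<phi> z)\<^sup>2 + (norm (grad \<phi> z))\<^sup>2) * indicator D z \<partial>lborel)"
    using sets_domain by (simp add: nn_integral_restrict_space nn_integral_completion)
  finally show ?thesis by simp
qed

text \<open>Near p the domain is the set of positive height, so the boundary has height 0 and the
  slab lies in D. Finiteness of the boundary measure is carried along to make smooth functions
  square integrable on the boundary.\<close>

lemma chart_trace_inequality:
  assumes "p \<in> frontier D"
  shows "\<exists>\<rho>>0. \<exists>C\<ge>0. emeasure (hausdorff_measure (real DIM('a) - 1)) (frontier D \<inter> ball p \<rho>) < \<infinity> \<and>
    (\<forall>\<phi>. smooth \<phi> \<longrightarrow>
      (\<integral>\<^sup>+x. ennreal ((\<phi> x)\<^sup>2) * indicator (frontier D \<inter> ball p \<rho>) x \<partial>hausdorff_measure (real DIM('a) - 1)) \<le>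
        ennreal (C * (H1_norm D \<phi>)\<^sup>2))"
proof -
  obtain r e L \<psi> where r: "r > 0" and e: "norm e = 1" and L: "L-lipschitz_on UNIV \<psi>"
    and chart: "D \<inter> ball p r = {x \<in> ball p r. (\<psi> (x - (x \<bullet> e) *\<^sub>R e) :: real) < x \<bullet> e}"
  proof -
    have "\<forall>p\<in>frontier D. \<exists>r>0. \<exists>e L \<psi>. norm e = 1 \<and> L-lipschitz_on UNIV \<psi> \<and>
        D \<inter> ball p r = {x \<in> ball p r. (\<psi> (x - (x \<bullet> e) *\<^sub>R e) :: real) < x \<bullet> e}"
      using lipschitz_domain unfolding bounded_lipschitz_domain_def by (elim conjE)
    from bspec[OF this assms] show ?thesis
      by (elim exE conjE) (rule that)
  qed
  \<comment> \<open>With radius and height both r / 2 the slab stays in \<open>ball p r\<close>,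
    where the chart describes D.\<close>
  interpret lipschitz_graph e L \<psi> p "r / 2" "r / 2"
    using r e L by unfold_locales auto
  have mem: "x \<in> D \<longleftrightarrow> 0 < height x" if "x \<in> ball p r" for x
  proof -
    have "x \<in> D \<inter> ball p r \<longleftrightarrow> 0 < height x"
      unfolding chart using that by (simp add: height_def)
    with that show ?thesis by blast
  qed
  have height0: "height x = 0" if x: "x \<in> frontier D \<inter> ball p (r / 2)" for x
  proof -
    have xr: "x \<in> ball p r" using x r by auto
    have "x \<notin> D" "x \<in> closure D"
      using x open_domain by (auto simp: frontier_def interior_open)
    have "\<not> height x < 0"
    proof
      assume "height x < 0"
      define T where "T = ball p r \<inter> height -` {..<0}"
      have "open T" "x \<in> T"
        using xr \<open>height x < 0\<close> by (auto simp: T_def intro!: open_vimage continuous_intros)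
      then have "T \<inter> D \<noteq> {}"
        using \<open>x \<in> closure D\<close> open_Int_closure_eq_empty by blast
      then show False using mem by (auto simp: T_def)
    qed
    with mem[OF xr] \<open>x \<notin> D\<close> show ?thesis by simp
  qed
  have slab: "slab \<subseteq> D"
    using slab_subset mem by (auto simp: slab_def)
  let ?H = "hausdorff_measure (real DIM('a) - 1)" and ?S = "frontier D \<inter> ball p (r / 2)"
  have "emeasure ?H ?S \<le> ennreal hausdorff_const * emeasure graph_measure ?S"
    using height0 by (intro emeasure_hausdorff_le) auto
  also have "\<dots> < \<infinity>"
    using graph_measure_finite[of ?S] by (simp add: ennreal_mult_less_top)
  finally have "emeasure ?H ?S < \<infinity>" .
  moreover have "(\<integral>\<^sup>+x. ennreal ((\<phi> x)\<^sup>2) * indicator ?S x \<partial>?H) \<le>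
      ennreal (hausdorff_const * (1 + r / 2) * (H1_norm D \<phi>)\<^sup>2)" if \<phi>: "smooth \<phi>" for \<phi>
  proof -
    have "(\<integral>\<^sup>+x. ennreal ((\<phi> x)\<^sup>2) * indicator ?S x \<partial>?H) \<le> ennreal (hausdorff_const * (1 + r / 2)) *
        (\<integral>\<^sup>+z. ennreal ((\<phi> z)\<^sup>2 + (norm (grad \<phi> z))\<^sup>2) * indicator slab z \<partial>lborel)"
      using height0 \<phi> by (intro local_trace_inequality) auto
    also have "\<dots> \<le> ennreal (hausdorff_const * (1 + r / 2)) *
        (\<integral>\<^sup>+z. ennreal ((\<phi> z)\<^sup>2 + (norm (grad \<phi> z))\<^sup>2) * indicator D z \<partial>lborel)"
      using slab by (intro mult_left_mono nn_integral_mono) (auto split: split_indicator)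
    also have "\<dots> = ennreal (hausdorff_const * (1 + r / 2) * (H1_norm D \<phi>)\<^sup>2)"
      unfolding nn_integral_smooth_H1[OF \<phi>]
      using hausdorff_const_nonneg r by (intro ennreal_mult'[symmetric]) auto
    finally show ?thesis .
  qed
  moreover have "0 \<le> hausdorff_const * (1 + r / 2)" using hausdorff_const_nonneg r by simp
  moreover have "0 < r / 2" using r by simp
  ultimately show ?thesis by blast
qed

text \<open>The boundary is compact, so finitely many charts suffice and the constants of the charts
  add up.\<close>

lemma trace_inequality_nn:
  "\<exists>C\<ge>0. emeasure (surface_measure D) (space (surface_measure D)) < \<infinity> \<and>
    (\<forall>\<phi>. smooth \<phi> \<longrightarrow> (\<integral>\<^sup>+x. ennreal ((\<phi> x)\<^sup>2) \<partial>surface_measure D) \<le> ennreal (C * (H1_norm D \<phi>)\<^sup>2))"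
proof -
  let ?H = "hausdorff_measure (real DIM('a) - 1) :: 'a measure"
  let ?S = "\<lambda>p \<rho>. frontier D \<inter> ball p \<rho>"
  define Q where "Q p \<rho> C \<longleftrightarrow> \<rho> > 0 \<and> C \<ge> 0 \<and> emeasure ?H (?S p \<rho>) < \<infinity> \<and> (\<forall>\<phi>. smooth \<phi> \<longrightarrow>
      (\<integral>\<^sup>+x. ennreal ((\<phi> x)\<^sup>2) * indicator (?S p \<rho>) x \<partial>?H) \<le> ennreal (C * (H1_norm D \<phi>)\<^sup>2))"
    for p \<rho> C
  have "\<exists>\<rho> C. Q p \<rho> C" if "p \<in> frontier D" for p
    using chart_trace_inequality[OF that] unfolding Q_def by blast
  then obtain \<rho> C where "\<And>p. p \<in> frontier D \<Longrightarrow> Q p (\<rho> p) (C p)"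
    by metis
  note chart = this[unfolded Q_def]
  have "frontier D \<subseteq> (\<Union>p\<in>frontier D. ball p (\<rho> p))" using chart by fastforce
  then obtain P where P: "P \<subseteq> frontier D" "finite P" "frontier D \<subseteq> (\<Union>p\<in>P. ball p (\<rho> p))"
    using compactE_image[OF compact_frontier_domain, of "frontier D" "\<lambda>p. ball p (\<rho> p)"] by (metis open_ball)
  have S: "?S p (\<rho> p) \<in> sets ?H" for p by (simp add: sets_hausdorff_measure)
  have ind: "indicator (frontier D) x \<le> (\<Sum>p\<in>P. indicator (?S p (\<rho> p)) x :: ennreal)" for x
  proof (cases "x \<in> frontier D")
    case True
    then obtain p where p: "p \<in> P" "x \<in> ?S p (\<rho> p)" using P(3) by blast
    then have "1 \<le> (\<Sum>p\<in>{p}. indicator (?S p (\<rho> p)) x :: ennreal)" by simp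
    also have "\<dots> \<le> (\<Sum>p\<in>P. indicator (?S p (\<rho> p)) x)"
      using P(2) p(1) by (intro sum_mono2) auto
    finally show ?thesis using True by simp
  qed simp
  have le: "(\<integral>\<^sup>+x. g x \<partial>surface_measure D) \<le> (\<Sum>p\<in>P. \<integral>\<^sup>+x. g x * indicator (?S p (\<rho> p)) x \<partial>?H)"
    if [measurable]: "g \<in> borel_measurable borel" for g :: "'a \<Rightarrow> ennreal"
  proof -
    have "(\<integral>\<^sup>+x. g x \<partial>surface_measure D) \<le> (\<integral>\<^sup>+x. g x * (\<Sum>p\<in>P. indicator (?S p (\<rho> p)) x) \<partial>?H)"
      unfolding nn_integral_surface by (intro nn_integral_mono mult_left_mono ind) simp
    also have "\<dots> = (\<Sum>p\<in>P. \<integral>\<^sup>+x. g x * indicator (?S p (\<rho> p)) x \<partial>?H)"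
      unfolding sum_distrib_left
      by (intro nn_integral_sum borel_measurable_times_ennreal borel_measurable_indicator S)
        (use that in \<open>simp add: measurable_cong_sets[OF sets_hausdorff_measure refl]\<close>)
    finally show ?thesis .
  qed
  have "emeasure (surface_measure D) (space (surface_measure D)) = (\<integral>\<^sup>+x. 1 \<partial>surface_measure D)" by simp
  also have "\<dots> \<le> (\<Sum>p\<in>P. \<integral>\<^sup>+x. 1 * indicator (?S p (\<rho> p)) x \<partial>?H)"
    by (rule le) simp
  also have "\<dots> = (\<Sum>p\<in>P. emeasure ?H (?S p (\<rho> p)))"
    using S by simp
  also have "\<dots> < \<infinity>"
    using chart P by (auto simp: less_top)
  finally have "emeasure (surface_measure D) (space (surface_measure D)) < \<infinity>" .
  moreover have "(\<integral>\<^sup>+x. ennreal ((\<phi> x)\<^sup>2) \<partial>surface_measure D) \<le> ennreal ((\<Sum>p\<in>P. C p) * (H1_norm D \<phi>)\<^sup>2)"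
    if \<phi>: "smooth \<phi>" for \<phi>
  proof -
    note [measurable] = borel_measurable_smooth[OF \<phi>]
    have "(\<integral>\<^sup>+x. ennreal ((\<phi> x)\<^sup>2) \<partial>surface_measure D) \<le>
        (\<Sum>p\<in>P. \<integral>\<^sup>+x. ennreal ((\<phi> x)\<^sup>2) * indicator (?S p (\<rho> p)) x \<partial>?H)"
      by (rule le) measurable
    also have "\<dots> \<le> (\<Sum>p\<in>P. ennreal (C p * (H1_norm D \<phi>)\<^sup>2))"
      using chart \<phi> P(1) by (intro sum_mono) blast
    also have "\<dots> = ennreal ((\<Sum>p\<in>P. C p) * (H1_norm D \<phi>)\<^sup>2)"
      using chart P(1) by (subst sum_ennreal) (auto simp: sum_distrib_right)
    finally show ?thesis .
  qed
  moreover have "0 \<le> (\<Sum>p\<in>P. C p)" using chart P(1) by (intro sum_nonneg) auto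
  ultimately show ?thesis by blast
qed

sublocale surf: finite_measure "surface_measure D"
  using trace_inequality_nn by (intro finite_measureI) auto

lemma square_integrable_surface_smooth:
  assumes \<phi>: "smooth \<phi>"
  shows "square_integrable (surface_measure D) \<phi>"
proof -
  have "bounded (\<phi> ` frontier D)"
    using compact_frontier_domain \<phi> by (intro compact_imp_bounded compact_continuous_image continuous_on_smooth)
  then obtain B where B: "\<And>x. x \<in> frontier D \<Longrightarrow> norm (\<phi> x) \<le> B"
    unfolding bounded_iff by blast
  have meas: "\<phi> \<in> borel_measurable (surface_measure D)"
    using \<phi> by (intro borel_measurable_surface borel_measurable_smooth)
  moreover have "integrable (surface_measure D) (\<lambda>x. (norm (\<phi> x))\<^sup>2)"
  proof (rule surf.integrable_const_bound)
    show "AE x in surface_measure D. norm ((norm (\<phi> x))\<^sup>2) \<le> B\<^sup>2"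
      using AE_surface_frontier
    proof eventually_elim
      case (elim x)
      then show ?case using power_mono[OF B[OF elim] norm_ge_zero, of 2] by simp
    qed
  qed (use meas in measurable)
  ultimately show ?thesis by (simp add: square_integrable_def)
qed

lemma trace_inequality:
  "\<exists>C\<ge>0. \<forall>\<phi>. smooth \<phi> \<longrightarrow> (LINT x|surface_measure D. (\<phi> x)\<^sup>2) \<le> C * (H1_norm D \<phi>)\<^sup>2"
proof -
  obtain C where C: "C \<ge> 0" "\<And>\<phi>. smooth \<phi> \<Longrightarrow>
      (\<integral>\<^sup>+x. ennreal ((\<phi> x)\<^sup>2) \<partial>surface_measure D) \<le> ennreal (C * (H1_norm D \<phi>)\<^sup>2)"
    using trace_inequality_nn by blast
  have "(LINT x|surface_measure D. (\<phi> x)\<^sup>2) \<le> C * (H1_norm D \<phi>)\<^sup>2" if \<phi>: "smooth \<phi>" for \<phi>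
  proof -
    have "integrable (surface_measure D) (\<lambda>x. (\<phi> x)\<^sup>2)"
      using square_integrable_surface_smooth[OF \<phi>] by (simp add: square_integrable_def)
    then have "ennreal (LINT x|surface_measure D. (\<phi> x)\<^sup>2) \<le> ennreal (C * (H1_norm D \<phi>)\<^sup>2)"
      using C(2)[OF \<phi>] by (subst nn_integral_eq_integral[symmetric]) auto
    then show ?thesis using C(1) by (simp add: ennreal_le_iff)
  qed
  with C(1) show ?thesis by blast
qed

text \<open>The two approximating sequences both tend to u, so their difference tends to 0 in H^1;
  being smooth, it tends to 0 on the boundary by the trace inequality. The rest is a triangle
  inequality for squares with three terms.\<close>

lemma has_trace_unique:
  assumes "has_trace D u g" "has_trace D u g'"
  shows "AE x in surface_measure D. g x = g' x"
proof -
  let ?\<sigma> = "surface_measure D"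
  obtain \<phi> where \<phi>: "\<And>n::nat. smooth (\<phi> n)" "(\<lambda>n. H1_norm D (\<lambda>x. \<phi> n x - u x)) \<longlonglongrightarrow> 0"
      "(\<lambda>n. LINT x|?\<sigma>. (\<phi> n x - g x)\<^sup>2) \<longlonglongrightarrow> 0"
    and g: "square_integrable ?\<sigma> g" and u: "u \<in> H1 D"
    using assms(1) unfolding has_trace_def by blast
  obtain \<phi>' where \<phi>': "\<And>n::nat. smooth (\<phi>' n)" "(\<lambda>n. H1_norm D (\<lambda>x. \<phi>' n x - u x)) \<longlonglongrightarrow> 0"
      "(\<lambda>n. LINT x|?\<sigma>. (\<phi>' n x - g' x)\<^sup>2) \<longlonglongrightarrow> 0"
    and g': "square_integrable ?\<sigma> g'"
    using assms(2) unfolding has_trace_def by blast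
  obtain C where C: "C \<ge> 0" "\<And>\<phi>. smooth \<phi> \<Longrightarrow> (LINT x|?\<sigma>. (\<phi> x)\<^sup>2) \<le> C * (H1_norm D \<phi>)\<^sup>2"
    using trace_inequality by blast
  have sq: "integrable ?\<sigma> (\<lambda>x. (a x - b x)\<^sup>2)" if "square_integrable ?\<sigma> a" "square_integrable ?\<sigma> b" for a b :: "'a \<Rightarrow> real"
    using square_integrable_lincomb[OF that, of 1 "-1"] by (simp add: square_integrable_def)
  define N where "N n = H1_norm D (\<lambda>x. \<phi> n x - u x) + H1_norm D (\<lambda>x. \<phi>' n x - u x)" for n
  have "(LINT x|?\<sigma>. (g x - g' x)\<^sup>2) \<le>
      3 * (LINT x|?\<sigma>. (\<phi> n x - g x)\<^sup>2) + 3 * (LINT x|?\<sigma>. (\<phi>' n x - g' x)\<^sup>2) + 3 * (C * (N n)\<^sup>2)" for n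
  proof -
    note sm = square_integrable_surface_smooth[OF \<phi>(1)[of n]] square_integrable_surface_smooth[OF \<phi>'(1)[of n]]
    have int: "integrable ?\<sigma> (\<lambda>x. (\<phi> n x - g x)\<^sup>2)" "integrable ?\<sigma> (\<lambda>x. (\<phi>' n x - g' x)\<^sup>2)"
      "integrable ?\<sigma> (\<lambda>x. (\<phi> n x - \<phi>' n x)\<^sup>2)"
      using sm g g' by (auto intro: sq)
    have "(g x - g' x)\<^sup>2 \<le> 3 * (\<phi> n x - g x)\<^sup>2 + 3 * (\<phi>' n x - g' x)\<^sup>2 + 3 * (\<phi> n x - \<phi>' n x)\<^sup>2" for x
    proof -
      define a b c where "a = \<phi> n x - g x" and "b = \<phi>' n x - g' x" and "c = \<phi> n x - \<phi>' n x"
      have eq: "g x - g' x = c - a + b" by (simp add: a_def b_def c_def)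
      \<comment> \<open>Lagrange's identity for the vectors (c, -a, b) and (1, 1, 1).\<close>
      have "3 * a\<^sup>2 + 3 * b\<^sup>2 + 3 * c\<^sup>2 - (c - a + b)\<^sup>2 = (a + b)\<^sup>2 + (a + c)\<^sup>2 + (b - c)\<^sup>2"
        by (simp add: power2_eq_square algebra_simps)
      moreover have "0 \<le> (a + b)\<^sup>2 + (a + c)\<^sup>2 + (b - c)\<^sup>2" by simp
      ultimately have "(g x - g' x)\<^sup>2 \<le> 3 * a\<^sup>2 + 3 * b\<^sup>2 + 3 * c\<^sup>2" unfolding eq by linarith
      then show ?thesis by (simp only: a_def b_def c_def)
    qed
    then have "(LINT x|?\<sigma>. (g x - g' x)\<^sup>2) \<le>
        (LINT x|?\<sigma>. 3 * (\<phi> n x - g x)\<^sup>2 + 3 * (\<phi>' n x - g' x)\<^sup>2 + 3 * (\<phi> n x - \<phi>' n x)\<^sup>2)"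
      using int by (intro integral_mono sq g g') auto
    also have "\<dots> = 3 * (LINT x|?\<sigma>. (\<phi> n x - g x)\<^sup>2) + 3 * (LINT x|?\<sigma>. (\<phi>' n x - g' x)\<^sup>2) +
        3 * (LINT x|?\<sigma>. (\<phi> n x - \<phi>' n x)\<^sup>2)"
      using int by simp
    finally have 1: "(LINT x|?\<sigma>. (g x - g' x)\<^sup>2) \<le> \<dots>" .
    have "H1_norm D (\<lambda>x. \<phi> n x - \<phi>' n x) \<le> N n"
      using H1_norm_triangle[OF H1.diff_in[OF smooth_in_H1[OF \<phi>(1)[of n]] u] H1.diff_in[OF smooth_in_H1[OF \<phi>'(1)[of n]] u]]
      by (simp add: N_def)
    then have "(H1_norm D (\<lambda>x. \<phi> n x - \<phi>' n x))\<^sup>2 \<le> (N n)\<^sup>2"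
      using H1_norm_nonneg by (intro power_mono)
    then have "(LINT x|?\<sigma>. (\<phi> n x - \<phi>' n x)\<^sup>2) \<le> C * (N n)\<^sup>2"
      using C(2)[OF smooth_diff[OF \<phi>(1)[of n] \<phi>'(1)[of n]]] C(1) mult_left_mono order_trans by blast
    with 1 show ?thesis by linarith
  qed
  moreover have "(\<lambda>n. 3 * (LINT x|?\<sigma>. (\<phi> n x - g x)\<^sup>2) + 3 * (LINT x|?\<sigma>. (\<phi>' n x - g' x)\<^sup>2) + 3 * (C * (N n)\<^sup>2))
      \<longlonglongrightarrow> 3 * 0 + 3 * 0 + 3 * (C * (0 + 0)\<^sup>2)"
    unfolding N_def by (intro tendsto_intros \<phi> \<phi>')
  ultimately have "(LINT x|?\<sigma>. (g x - g' x)\<^sup>2) \<le> 0"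
    by (intro LIMSEQ_le_const) auto
  then have "(LINT x|?\<sigma>. (norm (g x - g' x))\<^sup>2) = 0"
    by (simp add: antisym)
  then have "AE x in ?\<sigma>. g x - g' x = 0"
    using square_integrable_lincomb[OF g g', of 1 "-1"] by (intro square_integral_0_imp_AE) auto
  then show ?thesis by eventually_elim simp
qed

lemma has_trace_cmult:
  assumes "has_trace D u g"
  shows "has_trace D (\<lambda>x. c * u x) (\<lambda>x. c * g x)"
proof -
  let ?\<sigma> = "surface_measure D"
  obtain \<phi> where \<phi>: "\<And>n::nat. smooth (\<phi> n)" "(\<lambda>n. H1_norm D (\<lambda>x. \<phi> n x - u x)) \<longlonglongrightarrow> 0"
      "(\<lambda>n. LINT x|?\<sigma>. (\<phi> n x - g x)\<^sup>2) \<longlonglongrightarrow> 0"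
    and g: "square_integrable ?\<sigma> g" and u: "u \<in> H1 D"
    using assms unfolding has_trace_def by blast
  have "H1_norm D (\<lambda>x. c * \<phi> n x - c * u x) = \<bar>c\<bar> * H1_norm D (\<lambda>x. \<phi> n x - u x)" for n
    using H1_norm_cmult[OF H1.diff_in[OF smooth_in_H1[OF \<phi>(1)[of n]] u], of c] by (simp add: right_diff_distrib)
  then have "(\<lambda>n. H1_norm D (\<lambda>x. c * \<phi> n x - c * u x)) \<longlonglongrightarrow> 0"
    using tendsto_mult_right_zero[OF \<phi>(2), of "\<bar>c\<bar>"] by simp
  moreover have "(LINT x|?\<sigma>. (c * \<phi> n x - c * g x)\<^sup>2) = c\<^sup>2 * (LINT x|?\<sigma>. (\<phi> n x - g x)\<^sup>2)" for n
    by (simp add: power_mult_distrib flip: right_diff_distrib)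
  then have "(\<lambda>n. LINT x|?\<sigma>. (c * \<phi> n x - c * g x)\<^sup>2) \<longlonglongrightarrow> 0"
    using tendsto_mult_right_zero[OF \<phi>(3), of "c\<^sup>2"] by simp
  moreover have "square_integrable ?\<sigma> (\<lambda>x. c * g x)"
    using square_integrable_lincomb[OF g g, of c 0] by simp
  ultimately show ?thesis
    unfolding has_trace_def using u \<phi>(1)
    by (auto intro!: H1.cmult_in exI[of _ "\<lambda>n x. c * \<phi> n x"] smooth_cmult)
qed

text \<open>The same approximating sequence serves for v and h.\<close>

lemma has_trace_cong_AE:
  assumes "has_trace D u g" "AE x in lebesgue_on D. u x = v x" "AE x in surface_measure D. g x = h x"
  shows "has_trace D v h"
proof -
  let ?\<sigma> = "surface_measure D"
  have u: "u \<in> H1 D" using assms(1) by (simp add: has_trace_def)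
  have "H1_norm D (\<lambda>x. \<phi> x - v x) = H1_norm D (\<lambda>x. \<phi> x - u x)" if "smooth \<phi>" for \<phi>
  proof -
    have ae: "AE x in lebesgue_on D. \<phi> x - u x = \<phi> x - v x"
      using assms(2) by eventually_elim simp
    show ?thesis
      unfolding H1_norm_def H1_inner_cong_AE[OF ae]
      using H1_inner_cong_AE[OF ae] by (subst H1_inner_commute) simp
  qed
  moreover have "(LINT x|?\<sigma>. (\<phi> x - h x)\<^sup>2) = (LINT x|?\<sigma>. (\<phi> x - g x)\<^sup>2)" for \<phi>
    by (intro surf.integral_cong_AE_complete) (use assms(3) in \<open>eventually_elim, simp\<close>)
  moreover have "square_integrable ?\<sigma> h"
    using assms(1,3) surf.square_integrable_cong_AE by (auto simp: has_trace_def)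
  moreover have "v \<in> H1 D" using H1_cong_AE[OF u assms(2)] .
  ultimately show ?thesis
    using assms(1) unfolding has_trace_def by auto
qed

lemma has_trace_0: "has_trace D (\<lambda>_. 0) (\<lambda>_. 0)"
  unfolding has_trace_def
proof (intro conjI exI[of _ "\<lambda>_ _. 0"] allI)
  have "H1_norm D (\<lambda>x. 0) = 0"
    by (simp add: H1_norm_def H1.zero_left H1_0)
  then show "(\<lambda>n. H1_norm D (\<lambda>x. 0 - 0)) \<longlonglongrightarrow> 0" by simp
qed (simp_all add: H1_0 square_integrable_0 smooth_const)

end

section \<open>Diagonalisation of symmetric matrices by rotations\<close>

text \<open>Orthogonal n by n matrices. The column relations leave a sum of products unchanged, the
  row relations keep an orthonormal family orthonormal.\<close>

definition orthogonal_coeffs :: "nat \<Rightarrow> (nat \<Rightarrow> nat \<Rightarrow> real) \<Rightarrow> bool" where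
  "orthogonal_coeffs n c \<longleftrightarrow>
     (\<forall>i<n. \<forall>j<n. (\<Sum>k<n. c i k * c j k) = of_bool (i = j)) \<and>
     (\<forall>i<n. \<forall>j<n. (\<Sum>k<n. c k i * c k j) = of_bool (i = j))"

lemma orthogonal_coeffs_sum:
  assumes "orthogonal_coeffs n c"
  shows "(\<Sum>k<n. (\<Sum>l<n. c k l * f l) * (\<Sum>m<n. c k m * g m)) = (\<Sum>l<n. f l * g l)"
proof -
  have "(\<Sum>k<n. (\<Sum>l<n. c k l * f l) * (\<Sum>m<n. c k m * g m)) =
      (\<Sum>k<n. \<Sum>l<n. \<Sum>m<n. c k l * c k m * (f l * g m))"
    by (simp add: sum_product mult_ac)
  also have "\<dots> = (\<Sum>l<n. \<Sum>k<n. \<Sum>m<n. c k l * c k m * (f l * g m))"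
    by (rule sum.swap)
  also have "\<dots> = (\<Sum>l<n. \<Sum>m<n. (\<Sum>k<n. c k l * c k m) * (f l * g m))"
    unfolding sum_distrib_right by (intro sum.cong sum.swap refl)
  also have "\<dots> = (\<Sum>l<n. \<Sum>m<n. if m = l then f l * g l else 0)"
    using assms unfolding orthogonal_coeffs_def by (intro sum.cong refl) auto
  also have "\<dots> = (\<Sum>l<n. f l * g l)"
    by (intro sum.cong refl) (simp add: sum.delta)
  finally show ?thesis .
qed

lemma orthogonal_coeffs_dot:
  assumes "orthogonal_coeffs n c" "i < n" "j < n" "\<And>l m. l < n \<Longrightarrow> m < n \<Longrightarrow> G l m = of_bool (l = m)"
  shows "(\<Sum>l<n. \<Sum>m<n. c i l * c j m * G l m) = of_bool (i = j)"
proof -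
  have "(\<Sum>l<n. \<Sum>m<n. c i l * c j m * G l m) = (\<Sum>l<n. \<Sum>m<n. if m = l then c i l * c j l else 0)"
    using assms(4) by (intro sum.cong refl) auto
  also have "\<dots> = (\<Sum>l<n. c i l * c j l)"
    by (intro sum.cong refl) (simp add: sum.delta)
  finally show ?thesis using assms(1-3) by (simp add: orthogonal_coeffs_def)
qed

definition quad_form :: "nat \<Rightarrow> (nat \<Rightarrow> nat \<Rightarrow> real) \<Rightarrow> (nat \<Rightarrow> real) \<Rightarrow> (nat \<Rightarrow> real) \<Rightarrow> real" where
  "quad_form n A x y = (\<Sum>l<n. \<Sum>m<n. x l * y m * A l m)"

lemma quad_form_left:
  "quad_form n A (\<lambda>k. a * x k + b * y k) w = a * quad_form n A x w + b * quad_form n A y w"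
  by (simp add: quad_form_def sum_distrib_left algebra_simps sum.distrib)

lemma quad_form_right:
  "quad_form n A w (\<lambda>k. a * x k + b * y k) = a * quad_form n A w x + b * quad_form n A w y"
  by (simp add: quad_form_def sum_distrib_left algebra_simps sum.distrib)

lemma quad_form_commute:
  assumes "\<And>l m. l < n \<Longrightarrow> m < n \<Longrightarrow> A l m = A m l"
  shows "quad_form n A x y = quad_form n A y x"
  unfolding quad_form_def using assms
  by (subst sum.swap) (intro sum.cong refl, simp add: mult_ac)

lemma sum_split_two:
  fixes g :: "nat \<Rightarrow> real"
  assumes "p < n" "q < n" "p \<noteq> q"
  shows "(\<Sum>i<n. g i) = g p + g q + (\<Sum>i\<in>{..<n} - {p, q}. g i)"
  using assms by (simp add: sum.remove[of "{..<n}" p] sum.remove[of "{..<n} - {p}" q] Diff_insert2[symmetric] insert_commute)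

definition jacobi_rotation :: "nat \<Rightarrow> nat \<Rightarrow> real \<Rightarrow> real \<Rightarrow> (nat \<Rightarrow> nat \<Rightarrow> real) \<Rightarrow> nat \<Rightarrow> nat \<Rightarrow> real" where
  "jacobi_rotation p q co si c =
     c(p := \<lambda>k. co * c p k + si * c q k, q := \<lambda>k. - si * c p k + co * c q k)"

text \<open>Rows are handled by bilinearity of the dot product. In a column sum only the terms p and
  q change, and the unit condition restores their total.\<close>

lemma orthogonal_jacobi_rotation:
  assumes c: "orthogonal_coeffs n c" and pq: "p < n" "q < n" "p \<noteq> q" and unit: "co\<^sup>2 + si\<^sup>2 = 1"
  shows "orthogonal_coeffs n (jacobi_rotation p q co si c)"
proof -
  define D where "D x y = (\<Sum>k<n. x k * y k)" for x y :: "nat \<Rightarrow> real"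
  have D_left: "D (\<lambda>k. a * x k + b * y k) w = a * D x w + b * D y w" for a b x y w
    by (simp add: D_def sum_distrib_left algebra_simps sum.distrib)
  have D_commute: "D x y = D y x" for x y by (simp add: D_def mult.commute)
  have D_right: "D w (\<lambda>k. a * x k + b * y k) = a * D w x + b * D w y" for a b x y w
    using D_left D_commute by metis
  have D_diff: "D (\<lambda>k. a * x k - b * y k) w = a * D x w - b * D y w"
    "D w (\<lambda>k. a * x k - b * y k) = a * D w x - b * D w y" for a b x y w
    by (simp_all add: D_def sum_distrib_left algebra_simps sum_subtractf)
  have D: "D (c i) (c j) = of_bool (i = j)" if "i < n" "j < n" for i j
    using c that by (simp add: D_def orthogonal_coeffs_def)
  have unit': "co * co + si * si = 1" using unit by (simp add: power2_eq_square)
  let ?c = "jacobi_rotation p q co si c"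
  have "D (?c i) (?c j) = of_bool (i = j)" if "i < n" "j < n" for i j
  proof -
    have p: "?c p = (\<lambda>k. co * c p k + si * c q k)" and q: "?c q = (\<lambda>k. - si * c p k + co * c q k)"
      using pq by (simp_all add: jacobi_rotation_def)
    have other: "?c i = c i" if "i \<noteq> p" "i \<noteq> q" for i
      using that by (simp add: jacobi_rotation_def)
    show ?thesis
      using that pq unit'
      by (cases "i = p"; cases "i = q"; cases "j = p"; cases "j = q")
        (simp_all add: p q other D D_left D_right D_diff algebra_simps)
  qed
  moreover have "(\<Sum>k<n. ?c k i * ?c k j) = of_bool (i = j)" if "i < n" "j < n" for i j
  proof -
    have "(\<Sum>k<n. ?c k i * ?c k j) = (co * c p i + si * c q i) * (co * c p j + si * c q j) +
        (- si * c p i + co * c q i) * (- si * c p j + co * c q j) + (\<Sum>k\<in>{..<n} - {p, q}. c k i * c k j)"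
      unfolding sum_split_two[OF pq] using pq by (simp add: jacobi_rotation_def)
    also have "\<dots> = (co * co + si * si) * (c p i * c p j + c q i * c q j) + (\<Sum>k\<in>{..<n} - {p, q}. c k i * c k j)"
      by (simp add: algebra_simps)
    also have "\<dots> = (\<Sum>k<n. c k i * c k j)"
      unfolding sum_split_two[OF pq] unit' by simp
    finally show ?thesis using c that by (simp add: orthogonal_coeffs_def)
  qed
  ultimately show ?thesis by (simp add: orthogonal_coeffs_def D_def)
qed

text \<open>
  Jacobi's argument: a rotation in the plane of two rows that annihilates their off-diagonal entry
  increases the sum of the squares of the diagonal entries.
\<close>

lemma jacobi_rotation_increases:
  assumes A: "\<And>l m. l < n \<Longrightarrow> m < n \<Longrightarrow> A l m = A m l"
    and pq: "p < n" "q < n" "p \<noteq> q" and nz: "quad_form n A (c p) (c q) \<noteq> 0"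
  shows "\<exists>co si. co\<^sup>2 + si\<^sup>2 = 1 \<and>
    (\<Sum>i<n. (quad_form n A (c i) (c i))\<^sup>2) <
    (\<Sum>i<n. (quad_form n A (jacobi_rotation p q co si c i) (jacobi_rotation p q co si c i))\<^sup>2)"
proof -
  define x y z where "x = quad_form n A (c p) (c p)" and "y = quad_form n A (c q) (c q)"
    and "z = quad_form n A (c p) (c q)"
  have z': "quad_form n A (c q) (c p) = z" using quad_form_commute[of n A] A z_def by metis
  \<comment> \<open>R is the gap between the eigenvalues of the symmetric block with diagonal x, y
    and off-diagonal entry z; rotating by half the angle t found below diagonalises this
    block.\<close>
  define R where "R = sqrt ((x - y)\<^sup>2 + (2 * z)\<^sup>2)"
  have "z \<noteq> 0" using nz by (simp add: z_def)
  then have "0 < (2 * z)\<^sup>2" by simp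
  then have "0 < (x - y)\<^sup>2 + (2 * z)\<^sup>2" by (intro add_nonneg_pos) auto
  then have R: "R > 0" "R\<^sup>2 = (x - y)\<^sup>2 + (2 * z)\<^sup>2" by (auto simp: R_def)
  have "((x - y) / R)\<^sup>2 + (2 * z / R)\<^sup>2 = ((x - y)\<^sup>2 + (2 * z)\<^sup>2) / R\<^sup>2"
    by (simp add: power_divide add_divide_distrib)
  also have "\<dots> = 1" unfolding R(2)[symmetric] using R(1) by simp
  finally obtain t where t: "(x - y) / R = cos t" "2 * z / R = sin t"
    using sincos_total_2pi by metis
  define co si where "co = cos (t / 2)" and "si = sin (t / 2)"
  have unit: "co\<^sup>2 + si\<^sup>2 = 1" by (simp add: co_def si_def)
  have dbl: "co\<^sup>2 - si\<^sup>2 = (x - y) / R" "2 * si * co = 2 * z / R"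
    using cos_double[of "t / 2"] sin_double[of "t / 2"] t by (simp_all add: co_def si_def)
  let ?c = "jacobi_rotation p q co si c"
  define x' y' where "x' = quad_form n A (?c p) (?c p)" and "y' = quad_form n A (?c q) (?c q)"
  have x': "x' = co\<^sup>2 * x + si\<^sup>2 * y + (2 * si * co) * z"
    using pq z' by (simp add: x'_def jacobi_rotation_def quad_form_left quad_form_right
        x_def[symmetric] y_def[symmetric] z_def[symmetric] power2_eq_square algebra_simps)
  have "?c q = (\<lambda>k. (- si) * c p k + co * c q k)" by (simp add: jacobi_rotation_def)
  then have y': "y' = si\<^sup>2 * x + co\<^sup>2 * y - (2 * si * co) * z"
    unfolding y'_def
    by (simp only: quad_form_left quad_form_right z' x_def[symmetric] y_def[symmetric] z_def[symmetric])
      (simp add: power2_eq_square algebra_simps)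
  have "x' + y' = (co\<^sup>2 + si\<^sup>2) * (x + y)" by (simp add: x' y' algebra_simps)
  then have sum: "x' + y' = x + y" by (simp add: unit)
  have "x' - y' = (co\<^sup>2 - si\<^sup>2) * (x - y) + 2 * (2 * si * co) * z" by (simp add: x' y' algebra_simps)
  also have "\<dots> = ((x - y)\<^sup>2 + (2 * z)\<^sup>2) / R"
    unfolding dbl by (simp add: add_divide_distrib power2_eq_square)
  also have "\<dots> = R" unfolding R(2)[symmetric] using R(1) by (simp add: power2_eq_square)
  finally have diff: "x' - y' = R" .
  \<comment> \<open>The trace x + y is preserved while the squared difference grows by (2 z)^2, so
    the sum of squares gains 2 z^2.\<close>
  have "2 * (x'\<^sup>2 + y'\<^sup>2) = (x' + y')\<^sup>2 + (x' - y')\<^sup>2" by (simp add: power2_eq_square algebra_simps)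
  also have "\<dots> = (x + y)\<^sup>2 + ((x - y)\<^sup>2 + (2 * z)\<^sup>2)" unfolding sum diff R(2) ..
  also have "\<dots> = 2 * (x\<^sup>2 + y\<^sup>2) + (2 * z)\<^sup>2" by (simp add: power2_eq_square algebra_simps)
  finally have eq: "2 * (x'\<^sup>2 + y'\<^sup>2) = 2 * (x\<^sup>2 + y\<^sup>2) + (2 * z)\<^sup>2" .
  have "2 * (x\<^sup>2 + y\<^sup>2) < 2 * (x'\<^sup>2 + y'\<^sup>2)" unfolding eq using \<open>0 < (2 * z)\<^sup>2\<close> by simp
  then have "x\<^sup>2 + y\<^sup>2 < x'\<^sup>2 + y'\<^sup>2" by simp
  moreover have "(\<Sum>i\<in>{..<n} - {p, q}. (quad_form n A (?c i) (?c i))\<^sup>2) =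
      (\<Sum>i\<in>{..<n} - {p, q}. (quad_form n A (c i) (c i))\<^sup>2)"
    by (intro sum.cong refl) (simp add: jacobi_rotation_def)
  ultimately have "(\<Sum>i<n. (quad_form n A (c i) (c i))\<^sup>2) < (\<Sum>i<n. (quad_form n A (?c i) (?c i))\<^sup>2)"
    unfolding sum_split_two[OF pq] by (simp add: x_def y_def x'_def y'_def)
  with unit show ?thesis by blast
qed

text \<open>Entries outside the block are pinned to 0 and those inside lie in [-1, 1] since rows
  have unit length. The set is thus a closed part of a product of compact sets, compact by
  Tychonoff.\<close>

lemma compact_orthogonal_coeffs:
  "compact {c. orthogonal_coeffs n c \<and> (\<forall>i j. n \<le> i \<or> n \<le> j \<longrightarrow> c i j = 0)}"
proof -
  let ?S = "\<lambda>i j. if i < n \<and> j < n then {-1..1::real} else {0}"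
  let ?B = "PiE UNIV (\<lambda>i::nat. PiE UNIV (\<lambda>j::nat. ?S i j))"
  have "compact (PiE UNIV (\<lambda>j::nat. ?S i j))" for i :: nat
    unfolding compactin_euclidean_iff[symmetric] euclidean_product_topology[symmetric] compactin_PiE
    by (auto simp: compactin_euclidean_iff)
  then have comp: "compact ?B"
    unfolding compactin_euclidean_iff[symmetric] euclidean_product_topology[symmetric, where 'a=nat and 'b="nat \<Rightarrow> real"] compactin_PiE
    by (auto simp: compactin_euclidean_iff euclidean_product_topology)
  have cont [continuous_intros]: "continuous_on UNIV (\<lambda>c::nat \<Rightarrow> nat \<Rightarrow> real. c i k)" for i k
    using continuous_on_compose2[OF continuous_on_product_coordinates[of k] continuous_on_product_coordinates[of i]] by simp
  have "closed {c. orthogonal_coeffs n c}"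
    unfolding orthogonal_coeffs_def
    by (intro closed_Collect_conj closed_Collect_all closed_Collect_imp closed_Collect_eq continuous_intros) auto
  moreover have "{c. orthogonal_coeffs n c \<and> (\<forall>i j. n \<le> i \<or> n \<le> j \<longrightarrow> c i j = 0)} = ?B \<inter> {c. orthogonal_coeffs n c}"
  proof -
    have "\<bar>c i j\<bar> \<le> 1" if "orthogonal_coeffs n c" "i < n" "j < n" for c i j
    proof -
      have "(c i j)\<^sup>2 \<le> (\<Sum>k<n. c i k * c i k)"
        using that(3) member_le_sum[of j "{..<n}" "\<lambda>k. c i k * c i k"] by (simp add: power2_eq_square)
      also have "\<dots> = 1" using that by (simp add: orthogonal_coeffs_def)
      finally show ?thesis by (simp add: abs_square_le_1)
    qed
    then show ?thesis
      by (auto simp: PiE_UNIV_domain Pi_iff abs_le_iff not_less split: if_splits) (force simp: not_less minus_le_iff)+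
  qed
  ultimately show ?thesis using comp by (simp add: compact_Int_closed)
qed

text \<open>By compactness some orthogonal matrix maximises the sum of squared diagonal entries; a
  nonzero off-diagonal entry could then be rotated away with a strict gain.\<close>

theorem jacobi_diagonalisation:
  assumes A: "\<And>l m. l < n \<Longrightarrow> m < n \<Longrightarrow> A l m = A m l"
  obtains c where "orthogonal_coeffs n c"
    "\<And>i j. i < n \<Longrightarrow> j < n \<Longrightarrow> i \<noteq> j \<Longrightarrow> (\<Sum>l<n. \<Sum>m<n. c i l * c j m * A l m) = 0"
proof -
  let ?O = "{c. orthogonal_coeffs n c \<and> (\<forall>i j. n \<le> i \<or> n \<le> j \<longrightarrow> c i j = 0)}"
  have "(\<lambda>i j. of_bool (i < n \<and> i = j)) \<in> ?O"
  proof -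
    have "(\<Sum>k<n. of_bool (i < n \<and> i = k) * of_bool (j < n \<and> j = k) :: real) = of_bool (i = j)"
      "(\<Sum>k<n. of_bool (k < n \<and> k = i) * of_bool (k < n \<and> k = j) :: real) = of_bool (i = j)"
      if "i < n" "j < n" for i j
    proof -
      have "(\<Sum>k<n. of_bool (i < n \<and> i = k) * of_bool (j < n \<and> j = k) :: real) = (\<Sum>k<n. if k = i then of_bool (i = j) else 0)"
        "(\<Sum>k<n. of_bool (k < n \<and> k = i) * of_bool (k < n \<and> k = j) :: real) = (\<Sum>k<n. if k = i then of_bool (i = j) else 0)"
        using that by (auto intro!: sum.cong)
      then show "(\<Sum>k<n. of_bool (i < n \<and> i = k) * of_bool (j < n \<and> j = k) :: real) = of_bool (i = j)"
        "(\<Sum>k<n. of_bool (k < n \<and> k = i) * of_bool (k < n \<and> k = j) :: real) = of_bool (i = j)"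
        using that by (simp_all add: sum.delta)
    qed
    then show ?thesis by (auto simp: orthogonal_coeffs_def)
  qed
  then have ne: "?O \<noteq> {}" by blast
  have cont [continuous_intros]: "continuous_on ?O (\<lambda>c::nat \<Rightarrow> nat \<Rightarrow> real. c i k)" for i k
    using continuous_on_compose2[OF continuous_on_product_coordinates[of k] continuous_on_product_coordinates[of i]]
    by (auto intro: continuous_on_subset)
  define f where "f c = (\<Sum>i<n. (quad_form n A (c i) (c i))\<^sup>2)" for c
  have "continuous_on ?O f"
    unfolding f_def quad_form_def by (intro continuous_intros)
  from continuous_attains_sup[OF compact_orthogonal_coeffs[of n] ne this]
  obtain c where c: "c \<in> ?O" and max: "\<forall>d\<in>?O. f d \<le> f c"
    by (elim bexE)
  show thesis
  proof
    show orth: "orthogonal_coeffs n c" using c by simp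
    fix i j assume ij: "i < n" "j < n" "i \<noteq> j"
    have "quad_form n A (c i) (c j) = 0"
    proof (rule ccontr)
      assume "quad_form n A (c i) (c j) \<noteq> 0"
      then obtain co si where cs: "co\<^sup>2 + si\<^sup>2 = 1" and less: "(\<Sum>k<n. (quad_form n A (c k) (c k))\<^sup>2) <
          (\<Sum>k<n. (quad_form n A (jacobi_rotation i j co si c k) (jacobi_rotation i j co si c k))\<^sup>2)"
        using jacobi_rotation_increases[of n A i j c, OF A ij] by blast
      have "jacobi_rotation i j co si c \<in> ?O"
        using c ij orthogonal_jacobi_rotation[OF orth ij cs] by (auto simp: jacobi_rotation_def)
      with max less show False by (auto simp: f_def)
    qed
    then show "(\<Sum>l<n. \<Sum>m<n. c i l * c j m * A l m) = 0" by (simp add: quad_form_def)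
  qed
qed

section \<open>Singular value decomposition of kernels\<close>

lemma L2_inner_commute: "L2_inner D v w = L2_inner D w v"
  by (simp add: L2_inner_def mult.commute)

lemma L2_inner_self_nonneg: "0 \<le> L2_inner D v v"
  by (simp add: L2_inner_def)

lemma L2_norm_nonneg: "0 \<le> L2_norm D v"
  by (simp add: L2_norm_def L2_inner_self_nonneg)

lemma L2_norm_power2: "(L2_norm D v)\<^sup>2 = L2_inner D v v"
  by (simp add: L2_norm_def L2_inner_self_nonneg)

section \<open>The finite-dimensional space W: definiteness and interpolation\<close>

locale potential_space = lipschitz_domain D for D :: "'a::euclidean_space set" +
  fixes W :: "('a \<Rightarrow> real) set"
  assumes finite_dim: "finite_dim_subspace_C D W"
begin

lemma W_lincomb:
  assumes "v \<in> W" "w \<in> W"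
  shows "(\<lambda>x. a * v x + b * w x) \<in> W"
proof -
  obtain B where B: "W = {\<lambda>x. \<Sum>b\<in>B. c b * b x | c. True}"
    using finite_dim unfolding finite_dim_subspace_C_def by blast
  obtain c d where "v = (\<lambda>x. \<Sum>b\<in>B. c b * b x)" "w = (\<lambda>x. \<Sum>b\<in>B. d b * b x)"
    using assms unfolding B by blast
  then have eq: "(\<lambda>x. a * v x + b * w x) = (\<lambda>x. \<Sum>f\<in>B. (a * c f + b * d f) * f x)"
    by (simp add: sum_distrib_left sum.distrib algebra_simps)
  show ?thesis unfolding B by (rule CollectI, rule exI, rule conjI[OF eq TrueI])
qed

lemma W_0: "(\<lambda>_. 0) \<in> W"
proof -
  obtain B where B: "W = {\<lambda>x. \<Sum>b\<in>B. c b * b x | c. True}"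
    using finite_dim unfolding finite_dim_subspace_C_def by blast
  have eq: "(\<lambda>_. 0) = (\<lambda>x. \<Sum>b\<in>B. (\<lambda>_. 0) b * b x)" by simp
  show ?thesis unfolding B by (rule CollectI, rule exI, rule conjI[OF eq TrueI])
qed

lemma W_C_closure: "W \<subseteq> C_closure D"
proof
  fix w assume "w \<in> W"
  obtain B where B: "finite B" "B \<subseteq> C_closure D" "W = {\<lambda>x. \<Sum>b\<in>B. c b * b x | c. True}"
    using finite_dim unfolding finite_dim_subspace_C_def by blast
  then obtain c where w: "w = (\<lambda>x. \<Sum>b\<in>B. c b * b x)" using \<open>w \<in> W\<close> by blast
  show "w \<in> C_closure D"
    unfolding w C_closure_def using B(2)
    by (auto simp: C_closure_def subset_eq intro!: continuous_intros sum.neutral)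
qed

lemma W_continuous: "w \<in> W \<Longrightarrow> continuous_on (closure D) w"
  using W_C_closure by (auto simp: C_closure_def)

lemma W_outside: "w \<in> W \<Longrightarrow> x \<notin> closure D \<Longrightarrow> w x = 0"
  using W_C_closure by (auto simp: C_closure_def)

lemma W_square_integrable: "w \<in> W \<Longrightarrow> square_integrable (lebesgue_on D) w"
  by (intro square_integrable_continuous W_continuous)

lemma W_mult_integrable: "v \<in> W \<Longrightarrow> w \<in> W \<Longrightarrow> integrable (lebesgue_on D) (\<lambda>x. v x * w x)"
  by (intro square_integrable_mult W_square_integrable)

lemma L2_inner_lincomb_left:
  assumes "v \<in> W" "v' \<in> W" "w \<in> W"
  shows "L2_inner D (\<lambda>x. a * v x + b * v' x) w = a * L2_inner D v w + b * L2_inner D v' w"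
proof -
  have "L2_inner D (\<lambda>x. a * v x + b * v' x) w = (LINT x|lebesgue_on D. a * (v x * w x) + b * (v' x * w x))"
    by (simp add: L2_inner_def algebra_simps)
  also have "\<dots> = a * L2_inner D v w + b * L2_inner D v' w"
    using assms by (simp add: L2_inner_def W_mult_integrable)
  finally show ?thesis .
qed

sublocale L2: semi_inner_product W "L2_inner D"
  by unfold_locales
    (use W_0 W_lincomb L2_inner_commute L2_inner_lincomb_left L2_inner_self_nonneg in auto)

lemma L2_Cauchy_Schwarz: "v \<in> W \<Longrightarrow> w \<in> W \<Longrightarrow> \<bar>L2_inner D v w\<bar> \<le> L2_norm D v * L2_norm D w"
  unfolding L2_norm_def by (rule L2.Cauchy_Schwarz)

text \<open>The set in D where w is nonzero is open and null, hence empty; continuity covers the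
  closure, and outside it elements of W are 0 by convention. So on W, unlike on \<open>H1\<close>,
  norm zero means equality of functions.\<close>

lemma W_eq_0:
  assumes w: "w \<in> W" and "L2_norm D w = 0"
  shows "w = (\<lambda>_. 0)"
proof
  fix x
  have "L2_inner D w w = 0"
    using assms(2) L2_norm_power2[of D w] by simp
  then have "AE x in lebesgue_on D. w x = 0"
    by (intro square_integral_0_imp_AE W_square_integrable w)
      (simp add: L2_inner_def power2_eq_square)
  then have "AE x in lebesgue. x \<in> D \<longrightarrow> w x = 0"
    using sets_domain by (simp add: AE_restrict_space_iff)
  then have null: "negligible {x. \<not> (x \<in> D \<longrightarrow> w x = 0)}"
    by (auto simp: negligible_iff_null_sets completion.AE_iff_null_sets)
  have "open {x \<in> D. w x \<in> - {0}}"
    using continuous_on_subset[OF W_continuous[OF w] closure_subset] open_domain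
    by (intro continuous_open_preimage[unfolded vimage_def Int_def, simplified]) auto
  moreover have "{x. \<not> (x \<in> D \<longrightarrow> w x = 0)} = {x \<in> D. w x \<in> - {0}}" by auto
  ultimately have "{x \<in> D. w x \<in> - {0}} = {}"
    using null open_not_negligible by metis
  then have "w x = 0" if "x \<in> D" for x using that by auto
  then have "w x = 0" if "x \<in> closure D" for x
    using continuous_constant_on_closure[OF W_continuous[OF w] _ that] by blast
  then show "w x = 0" using W_outside[OF w] by blast
qed

definition interpolates :: "'a set \<Rightarrow> ('a \<Rightarrow> 'a \<Rightarrow> real) \<Rightarrow> ('a \<Rightarrow> real) \<Rightarrow> bool" where
  "interpolates Y e w \<longleftrightarrow> (\<forall>x. w x = (\<Sum>y\<in>Y. w y * e y x))"

text \<open>Reduces W-valued statements to finitely many point values, so that null sets depending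
  on the second variable can be united. The induction on a spanning set also maintains that the
  basis is dual to the nodes.\<close>

lemma W_interpolation:
  "\<exists>Y e. finite Y \<and> Y \<subseteq> closure D \<and> (\<forall>y\<in>Y. e y \<in> W) \<and> (\<forall>w\<in>W. interpolates Y e w)"
proof -
  obtain B where B: "finite B" "B \<subseteq> C_closure D" "W = {\<lambda>x. \<Sum>b\<in>B. c b * b x | c. True}"
    using finite_dim unfolding finite_dim_subspace_C_def by blast
  have sub: "b \<in> W" if "b \<in> B" for b
  proof -
    have eq: "b = (\<lambda>x. \<Sum>f\<in>B. of_bool (f = b) * f x)"
      using B(1) that by (auto simp: sum.remove[of B b] intro!: sum.neutral)
    show ?thesis unfolding B(3) by (rule CollectI, rule exI, rule conjI[OF eq TrueI])
  qed
  have "\<exists>Y e. finite Y \<and> Y \<subseteq> closure D \<and> (\<forall>y\<in>Y. e y \<in> W) \<and>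
      (\<forall>y\<in>Y. \<forall>y'\<in>Y. e y y' = of_bool (y = y')) \<and> (\<forall>b\<in>Z. interpolates Y e b)"
    if "Z \<subseteq> B" for Z
    using finite_subset[OF that B(1)] that
  proof (induction Z rule: finite_induct)
    case empty
    show ?case by (rule exI[of _ "{}"]) simp
  next
    case (insert b Z)
    then have "Z \<subseteq> B" by simp
    from insert.IH[OF this] obtain Y e where Y: "finite Y" "Y \<subseteq> closure D" "\<forall>y\<in>Y. e y \<in> W"
      "\<forall>y\<in>Y. \<forall>y'\<in>Y. e y y' = of_bool (y = y')" "\<forall>d\<in>Z. interpolates Y e d" by blast
    have b: "b \<in> W" using insert.prems sub by auto
    \<comment> \<open>The interpolation error of the new spanning function. It vanishes at the old
      nodes, so any point where it does not vanish can serve as a new node.\<close>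
    define r where "r x = b x - (\<Sum>y\<in>Y. b y * e y x)" for x
    have rW: "r \<in> W"
      using W_lincomb[OF b L2.sum_in[of Y e b], of 1 "-1"] Y(3) by (simp add: r_def[abs_def])
    have rY: "r y = 0" if "y \<in> Y" for y
    proof -
      have "(\<Sum>y'\<in>Y. b y' * e y' y) = (\<Sum>y'\<in>Y. if y' = y then b y else 0)"
        using Y(4) that by (intro sum.cong) auto
      also have "\<dots> = b y" using that Y(1) by simp
      finally show ?thesis by (simp add: r_def)
    qed
    show ?case
    proof (cases "\<forall>x. r x = 0")
      case True
      have "b x = (\<Sum>y\<in>Y. b y * e y x)" for x
        using spec[OF True, of x] unfolding r_def by linarith
      then have "interpolates Y e b" unfolding interpolates_def by blast
      with Y have "finite Y \<and> Y \<subseteq> closure D \<and> (\<forall>y\<in>Y. e y \<in> W) \<and>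
          (\<forall>y\<in>Y. \<forall>y'\<in>Y. e y y' = of_bool (y = y')) \<and> (\<forall>b\<in>insert b Z. interpolates Y e b)" by simp
      then show ?thesis by blast
    next
      case False
      then obtain z where z: "r z \<noteq> 0" by blast
      have zY: "z \<notin> Y" "z \<in> closure D" using z rY W_outside[OF rW] by auto
      \<comment> \<open>A Newton step: the normalised error is dual to the new node z, and the old
        basis functions are corrected so as to vanish there.\<close>
      define e' where "e' y = (if y = z then (\<lambda>x. 1 / r z * r x) else (\<lambda>x. 1 * e y x + (- (e y z / r z)) * r x))" for y
      have e': "e' z x = r x / r z" "y \<in> Y \<Longrightarrow> e' y x = e y x - e y z * (r x / r z)" for x y
        using zY(1) by (auto simp: e'_def)
      have e'_sum: "(\<Sum>y\<in>insert z Y. h y * e' y x) =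
          (\<Sum>y\<in>Y. h y * e y x) + (h z - (\<Sum>y\<in>Y. h y * e y z)) * (r x / r z)" for h x
      proof -
        define t where "t = r x / r z"
        have "(\<Sum>y\<in>Y. h y * e' y x) = (\<Sum>y\<in>Y. h y * (e y x - e y z * t))"
          using e'(2) by (intro sum.cong) (auto simp: t_def)
        also have "\<dots> = (\<Sum>y\<in>Y. h y * e y x) - (\<Sum>y\<in>Y. h y * e y z) * t"
          by (simp add: right_diff_distrib sum_subtractf sum_distrib_right mult.assoc)
        finally have "(\<Sum>y\<in>Y. h y * e' y x) = (\<Sum>y\<in>Y. h y * e y x) - (\<Sum>y\<in>Y. h y * e y z) * t" .
        then show ?thesis
          using zY(1) Y(1) e'(1)[of x] by (simp add: algebra_simps flip: t_def)
      qed
      have "e' y \<in> W" if "y \<in> insert z Y" for y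
      proof (cases "y = z")
        case True
        then show ?thesis unfolding e'_def using L2.cmult_in[OF rW, of "1 / r z"] by simp
      next
        case False
        then show ?thesis
          unfolding e'_def using W_lincomb[of "e y" r 1 "- (e y z / r z)"] that Y(3) rW by simp
      qed
      moreover have "e' y y' = of_bool (y = y')" if "y \<in> insert z Y" "y' \<in> insert z Y" for y y'
        using that zY(1) z Y(4) rY by (auto simp: e')
      moreover have "interpolates (insert z Y) e' d" if "d \<in> insert b Z" for d
        unfolding interpolates_def
      proof
        fix x
        show "d x = (\<Sum>y\<in>insert z Y. d y * e' y x)"
        proof (cases "d = b")
          case True
          have "(\<Sum>y\<in>insert z Y. b y * e' y x) = (\<Sum>y\<in>Y. b y * e y x) + r z * (r x / r z)"
            unfolding e'_sum r_def[of z] ..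
          then show ?thesis using True z by (simp add: r_def[of x])
        next
          case False
          then have "interpolates Y e d" using that Y(5) by simp
          then have d: "(\<Sum>y\<in>Y. d y * e y x) = d x" for x unfolding interpolates_def by metis
          show ?thesis unfolding e'_sum d by simp
        qed
      qed
      ultimately have "finite (insert z Y) \<and> insert z Y \<subseteq> closure D \<and> (\<forall>y\<in>insert z Y. e' y \<in> W) \<and>
          (\<forall>y\<in>insert z Y. \<forall>y'\<in>insert z Y. e' y y' = of_bool (y = y')) \<and>
          (\<forall>b\<in>insert b Z. interpolates (insert z Y) e' b)"
        using Y(1,2) zY(2) by blast
      then show ?thesis by blast
    qed
  qed
  from this[OF order_refl] obtain Y e where Y: "finite Y" "Y \<subseteq> closure D" "\<forall>y\<in>Y. e y \<in> W"
    "\<forall>b\<in>B. interpolates Y e b" by blast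
  have "interpolates Y e w" if "w \<in> W" for w
    unfolding interpolates_def
  proof
    fix x
    obtain c where w: "w = (\<lambda>x. \<Sum>b\<in>B. c b * b x)" using \<open>w \<in> W\<close> B(3) by blast
    have b: "b x = (\<Sum>y\<in>Y. b y * e y x)" if "b \<in> B" for b
      using Y(4) that unfolding interpolates_def by blast
    have "w x = (\<Sum>b\<in>B. c b * (\<Sum>y\<in>Y. b y * e y x))"
      unfolding w by (intro sum.cong refl arg_cong[of _ _ "(*) _"] b)
    also have "\<dots> = (\<Sum>b\<in>B. \<Sum>y\<in>Y. c b * b y * e y x)"
      by (simp add: sum_distrib_left mult.assoc)
    also have "\<dots> = (\<Sum>y\<in>Y. w y * e y x)"
      by (subst sum.swap) (simp add: w sum_distrib_right)
    finally show "w x = (\<Sum>y\<in>Y. w y * e y x)" .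
  qed
  with Y(1-3) show ?thesis by blast
qed

section \<open>Kernels as finite sums of tensors, and their singular values\<close>

definition kernel_rep :: "'a kernel \<Rightarrow> nat \<Rightarrow> (nat \<Rightarrow> 'a \<Rightarrow> real) \<Rightarrow> (nat \<Rightarrow> 'a \<Rightarrow> real) \<Rightarrow> bool" where
  "kernel_rep F n a w \<longleftrightarrow> (\<forall>l<n. a l \<in> H1 D \<and> w l \<in> W) \<and>
     (AE x in lebesgue_on D. \<forall>y. F x y = (\<Sum>l<n. a l x * w l y))"

text \<open>Interpolate \<open>F x\<close> in the second variable: the H^1 factors are the slices at
  the nodes. The nodes lie in \<open>closure D\<close>, where \<open>H1W\<close> provides slices in
  \<open>H1\<close>.\<close>

lemma kernel_rep_exists:
  assumes F: "F \<in> H1W D W"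
  shows "\<exists>n a w. kernel_rep F n a w"
proof -
  obtain Y e where Y: "finite Y" "Y \<subseteq> closure D" "\<And>y. y \<in> Y \<Longrightarrow> e y \<in> W"
    "\<And>w. w \<in> W \<Longrightarrow> interpolates Y e w"
    using W_interpolation by blast
  obtain h where h: "bij_betw h {..<card Y} Y"
    using Y(1) ex_bij_betw_nat_finite[of Y] by (auto simp: lessThan_atLeast0)
  have hY: "h l \<in> Y" if "l < card Y" for l using h that by (auto simp: bij_betw_def)
  have "F x y = (\<Sum>l<card Y. F x (h l) * e (h l) y)" if "x \<in> D" for x y
  proof -
    have "F x \<in> W" using F that by (simp add: H1W_def)
    then have "F x y = (\<Sum>y'\<in>Y. F x y' * e y' y)"
      using Y(4) unfolding interpolates_def by blast
    then show ?thesis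
      unfolding sum.reindex_bij_betw[OF h, of "\<lambda>y'. F x y' * e y' y"] .
  qed
  then have "AE x in lebesgue_on D. \<forall>y. F x y = (\<Sum>l<card Y. F x (h l) * e (h l) y)"
    by (intro AE_I2) simp
  moreover have "(\<lambda>x. F x (h l)) \<in> H1 D" "e (h l) \<in> W" if "l < card Y" for l
    using F hY[OF that] Y(2,3) by (auto simp: H1W_def)
  ultimately have "kernel_rep F (card Y) (\<lambda>l x. F x (h l)) (\<lambda>l. e (h l))"
    unfolding kernel_rep_def by blast
  then show ?thesis by blast
qed

lemma kernel_rep_slice:
  assumes "kernel_rep F n a w"
  shows "(\<lambda>x. F x y) \<in> H1 D"
    and "b \<in> H1 D \<Longrightarrow> H1_inner D (\<lambda>x. F x y) b = (\<Sum>l<n. H1_inner D (a l) b * w l y)"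
proof -
  have a: "a l \<in> H1 D" if "l \<in> {..<n}" for l using assms that by (simp add: kernel_rep_def)
  have S: "(\<lambda>x. \<Sum>l<n. w l y * a l x) \<in> H1 D" by (intro H1.sum_in a)
  have ae: "AE x in lebesgue_on D. (\<Sum>l<n. w l y * a l x) = F x y"
    using assms unfolding kernel_rep_def by (elim conjE AE_mp) (simp add: mult.commute)
  show "(\<lambda>x. F x y) \<in> H1 D" by (rule H1_cong_AE[OF S ae])
  show "H1_inner D (\<lambda>x. F x y) b = (\<Sum>l<n. H1_inner D (a l) b * w l y)" if "b \<in> H1 D"
  proof -
    have "H1_inner D (\<lambda>x. \<Sum>l<n. w l y * a l x) b = (\<Sum>l<n. w l y * H1_inner D (a l) b)"
      by (intro H1.sum_left a that)
    then show ?thesis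
      unfolding H1_inner_cong_AE[OF ae] by (simp add: mult.commute)
  qed
qed

lemma kernel_rep_op_of:
  assumes "kernel_rep F n a w" "b \<in> H1 D"
  shows "op_of D F b = (\<lambda>y. \<Sum>l<n. H1_inner D (a l) b * w l y)"
  using kernel_rep_slice(2)[OF assms] by (simp add: op_of_def)

lemma op_of_in_W:
  assumes "F \<in> H1W D W" "b \<in> H1 D"
  shows "op_of D F b \<in> W"
proof -
  obtain n a w where rep: "kernel_rep F n a w" using kernel_rep_exists[OF assms(1)] by blast
  show ?thesis
    unfolding kernel_rep_op_of[OF rep assms(2)] using rep by (intro L2.sum_in) (auto simp: kernel_rep_def)
qed

lemma H1W_slice: "F \<in> H1W D W \<Longrightarrow> (\<lambda>x. F x y) \<in> H1 D"
  using kernel_rep_exists kernel_rep_slice(1) by blast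

lemma kernel_rep_rotate:
  assumes rep: "kernel_rep F n a w" and c: "orthogonal_coeffs n c"
  shows "kernel_rep F n (\<lambda>k x. \<Sum>l<n. c k l * a l x) (\<lambda>k x. \<Sum>l<n. c k l * w l x)"
  using rep unfolding kernel_rep_def by (auto intro!: H1.sum_in L2.sum_in simp: orthogonal_coeffs_sum[OF c])

lemma kernel_rep_restrict:
  assumes rep: "kernel_rep F n a w"
    and zero: "\<And>k. k < n \<Longrightarrow> k \<notin> K \<Longrightarrow> (AE x in lebesgue_on D. a k x = 0) \<or> w k = (\<lambda>_. 0)"
    and h: "bij_betw h {..<r} (K \<inter> {..<n})"
  shows "kernel_rep F r (\<lambda>k. a (h k)) (\<lambda>k. w (h k))"
proof -
  have hK: "h k < n" if "k < r" for k using h that by (auto simp: bij_betw_def)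
  have "AE x in lebesgue_on D. k \<notin> K \<longrightarrow> a k x = 0 \<or> w k = (\<lambda>_. 0)" if "k < n" for k
    using zero[OF that] by (cases "k \<in> K") auto
  then have "AE x in lebesgue_on D. \<forall>k\<in>{..<n}. k \<notin> K \<longrightarrow> a k x = 0 \<or> w k = (\<lambda>_. 0)"
    by (subst AE_finite_all) auto
  moreover have "AE x in lebesgue_on D. \<forall>y. F x y = (\<Sum>l<n. a l x * w l y)"
    using rep by (simp add: kernel_rep_def)
  ultimately have "AE x in lebesgue_on D. \<forall>y. F x y = (\<Sum>k<r. a (h k) x * w (h k) y)"
  proof eventually_elim
    case (elim x)
    have "(\<Sum>l<n. a l x * w l y) = (\<Sum>l\<in>K \<inter> {..<n}. a l x * w l y)" for y
      using elim(1) by (intro sum.mono_neutral_right) auto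
    with elim(2) show ?case
      using sum.reindex_bij_betw[OF h, of "\<lambda>l. a l x * w l y" for y] by simp
  qed
  then show ?thesis using rep hK by (auto simp: kernel_rep_def)
qed

text \<open>
  The singular value decomposition: diagonalise the Gram matrix of the factors in \<open>W\<close>, normalise
  them, then diagonalise the Gram matrix of the factors in \<open>H\<^sup>1\<close>, which keeps the former orthonormal.
\<close>

theorem svd_exists:
  assumes F: "F \<in> H1W D W"
  shows "\<exists>r s a v. is_svd D W F r s a v"
proof -
  obtain n0 a0 w0 where rep0: "kernel_rep F n0 a0 w0" using kernel_rep_exists[OF F] by blast
  obtain c where c: "orthogonal_coeffs n0 c" "\<And>i j. i < n0 \<Longrightarrow> j < n0 \<Longrightarrow> i \<noteq> j \<Longrightarrow>
      (\<Sum>l<n0. \<Sum>m<n0. c i l * c j m * L2_inner D (w0 l) (w0 m)) = 0"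
    by (rule jacobi_diagonalisation[of n0 "\<lambda>l m. L2_inner D (w0 l) (w0 m)", OF L2_inner_commute]) (rule that)
  define a1 where "a1 k x = (\<Sum>l<n0. c k l * a0 l x)" for k x
  define w1 where "w1 k x = (\<Sum>l<n0. c k l * w0 l x)" for k x
  have rep1: "kernel_rep F n0 a1 w1"
    using kernel_rep_rotate[OF rep0 c(1)] by (simp add: a1_def[abs_def] w1_def[abs_def])
  have w1: "w1 k \<in> W" if "k < n0" for k using rep1 that by (simp add: kernel_rep_def)
  have orth1: "L2_inner D (w1 i) (w1 j) = 0" if "i < n0" "j < n0" "i \<noteq> j" for i j
  proof -
    have "L2_inner D (w1 i) (w1 j) = (\<Sum>l<n0. \<Sum>m<n0. c i l * c j m * L2_inner D (w0 l) (w0 m))"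
      unfolding w1_def[abs_def] using rep0 by (intro L2.sum_sum) (auto simp: kernel_rep_def)
    then show ?thesis using c(2)[OF that] by simp
  qed
  \<comment> \<open>Factors of norm zero contribute nothing and cannot be normalised, so they are
    dropped first.\<close>
  define K1 where "K1 = {k. L2_norm D (w1 k) \<noteq> 0}"
  define n where "n = card (K1 \<inter> {..<n0})"
  obtain h1 where h1: "bij_betw h1 {..<n} (K1 \<inter> {..<n0})"
    using ex_bij_betw_nat_finite[of "K1 \<inter> {..<n0}"] by (auto simp: lessThan_atLeast0 n_def)
  have h1K: "h1 k < n0" "h1 k \<in> K1" if "k < n" for k using h1 that by (auto simp: bij_betw_def)
  have rep2: "kernel_rep F n (\<lambda>k. a1 (h1 k)) (\<lambda>k. w1 (h1 k))"
    using h1 W_eq_0[OF w1] by (intro kernel_rep_restrict[OF rep1]) (auto simp: K1_def)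
  \<comment> \<open>The norm of the W factor is shifted to the H^1 factor, leaving the product
    unchanged.\<close>
  define a2 where "a2 k x = L2_norm D (w1 (h1 k)) * a1 (h1 k) x" for k x
  define w2 where "w2 k x = 1 / L2_norm D (w1 (h1 k)) * w1 (h1 k) x" for k x
  have a2: "a2 k \<in> H1 D" and w2: "w2 k \<in> W" if "k < n" for k
    unfolding a2_def[abs_def] w2_def[abs_def]
    using rep2 that by (auto simp only: kernel_rep_def intro!: H1.cmult_in L2.cmult_in)
  have "a2 k x * w2 k y = a1 (h1 k) x * w1 (h1 k) y" if "k < n" for k x y
    using h1K(2)[OF that] by (simp add: a2_def w2_def K1_def)
  then have rep3: "kernel_rep F n a2 w2"
    using rep2 a2 w2 by (simp add: kernel_rep_def)
  have orth2: "L2_inner D (w2 i) (w2 j) = of_bool (i = j)" if "i < n" "j < n" for i j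
  proof -
    have "L2_inner D (w2 i) (w2 j) = L2_inner D (w1 (h1 i)) (w1 (h1 j)) / (L2_norm D (w1 (h1 i)) * L2_norm D (w1 (h1 j)))"
      unfolding w2_def[abs_def] using that
      by (simp add: L2.cmult_left L2.cmult_right L2.cmult_in w1 h1K(1) del: times_divide_eq_left, simp)
    moreover have "i = j" if "h1 i = h1 j"
      using h1 that \<open>i < n\<close> \<open>j < n\<close> by (auto simp: bij_betw_def inj_on_def)
    ultimately show ?thesis
      using orth1[of "h1 i" "h1 j"] that h1K
      by (cases "i = j") (auto simp: K1_def L2_norm_power2[symmetric] power2_eq_square)
  qed
  obtain d where d: "orthogonal_coeffs n d" "\<And>i j. i < n \<Longrightarrow> j < n \<Longrightarrow> i \<noteq> j \<Longrightarrow>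
      (\<Sum>l<n. \<Sum>m<n. d i l * d j m * H1_inner D (a2 l) (a2 m)) = 0"
    by (rule jacobi_diagonalisation[of n "\<lambda>l m. H1_inner D (a2 l) (a2 m)", OF H1_inner_commute]) (rule that)
  define a3 where "a3 k x = (\<Sum>l<n. d k l * a2 l x)" for k x
  define w3 where "w3 k x = (\<Sum>l<n. d k l * w2 l x)" for k x
  have rep4: "kernel_rep F n a3 w3"
    using kernel_rep_rotate[OF rep3 d(1)] by (simp add: a3_def[abs_def] w3_def[abs_def])
  have a3: "a3 k \<in> H1 D" and w3: "w3 k \<in> W" if "k < n" for k using rep4 that by (auto simp: kernel_rep_def)
  have orth3: "H1_inner D (a3 i) (a3 j) = 0" if "i < n" "j < n" "i \<noteq> j" for i j
  proof -
    have "H1_inner D (a3 i) (a3 j) = (\<Sum>l<n. \<Sum>m<n. d i l * d j m * H1_inner D (a2 l) (a2 m))"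
      unfolding a3_def[abs_def] using a2 by (intro H1.sum_sum) auto
    then show ?thesis using d(2)[OF that] by simp
  qed
  have orth4: "L2_inner D (w3 i) (w3 j) = of_bool (i = j)" if "i < n" "j < n" for i j
  proof -
    have "L2_inner D (w3 i) (w3 j) = (\<Sum>l<n. \<Sum>m<n. d i l * d j m * L2_inner D (w2 l) (w2 m))"
      unfolding w3_def[abs_def] using w2 by (intro L2.sum_sum) auto
    also have "\<dots> = of_bool (i = j)" using orth2 by (intro orthogonal_coeffs_dot[OF d(1) that])
    finally show ?thesis .
  qed
  \<comment> \<open>The norms of the H^1 factors will be the singular values; removing the zero ones
    makes all of them positive.\<close>
  define K2 where "K2 = {k. H1_norm D (a3 k) \<noteq> 0}"
  define r where "r = card (K2 \<inter> {..<n})"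
  obtain h2 where h2: "bij_betw h2 {..<r} (K2 \<inter> {..<n})"
    using ex_bij_betw_nat_finite[of "K2 \<inter> {..<n}"] by (auto simp: lessThan_atLeast0 r_def)
  have h2K: "h2 k < n" "h2 k \<in> K2" if "k < r" for k using h2 that by (auto simp: bij_betw_def)
  have h2_inj: "h2 i = h2 j \<longleftrightarrow> i = j" if "i < r" "j < r" for i j
    using h2 that by (auto simp: bij_betw_def inj_on_def)
  have rep5: "kernel_rep F r (\<lambda>k. a3 (h2 k)) (\<lambda>k. w3 (h2 k))"
    using h2 H1_norm_eq_0_imp_AE[OF a3] by (intro kernel_rep_restrict[OF rep4]) (auto simp: K2_def)
  define s where "s k = H1_norm D (a3 (h2 k))" for k
  define a where "a k x = 1 / s k * a3 (h2 k) x" for k x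
  have s: "0 < s k" if "k < r" for k
    using h2K(2)[OF that] H1_norm_nonneg[of "a3 (h2 k)"] by (simp add: s_def K2_def)
  have a: "a k \<in> H1 D" if "k < r" for k
    unfolding a_def[abs_def] using a3 h2K(1)[OF that] by (intro H1.cmult_in)
  have "H1_inner D (a i) (a j) = of_bool (i = j)" if "i < r" "j < r" for i j
  proof -
    have "H1_inner D (a i) (a j) = H1_inner D (a3 (h2 i)) (a3 (h2 j)) / (s i * s j)"
      unfolding a_def[abs_def] using that
      by (simp add: H1.cmult_left H1.cmult_right H1.cmult_in a3 h2K(1) del: times_divide_eq_left, simp)
    then show ?thesis
      using orth3[of "h2 i" "h2 j"] that h2K h2_inj[OF that] s[of i]
      by (cases "i = j") (auto simp: s_def H1_norm_power2[symmetric] power2_eq_square)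
  qed
  moreover have "L2_inner D (w3 (h2 i)) (w3 (h2 j)) = of_bool (i = j)" if "i < r" "j < r" for i j
    using orth4[of "h2 i" "h2 j"] h2K(1) that h2_inj[OF that] by simp
  moreover have "s k * tensor (a k) (w3 (h2 k)) x y = a3 (h2 k) x * w3 (h2 k) y" if "k < r" for k x y
    using s[OF that] by (simp add: tensor_def a_def)
  then have "AE x in lebesgue_on D. \<forall>y. F x y = (\<Sum>k<r. s k * tensor (a k) (w3 (h2 k)) x y)"
    using rep5 by (simp add: kernel_rep_def)
  ultimately have "is_svd D W F r s a (\<lambda>k. w3 (h2 k))"
    using s a w3 h2K(1) by (simp add: is_svd_def)
  then show ?thesis by blast
qed

end

section \<open>Duality certificates\<close>

context lipschitz_domain begin

text \<open>\<open>data_inner\<close> sees data only through what \<open>data_eq\<close> compares.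
  In particular the polarised norm of the H^(-1/2) part evaluates functionals on
  \<open>Hhalf\<close> alone.\<close>

lemma data_inner_cong:
  assumes "data_eq D N P Z"
  shows "data_inner D N p P = data_inner D N p Z"
proof -
  obtain p1 p2 p3 where p: "p = (p1, p2, p3)" by (cases p) auto
  obtain P1 P2 P3 where P: "P = (P1, P2, P3)" by (cases P) auto
  obtain Z1 Z2 Z3 where Z: "Z = (Z1, Z2, Z3)" by (cases Z) auto
  have eq1: "Hneghalf_inner D (p1 i) (P1 i) = Hneghalf_inner D (p1 i) (Z1 i)" if "i \<in> {1..N}" for i
  proof -
    have eq: "P1 i g = Z1 i g" if "g \<in> Hhalf D" for g
      using assms that \<open>i \<in> {1..N}\<close> by (auto simp: data_eq_def P Z)
    have "Hneghalf_norm D (\<lambda>g. p1 i g + P1 i g) = Hneghalf_norm D (\<lambda>g. p1 i g + Z1 i g)"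
      "Hneghalf_norm D (\<lambda>g. p1 i g - P1 i g) = Hneghalf_norm D (\<lambda>g. p1 i g - Z1 i g)"
      unfolding Hneghalf_norm_def
      by (intro arg_cong[of _ _ Sup] Collect_cong ex_cong1, use eq in auto)+
    then show ?thesis by (simp add: Hneghalf_inner_def)
  qed
  have eq2: "H1_inner D (p2 i) (P2 i) = H1_inner D (p2 i) (Z2 i)" if "i \<in> {1..N}" for i
  proof -
    have "AE x in lebesgue_on D. P2 i x = Z2 i x"
      using assms that by (auto simp: data_eq_def P Z)
    then show ?thesis
      using H1_inner_cong_AE[of "P2 i" "Z2 i" "p2 i"] H1_inner_commute[of "p2 i"] by simp
  qed
  have eq3: "(LINT x|surface_measure D. L2_inner D (p3 i j x) (P3 i j x)) =
      (LINT x|surface_measure D. L2_inner D (p3 i j x) (Z3 i j x))" if "(i, j) \<in> pairs N" for i j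
  proof -
    have "AE x in surface_measure D. P3 i j x = Z3 i j x"
      using assms that by (auto simp: data_eq_def P Z)
    then show ?thesis
      by (intro surf.integral_cong_AE_complete) (auto elim!: AE_mp)
  qed
  show ?thesis
    unfolding p P Z data_inner_def by (auto intro!: sum.cong arg_cong2[of _ _ _ _ "(+)"] eq1 eq2 eq3)
qed

text \<open>Polarisation involves f i + f i, which is a trace of 2 w. If w had norm zero, the
  quotient norm of f i + f i would be zero and the inner product of f i with itself at most 0
  instead of 1.\<close>

lemma orthonormal_basis_nonzero:
  assumes f: "Hhalf_orthonormal_basis D f" and i: "i \<ge> 1" and w: "has_trace D w (f i)"
  shows "H1_norm D w \<noteq> 0"
proof
  assume 0: "H1_norm D w = 0"
  let ?T = "{u. has_trace D u (\<lambda>x. f i x + f i x)}"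
  have "(\<lambda>x. 2 * w x) \<in> ?T" using has_trace_cmult[OF w, of 2] by simp
  moreover have "H1_norm D (\<lambda>x. 2 * w x) = 0"
    using 0 w H1_norm_cmult[of w 2] by (simp add: has_trace_def)
  ultimately have "0 \<in> H1_norm D ` ?T" by force
  moreover have "bdd_below (H1_norm D ` ?T)"
    using H1_norm_nonneg by (intro bdd_belowI[of _ 0]) auto
  ultimately have "Hhalf_norm D (\<lambda>x. f i x + f i x) \<le> 0"
    unfolding Hhalf_norm_def by (rule cInf_lower)
  moreover have "0 \<le> Hhalf_norm D (\<lambda>x. f i x + f i x)"
    unfolding Hhalf_norm_def using \<open>0 \<in> H1_norm D ` ?T\<close> H1_norm_nonneg
    by (intro cInf_greatest) auto
  ultimately have "Hhalf_inner D (f i) (f i) \<le> 0"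
    by (simp add: Hhalf_inner_def)
  moreover have "Hhalf_inner D (f i) (f i) = 1"
    using f i by (simp add: Hhalf_orthonormal_basis_def)
  ultimately show False by simp
qed

text \<open>Otherwise f i would be a trace of the zero function, against
  \<open>orthonormal_basis_nonzero\<close>.\<close>

lemma orthonormal_basis_boundary_integral:
  assumes f: "Hhalf_orthonormal_basis D f" and i: "i \<ge> 1" and w: "has_trace D w (f i)"
  shows "(LINT x|surface_measure D. \<bar>f i x\<bar>\<^sup>2) \<noteq> 0"
proof
  assume "(LINT x|surface_measure D. \<bar>f i x\<bar>\<^sup>2) = 0"
  then have "AE x in surface_measure D. f i x = 0"
    using w by (intro square_integral_0_imp_AE) (auto simp: has_trace_def)
  then have "AE x in surface_measure D. 0 = f i x" by eventually_elim simp
  then have "has_trace D (\<lambda>_. 0) (f i)"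
    by (intro has_trace_cong_AE[OF has_trace_0]) auto
  from orthonormal_basis_nonzero[OF f i this] show False
    by (simp add: H1_norm_def H1.zero_left H1_0)
qed

end

section \<open>Nuclear norm, operator norm and adjoint\<close>

context potential_space begin

lemma svd_kernel_rep: "is_svd D W F r s a v \<Longrightarrow> kernel_rep F r (\<lambda>k x. s k * a k x) v"
  by (auto simp: is_svd_def kernel_rep_def tensor_def mult.assoc intro: H1.cmult_in)

lemma svd_op_of:
  assumes svd: "is_svd D W F r s a v" and b: "b \<in> H1 D"
  shows "op_of D F b = (\<lambda>y. \<Sum>k<r. (s k * H1_inner D (a k) b) * v k y)"
  unfolding kernel_rep_op_of[OF svd_kernel_rep[OF svd] b]
  using svd b by (intro ext sum.cong) (auto simp: is_svd_def H1.cmult_left)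

text \<open>The sum of the s' j equals that of the pairings of F with the second singular system.
  Expanding F in the first system, products are bounded by half sums of squares, and Bessel bounds
  each sum of squares by 1. By symmetry the value described by \<open>nuclear_norm\<close> is
  unique.\<close>

lemma svd_sum_le:
  assumes svd: "is_svd D W F r s a v" and svd': "is_svd D W F r' s' a' v'"
  shows "(\<Sum>j<r'. s' j) \<le> (\<Sum>k<r. s k)"
proof -
  have av: "s k > 0" "a k \<in> H1 D" "v k \<in> W" "H1_inner D (a k) (a k) = 1" "L2_inner D (v k) (v k) = 1"
    if "k < r" for k using svd that by (auto simp: is_svd_def)
  have av': "a' k \<in> H1 D" "v' k \<in> W" if "k < r'" for k using svd' that by (auto simp: is_svd_def)
  have orth': "H1_inner D (a' j) (a' k) = of_bool (j = k)" "L2_inner D (v' j) (v' k) = of_bool (j = k)"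
    if "j < r'" "k < r'" for j k using svd' that by (auto simp: is_svd_def)
  have "(\<Sum>j<r'. s' j) = (\<Sum>j<r'. L2_inner D (op_of D F (a' j)) (v' j))"
  proof (intro sum.cong refl)
    fix j assume j: "j \<in> {..<r'}"
    then have "L2_inner D (op_of D F (a' j)) (v' j) =
        (\<Sum>k<r'. s' k * H1_inner D (a' k) (a' j) * L2_inner D (v' k) (v' j))"
      unfolding svd_op_of[OF svd' av'(1)[OF j[simplified]]] using av' by (intro L2.sum_left) auto
    also have "\<dots> = (\<Sum>k<r'. if k = j then s' j else 0)"
      using orth' j by (intro sum.cong) auto
    finally show "s' j = L2_inner D (op_of D F (a' j)) (v' j)" using j by simp
  qed
  also have "\<dots> = (\<Sum>j<r'. \<Sum>k<r. s k * H1_inner D (a k) (a' j) * L2_inner D (v k) (v' j))"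
  proof (intro sum.cong refl)
    fix j assume j: "j \<in> {..<r'}"
    then show "L2_inner D (op_of D F (a' j)) (v' j) =
        (\<Sum>k<r. s k * H1_inner D (a k) (a' j) * L2_inner D (v k) (v' j))"
      unfolding svd_op_of[OF svd av'(1)[OF j[simplified]]] using av av' by (intro L2.sum_left) auto
  qed
  also have "\<dots> = (\<Sum>k<r. s k * (\<Sum>j<r'. H1_inner D (a k) (a' j) * L2_inner D (v k) (v' j)))"
    by (subst sum.swap) (simp add: sum_distrib_left mult.assoc)
  also have "\<dots> \<le> (\<Sum>k<r. s k * 1)"
  proof (intro sum_mono mult_left_mono)
    fix k assume k: "k \<in> {..<r}"
    have "(\<Sum>j<r'. H1_inner D (a k) (a' j) * L2_inner D (v k) (v' j)) \<le>
        (\<Sum>j<r'. ((H1_inner D (a' j) (a k))\<^sup>2 + (L2_inner D (v' j) (v k))\<^sup>2) / 2)"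
    proof (intro sum_mono)
      fix j
      show "H1_inner D (a k) (a' j) * L2_inner D (v k) (v' j) \<le>
          ((H1_inner D (a' j) (a k))\<^sup>2 + (L2_inner D (v' j) (v k))\<^sup>2) / 2"
        using sum_squares_bound[of "H1_inner D (a' j) (a k)" "L2_inner D (v' j) (v k)"]
        by (simp add: H1_inner_commute[of "a k"] L2_inner_commute[of D "v k"])
    qed
    also have "\<dots> = ((\<Sum>j<r'. (H1_inner D (a' j) (a k))\<^sup>2) + (\<Sum>j<r'. (L2_inner D (v' j) (v k))\<^sup>2)) / 2"
      by (simp add: sum.distrib flip: sum_divide_distrib)
    also have "\<dots> \<le> 1"
      using H1.Bessel[of r' a' "a k"] L2.Bessel[of r' v' "v k"] av[of k] k av' orth' by simp
    finally show "(\<Sum>j<r'. H1_inner D (a k) (a' j) * L2_inner D (v k) (v' j)) \<le> 1" .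
  qed (use av in \<open>auto intro: less_imp_le\<close>)
  finally show ?thesis by simp
qed

lemma nuclear_norm_eq:
  assumes "is_svd D W F r s a v"
  shows "nuclear_norm D W F = (\<Sum>k<r. s k)"
  unfolding nuclear_norm_def
proof (rule the_equality)
  show "\<exists>r' s' a' v'. is_svd D W F r' s' a' v' \<and> (\<Sum>k<r. s k) = (\<Sum>k<r'. s' k)"
    using assms by blast
  fix t assume "\<exists>r' s' a' v'. is_svd D W F r' s' a' v' \<and> t = (\<Sum>k<r'. s' k)"
  then show "t = (\<Sum>k<r. s k)"
    using assms svd_sum_le by (auto intro: antisym)
qed

lemma svd_rank_one:
  assumes "u \<in> H1 D" "q \<in> W" "H1_inner D u u = 1" "L2_inner D q q = 1" "\<sigma> > 0"
    and "AE x in lebesgue_on D. \<forall>y. F x y = \<sigma> * tensor u q x y"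
  shows "is_svd D W F 1 (\<lambda>_. \<sigma>) (\<lambda>_. u) (\<lambda>_. q)"
  using assms by (simp add: is_svd_def)

text \<open>The Hilbert-Schmidt product is obtained by expanding F alone, so K has to be estimated
  only on the singular pairs of F.\<close>

lemma H1W_inner_svd:
  assumes K: "K \<in> H1W D W" and svd: "is_svd D W F r s a v"
  shows "H1W_inner D K F = (\<Sum>k<r. s k * L2_inner D (op_of D K (a k)) (v k))"
proof -
  have av: "a k \<in> H1 D" "v k \<in> W" if "k \<in> {..<r}" for k using svd that by (auto simp: is_svd_def)
  note opW = op_of_in_W[OF K av(1)]
  have "H1_inner D (\<lambda>x. K x y) (\<lambda>x. F x y) = (\<Sum>k<r. s k * (op_of D K (a k) y * v k y))" for y
  proof -
    have "H1_inner D (\<lambda>x. F x y) (\<lambda>x. K x y) = (\<Sum>k<r. H1_inner D (\<lambda>x. s k * a k x) (\<lambda>x. K x y) * v k y)"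
      by (rule kernel_rep_slice(2)[OF svd_kernel_rep[OF svd] H1W_slice[OF K]])
    also have "\<dots> = (\<Sum>k<r. s k * (op_of D K (a k) y * v k y))"
      using av H1W_slice[OF K, of y] H1_inner_commute[of _ "\<lambda>x. K x y"]
      by (intro sum.cong refl) (simp add: H1.cmult_left H1.cmult_right op_of_def mult_ac)
    finally show ?thesis by (simp add: H1_inner_commute)
  qed
  then have "H1W_inner D K F = (LINT y|lebesgue_on D. (\<Sum>k<r. s k * (op_of D K (a k) y * v k y)))"
    by (simp add: H1W_inner_def)
  also have "\<dots> = (\<Sum>k<r. LINT y|lebesgue_on D. s k * (op_of D K (a k) y * v k y))"
    by (intro Bochner_Integration.integral_sum integrable_mult_right W_mult_integrable opW av)
  finally show ?thesis by (simp add: L2_inner_def)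
qed

lemma op_of_lincomb:
  assumes "V \<in> H1W D W" "a \<in> H1 D" "b \<in> H1 D"
  shows "op_of D V (\<lambda>x. c * a x + d * b x) = (\<lambda>y. c * op_of D V a y + d * op_of D V b y)"
  using assms H1W_slice[OF assms(1)] by (simp add: op_of_def H1.lincomb_right)

text \<open>Shows that the set in \<open>op_norm\<close> is bounded above, so that its supremum is a
  genuine bound.\<close>

lemma op_of_bounded:
  assumes V: "V \<in> H1W D W"
  shows "\<exists>C. \<forall>b\<in>H1 D. L2_norm D (op_of D V b) \<le> C * H1_norm D b"
proof -
  obtain n a w where rep: "kernel_rep V n a w" using kernel_rep_exists[OF V] by blast
  have aw: "a l \<in> H1 D" "w l \<in> W" if "l < n" for l using rep that by (auto simp: kernel_rep_def)
  define C where "C = (\<Sum>l<n. H1_norm D (a l) * L2_norm D (w l))"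
  have "L2_norm D (op_of D V b) \<le> C * H1_norm D b" if b: "b \<in> H1 D" for b
  proof -
    define t where "t = op_of D V b"
    have t: "t \<in> W" using op_of_in_W[OF V b] by (simp add: t_def)
    have "(L2_norm D t)\<^sup>2 = L2_inner D (\<lambda>y. \<Sum>l<n. H1_inner D (a l) b * w l y) t"
      using kernel_rep_op_of[OF rep b] by (simp add: L2_norm_power2 t_def)
    also have "\<dots> = (\<Sum>l<n. H1_inner D (a l) b * L2_inner D (w l) t)"
      using aw t by (intro L2.sum_left) auto
    also have "\<dots> \<le> (\<Sum>l<n. (H1_norm D (a l) * H1_norm D b) * (L2_norm D (w l) * L2_norm D t))"
    proof (intro sum_mono)
      fix l assume l: "l \<in> {..<n}"
      have "\<bar>H1_inner D (a l) b\<bar> * \<bar>L2_inner D (w l) t\<bar> \<le>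
          (H1_norm D (a l) * H1_norm D b) * (L2_norm D (w l) * L2_norm D t)"
        using l aw b t by (intro mult_mono H1_Cauchy_Schwarz L2_Cauchy_Schwarz mult_nonneg_nonneg H1_norm_nonneg) auto
      then show "H1_inner D (a l) b * L2_inner D (w l) t \<le>
          (H1_norm D (a l) * H1_norm D b) * (L2_norm D (w l) * L2_norm D t)"
        using abs_ge_self[of "H1_inner D (a l) b * L2_inner D (w l) t"] by (simp add: abs_mult)
    qed
    also have "\<dots> = (C * H1_norm D b) * L2_norm D t"
      by (simp add: C_def sum_distrib_left sum_distrib_right mult_ac)
    finally have le: "L2_norm D t * L2_norm D t \<le> (C * H1_norm D b) * L2_norm D t"
      by (simp add: power2_eq_square)
    have "0 \<le> C"
      unfolding C_def by (intro sum_nonneg mult_nonneg_nonneg H1_norm_nonneg L2_norm_nonneg)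
    then have "0 \<le> C * H1_norm D b" using H1_norm_nonneg by simp
    with le show ?thesis
      unfolding t_def[symmetric] using L2_norm_nonneg[of D t] by (cases "L2_norm D t = 0") auto
  qed
  then show ?thesis by blast
qed

lemma L2_norm_cmult: "w \<in> W \<Longrightarrow> L2_norm D (\<lambda>x. c * w x) = \<bar>c\<bar> * L2_norm D w"
  unfolding L2_norm_def
  by (simp add: L2.cmult_left L2.cmult_right L2.cmult_in real_sqrt_mult flip: mult.assoc)

lemma op_norm_bound:
  assumes V: "V \<in> H1W D W" and b: "b \<in> H1 D"
  shows "L2_norm D (op_of D V b) \<le> op_norm D V * H1_norm D b"
proof -
  let ?S = "{L2_norm D (op_of D V a) | a. a \<in> H1 D \<and> H1_norm D a \<le> 1}"
  obtain C where C: "\<And>b. b \<in> H1 D \<Longrightarrow> L2_norm D (op_of D V b) \<le> C * H1_norm D b"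
    using op_of_bounded[OF V] by blast
  have bdd: "bdd_above ?S"
  proof (rule bdd_aboveI)
    fix t assume "t \<in> ?S"
    then obtain a where a: "a \<in> H1 D" "H1_norm D a \<le> 1" "t = L2_norm D (op_of D V a)" by blast
    have "C * H1_norm D a \<le> \<bar>C\<bar> * 1"
      using a(2) H1_norm_nonneg[of a] by (intro mult_mono) auto
    with C[OF a(1)] a(3) show "t \<le> \<bar>C\<bar>" by simp
  qed
  show ?thesis
  proof (cases "H1_norm D b = 0")
    case True
    then show ?thesis using C[OF b] by simp
  next
    case False
    define c where "c = 1 / H1_norm D b"
    have c: "c > 0" "c * H1_norm D b = 1" using False H1_norm_nonneg[of b] by (auto simp: c_def)
    have "H1_norm D (\<lambda>x. c * b x) = 1" using c by (simp add: H1_norm_cmult[OF b])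
    then have "L2_norm D (op_of D V (\<lambda>x. c * b x)) \<in> ?S" using H1.cmult_in[OF b] by force
    then have "L2_norm D (op_of D V (\<lambda>x. c * b x)) \<le> op_norm D V"
      unfolding op_norm_def using bdd by (rule cSup_upper)
    moreover have "op_of D V (\<lambda>x. c * b x) = (\<lambda>y. c * op_of D V b y)"
      using op_of_lincomb[OF V b b, of c 0] by simp
    ultimately have "c * L2_norm D (op_of D V b) \<le> op_norm D V"
      using c(1) L2_norm_cmult[OF op_of_in_W[OF V b], of c] by simp
    then have "H1_norm D b * (c * L2_norm D (op_of D V b)) \<le> H1_norm D b * op_norm D V"
      using H1_norm_nonneg by (rule mult_left_mono)
    then show ?thesis using c(2) by (simp add: mult_ac flip: mult.assoc)
  qed
qed

text \<open>\<open>adjoint_of\<close> is a choice, so its defining property needs a witness: for a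
  sum of tensors of a l and v l it is the combination of the a l with coefficients
  \<open>L2_inner D w (v l)\<close>.\<close>

lemma adjoint_of_eq_0:
  assumes V: "V \<in> H1W D W" and w: "w \<in> W" and ae: "AE x in lebesgue_on D. adjoint_of D V w x = 0"
    and b: "b \<in> H1 D"
  shows "L2_inner D w (op_of D V b) = 0"
proof -
  obtain n a v where rep: "kernel_rep V n a v" using kernel_rep_exists[OF V] by blast
  have av: "a l \<in> H1 D" "v l \<in> W" if "l \<in> {..<n}" for l using rep that by (auto simp: kernel_rep_def)
  let ?P = "\<lambda>a. a \<in> H1 D \<and> (\<forall>b\<in>H1 D. H1_inner D a b = L2_inner D w (op_of D V b))"
  have "?P (\<lambda>x. \<Sum>l<n. L2_inner D w (v l) * a l x)"
  proof (intro conjI ballI)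
    show "(\<lambda>x. \<Sum>l<n. L2_inner D w (v l) * a l x) \<in> H1 D" by (intro H1.sum_in av)
    fix b assume b: "b \<in> H1 D"
    have "H1_inner D (\<lambda>x. \<Sum>l<n. L2_inner D w (v l) * a l x) b = (\<Sum>l<n. L2_inner D w (v l) * H1_inner D (a l) b)"
      by (intro H1.sum_left av b)
    also have "\<dots> = L2_inner D w (op_of D V b)"
      unfolding kernel_rep_op_of[OF rep b] using av w by (subst L2.sum_right) (auto simp: mult.commute)
    finally show "H1_inner D (\<lambda>x. \<Sum>l<n. L2_inner D w (v l) * a l x) b = L2_inner D w (op_of D V b)" .
  qed
  then have "?P (adjoint_of D V w)"
    unfolding adjoint_of_def by (rule someI[of ?P])
  then have "L2_inner D w (op_of D V b) = H1_inner D (adjoint_of D V w) b"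
    using b by simp
  also have "\<dots> = H1_inner D (\<lambda>_. 0) b"
    by (rule H1_inner_cong_AE) (use ae in \<open>eventually_elim, simp\<close>)
  finally show ?thesis using b by (simp add: H1.zero_left)
qed

text \<open>
  With \<open>\<alpha> = \<langle>u, a\<rangle>\<close>, \<open>\<beta> = \<langle>q, v\<rangle>\<close> and \<open>A\<close>, \<open>B\<close> the norms of the components of \<open>a\<close>, \<open>v\<close>
  orthogonal to \<open>u\<close>, \<open>q\<close>, the pairing is at most \<open>\<alpha>\<beta> + \<parallel>V\<parallel>AB \<le> \<alpha>\<beta> + AB \<le> 1\<close>, and
  \<open>\<parallel>V\<parallel> < 1\<close> forces \<open>AB = 0\<close> in the case of equality.
\<close>

lemma certificate_rank_one:
  assumes u: "u \<in> H1 D" "H1_inner D u u = 1" and q: "q \<in> W" "L2_inner D q q = 1"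
    and V: "V \<in> H1W D W" "op_of D V u = (\<lambda>_. 0)" "\<And>b. b \<in> H1 D \<Longrightarrow> L2_inner D q (op_of D V b) = 0"
      "op_norm D V < 1"
    and a: "a \<in> H1 D" "H1_inner D a a = 1" and v: "v \<in> W" "L2_inner D v v = 1"
  defines "g \<equiv> H1_inner D u a * L2_inner D q v + L2_inner D (op_of D V a) v"
  shows "g \<le> 1"
    and "g = 1 \<Longrightarrow> AE x in lebesgue_on D. \<forall>y. a x * v y = u x * q y"
proof -
  define \<alpha> \<beta> where "\<alpha> = H1_inner D u a" and "\<beta> = L2_inner D q v"
  define a' where "a' x = 1 * a x + (- \<alpha>) * u x" for x
  define v' where "v' y = 1 * v y + (- \<beta>) * q y" for y
  have a': "a' \<in> H1 D" unfolding a'_def[abs_def] using a(1) u(1) by (rule H1_lincomb)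
  have v': "v' \<in> W" unfolding v'_def[abs_def] using v(1) q(1) by (rule W_lincomb)
  define A B where "A = H1_norm D a'" and "B = L2_norm D v'"
  have "H1_inner D a' a' = 1 - \<alpha>\<^sup>2"
    unfolding a'_def[abs_def] H1.lincomb_self[OF a(1) u(1)]
    using a(2) u(2) H1_inner_commute[of a u] by (simp add: \<alpha>_def power2_eq_square)
  then have A: "\<alpha>\<^sup>2 + A\<^sup>2 = 1" "0 \<le> A" by (auto simp: A_def H1_norm_power2 H1_norm_nonneg)
  have "L2_inner D v' v' = 1 - \<beta>\<^sup>2"
    unfolding v'_def[abs_def] L2.lincomb_self[OF v(1) q(1)]
    using v(2) q(2) L2_inner_commute[of D v q] by (simp add: \<beta>_def power2_eq_square)
  then have B: "\<beta>\<^sup>2 + B\<^sup>2 = 1" "0 \<le> B" by (auto simp: B_def L2_norm_power2 L2_norm_nonneg)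
  note Va = op_of_in_W[OF V(1) a(1)]
  have "op_of D V a' = op_of D V a"
    unfolding a'_def[abs_def] op_of_lincomb[OF V(1) a(1) u(1)] using V(2) by simp
  moreover have "L2_inner D (op_of D V a) v' = L2_inner D (op_of D V a) v"
    unfolding v'_def[abs_def] L2.lincomb_right[OF v(1) q(1) Va]
    using V(3)[OF a(1)] by (simp add: L2_inner_commute)
  ultimately have "L2_inner D (op_of D V a) v \<le> L2_norm D (op_of D V a') * B"
    using L2_Cauchy_Schwarz[OF Va v'] by (simp add: B_def abs_le_iff)
  also have "\<dots> \<le> op_norm D V * A * B"
    using op_norm_bound[OF V(1) a'] B(2) by (intro mult_right_mono) (auto simp: A_def)
  finally have g: "g \<le> \<alpha> * \<beta> + op_norm D V * A * B" by (simp add: g_def \<alpha>_def \<beta>_def)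
  have AB: "0 \<le> A * B" using A(2) B(2) by simp
  then have "op_norm D V * (A * B) \<le> 1 * (A * B)" using V(4) by (intro mult_right_mono) auto
  with g have g': "g \<le> \<alpha> * \<beta> + A * B" by (simp add: mult.assoc)
  have one: "\<alpha> * \<beta> + A * B \<le> 1"
    using sum_squares_bound[of \<alpha> \<beta>] sum_squares_bound[of A B] A(1) B(1) by linarith
  show "g \<le> 1" using g' one by linarith
  assume "g = 1"
  then have "(1 - op_norm D V) * (A * B) \<le> 0"
    using g one by (simp add: algebra_simps)
  moreover have "0 < 1 - op_norm D V" using V(4) by simp
  ultimately have "A * B = 0"
    using AB by (metis antisym mult_le_cancel_left_pos mult_zero_right)
  then have \<alpha>\<beta>: "\<alpha> * \<beta> = 1" using g' one \<open>g = 1\<close> by linarith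
  \<comment> \<open>With \<alpha>\<beta> = 1 the normalisations give (\<alpha> - \<beta>)^2 + A^2 +
    B^2 = 0, so both A and B vanish and not just their product.\<close>
  have "0 \<le> (\<alpha> - \<beta>)\<^sup>2" by simp
  moreover have "(\<alpha> - \<beta>)\<^sup>2 = \<alpha>\<^sup>2 + \<beta>\<^sup>2 - 2 * (\<alpha> * \<beta>)" by (simp add: power2_eq_square algebra_simps)
  moreover have "0 \<le> A\<^sup>2" "0 \<le> B\<^sup>2" by simp_all
  ultimately have "A\<^sup>2 = 0" "B\<^sup>2 = 0" using A(1) B(1) \<alpha>\<beta> by linarith+
  then have "A = 0" "B = 0" by simp_all
  then have "AE x in lebesgue_on D. a' x = 0" and v'0: "v' = (\<lambda>_. 0)"
    using H1_norm_eq_0_imp_AE[OF a'] W_eq_0[OF v'] by (auto simp: A_def B_def)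
  have vq: "v y = \<beta> * q y" for y using fun_cong[OF v'0, of y] by (simp add: v'_def)
  show "AE x in lebesgue_on D. \<forall>y. a x * v y = u x * q y"
    using \<open>AE x in lebesgue_on D. a' x = 0\<close>
  proof eventually_elim
    case (elim x)
    then have "a x = \<alpha> * u x" by (simp add: a'_def)
    \<comment> \<open>\<alpha> and \<beta> may both be -1; only their product enters the
      tensor.\<close>
    then have "a x * v y = (\<alpha> * \<beta>) * (u x * q y)" for y by (simp add: vq)
    then show ?case by (simp add: \<alpha>\<beta>)
  qed
qed

text \<open>Each singular pair of F contributes \<open>s k * g k\<close> with
  \<open>g k \<le> 1\<close>. As the weights are positive, equality of the sums forces
  \<open>g k = 1\<close> for every k, so all the tensors coincide with that of u and q and the
  decomposition collapses to one term.\<close>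

lemma certificate_pairing:
  assumes u: "u \<in> H1 D" "H1_inner D u u = 1" and q: "q \<in> W" "L2_inner D q q = 1"
    and V: "V \<in> H1W D W" "op_of D V u = (\<lambda>_. 0)" "\<And>b. b \<in> H1 D \<Longrightarrow> L2_inner D q (op_of D V b) = 0"
      "op_norm D V < 1"
    and K: "K \<in> H1W D W" "AE x in lebesgue_on D. \<forall>y. K x y = tensor u q x y + V x y"
    and F: "F \<in> H1W D W"
  shows "H1W_inner D K F \<le> nuclear_norm D W F"
    and "H1W_inner D K F = nuclear_norm D W F \<Longrightarrow>
      AE x in lebesgue_on D. \<forall>y. F x y = nuclear_norm D W F * tensor u q x y"
proof -
  obtain r s a v where svd: "is_svd D W F r s a v" using svd_exists[OF F] by blast
  have sav: "s k > 0" "a k \<in> H1 D" "v k \<in> W" "H1_inner D (a k) (a k) = 1" "L2_inner D (v k) (v k) = 1"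
    if "k < r" for k using svd that by (auto simp: is_svd_def)
  define g where "g k = H1_inner D u (a k) * L2_inner D q (v k) + L2_inner D (op_of D V (a k)) (v k)" for k
  have cert: "g k \<le> 1" "g k = 1 \<Longrightarrow> AE x in lebesgue_on D. \<forall>y. a k x * v k y = u x * q y" if "k < r" for k
    using certificate_rank_one[OF u q V sav(2)[OF that] sav(4)[OF that] sav(3)[OF that] sav(5)[OF that]]
    by (simp_all add: g_def)
  have op: "op_of D K b = (\<lambda>y. H1_inner D u b * q y + 1 * op_of D V b y)" if b: "b \<in> H1 D" for b
  proof
    fix y
    have "AE x in lebesgue_on D. q y * u x + 1 * V x y = K x y"
      using K(2) by eventually_elim (simp add: tensor_def)
    then have "H1_inner D (\<lambda>x. K x y) b = H1_inner D (\<lambda>x. q y * u x + 1 * V x y) b"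
      by (rule H1_inner_cong_AE)
    also have "\<dots> = q y * H1_inner D u b + 1 * H1_inner D (\<lambda>x. V x y) b"
      using u(1) H1W_slice[OF V(1)] b by (rule H1_inner_lincomb_left)
    finally show "op_of D K b y = H1_inner D u b * q y + 1 * op_of D V b y" by (simp add: op_of_def)
  qed
  have "L2_inner D (op_of D K (a k)) (v k) = g k" if "k < r" for k
    unfolding op[OF sav(2)[OF that]]
      L2_inner_lincomb_left[OF q(1) op_of_in_W[OF V(1) sav(2)[OF that]] sav(3)[OF that]]
    by (simp add: g_def)
  then have pair: "H1W_inner D K F = (\<Sum>k<r. s k * g k)"
    unfolding H1W_inner_svd[OF K(1) svd] by simp
  have nn: "nuclear_norm D W F = (\<Sum>k<r. s k)" by (rule nuclear_norm_eq[OF svd])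
  have le: "s k * g k \<le> s k" if "k < r" for k
    using cert(1)[OF that] sav(1)[OF that] by simp
  then show "H1W_inner D K F \<le> nuclear_norm D W F"
    unfolding pair nn by (intro sum_mono) auto
  assume "H1W_inner D K F = nuclear_norm D W F"
  then have "(\<Sum>k<r. s k - s k * g k) = 0" by (simp add: pair nn sum_subtractf)
  then have "\<forall>k\<in>{..<r}. s k - s k * g k = 0"
    using le by (subst (asm) sum_nonneg_eq_0_iff) auto
  then have "s k * (1 - g k) = 0" if "k < r" for k using that by (simp add: right_diff_distrib)
  then have "g k = 1" if "k < r" for k using sav(1)[OF that] that by fastforce
  then have "AE x in lebesgue_on D. \<forall>k\<in>{..<r}. \<forall>y. a k x * v k y = u x * q y"
    using cert(2) by (subst AE_finite_all) auto
  moreover have "AE x in lebesgue_on D. \<forall>y. F x y = (\<Sum>k<r. s k * tensor (a k) (v k) x y)"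
    using svd by (simp add: is_svd_def)
  ultimately show "AE x in lebesgue_on D. \<forall>y. F x y = nuclear_norm D W F * tensor u q x y"
    by eventually_elim (simp add: nn tensor_def sum_distrib_right)
qed

text \<open>For each y the traces agree off a null set depending on y; testing at finitely many
  interpolation nodes yields one null set for whole elements of W.\<close>

lemma has_traceW_unique:
  assumes "has_traceW D W F G" "has_traceW D W F G'"
  shows "AE x in surface_measure D. G x = G' x"
proof -
  obtain Y e where Y: "finite Y" "Y \<subseteq> closure D" "\<And>w. w \<in> W \<Longrightarrow> interpolates Y e w"
    using W_interpolation by blast
  have "AE x in surface_measure D. G x y = G' x y" if "y \<in> Y" for y
    using assms that Y(2) has_trace_unique unfolding has_traceW_def by blast
  then have "AE x in surface_measure D. \<forall>y\<in>Y. G x y = G' x y"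
    using Y(1) by (subst AE_finite_all) auto
  with AE_surface_frontier show ?thesis
  proof eventually_elim
    case (elim x)
    then have "interpolates Y e (G x)" "interpolates Y e (G' x)"
      using assms Y(3) by (auto simp: has_traceW_def)
    then have "G x z = (\<Sum>y\<in>Y. G x y * e y z)" "G' x z = (\<Sum>y\<in>Y. G' x y * e y z)" for z
      unfolding interpolates_def by blast+
    with elim(2) show ?case by (metis (no_types, lifting) ext sum.cong)
  qed
qed

text \<open>For a multiple of a tensor a trace can be written down, so the chosen
  \<open>traceW\<close> is a trace as well, and uniqueness identifies the two.\<close>

lemma traceW_rank_one:
  assumes f: "has_trace D u f" and q: "q \<in> W"
    and F: "AE x in lebesgue_on D. \<forall>y. F x y = c * tensor u q x y"
  shows "AE x in surface_measure D. traceW D W F x = (\<lambda>y. c * f x * q y)"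
proof -
  have "has_trace D (\<lambda>x. F x y) (\<lambda>x. c * f x * q y)" for y
  proof (rule has_trace_cong_AE[OF has_trace_cmult[OF f]])
    show "AE x in lebesgue_on D. c * q y * u x = F x y"
      using F by eventually_elim (simp add: tensor_def)
  qed (simp add: mult_ac)
  then have tr: "has_traceW D W F (\<lambda>x y. c * f x * q y)"
    unfolding has_traceW_def using L2.cmult_in[OF q] by blast
  have "has_traceW D W F (traceW D W F)"
    unfolding traceW_def using someI[of "has_traceW D W F", OF tr] .
  from has_traceW_unique[OF this tr] show ?thesis .
qed

lemma tensor_in_H1W:
  assumes u: "u \<in> H1 D" and q: "q \<in> W"
  shows "tensor u q \<in> H1W D W"
proof -
  have "(\<lambda>x. u x * q y) \<in> H1 D" for y
    using H1.cmult_in[OF u, of "q y"] by (simp add: mult.commute)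
  then show ?thesis
    using L2.cmult_in[OF q] by (simp add: H1W_def tensor_def[abs_def])
qed

lemma zero_in_H1W: "(\<lambda>_ _. 0) \<in> H1W D W"
  using W_0 H1_0 by (auto simp: H1W_def)

lemma H1W_inner_0_right: "K \<in> H1W D W \<Longrightarrow> H1W_inner D K (\<lambda>_ _. 0) = 0"
  using H1W_slice[of K] H1.zero_left by (simp add: H1W_inner_def H1_inner_commute[of _ "\<lambda>_. 0"])

end

section \<open>Minimality, uniqueness and recovery of the potential\<close>

theorem proposition5p3:
  fixes \<Omega> :: "'a::euclidean_space set"
    and W :: "('a \<Rightarrow> real) set"
    and q :: "'a \<Rightarrow> real"
    and f u :: "nat \<Rightarrow> 'a \<Rightarrow> real"
    and N :: nat
  assumes "DIM('a) \<ge> 2"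
    and "bounded_lipschitz_domain \<Omega>"
    and "finite_dim_subspace_C \<Omega> W"
    and "q \<in> W"
    and "\<not> dirichlet_eigenvalue \<Omega> q 0"
    and "(LINT x|lebesgue_on \<Omega>. q x) \<noteq> 0"
    and "Hhalf_orthonormal_basis \<Omega> f"
    and "\<forall>i\<ge>1. \<exists>C. AE x in surface_measure \<Omega>. \<bar>f i x\<bar> \<le> C"
    and "\<forall>i\<ge>1. weak_solution \<Omega> q (\<lambda>_. 0) (f i) (u i)"
    and "N \<ge> 1"
    and "NDSC \<Omega> W q f u N"
  shows "is_unique_minimizer \<Omega> W q f N (Phi \<Omega> W q f (\<lambda>i. tensor (u i) q)) (\<lambda>i. tensor (u i) q)
    \<and> (\<forall>i\<in>{1..N}. tensor (u i) q =
         (\<lambda>x y. (H1_norm \<Omega> (u i) * L2_norm \<Omega> q) *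
            tensor (normalized_solution \<Omega> (u i)) (normalized_potential \<Omega> q) x y))
    \<and> (\<forall>i\<in>{1..N}. q = (\<lambda>y. 1 / (LINT x|surface_measure \<Omega>. \<bar>f i x\<bar>\<^sup>2) *
         (LINT x|surface_measure \<Omega>. traceW \<Omega> W (tensor (u i) q) x y * f i x)))"
proof -
  interpret potential_space \<Omega> W
    using assms(2,3) by unfold_locales
  note q = \<open>q \<in> W\<close> and basis = \<open>Hhalf_orthonormal_basis \<Omega> f\<close>
  have trace: "has_trace \<Omega> (u i) (f i)" if "i \<in> {1..N}" for i
    using assms(9) that by (simp add: weak_solution_def)
  have u: "u i \<in> H1 \<Omega>" if "i \<in> {1..N}" for i
    using trace[OF that] by (simp add: has_trace_def)
  have u_pos: "0 < H1_norm \<Omega> (u i)" if "i \<in> {1..N}" for i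
    using orthonormal_basis_nonzero[OF basis _ trace[OF that]] that H1_norm_nonneg[of "u i"] by simp
  \<comment> \<open>A potential of norm zero would be the zero function and have mean zero.\<close>
  have "L2_norm \<Omega> q \<noteq> 0" using W_eq_0[OF q] assms(6) by auto
  then have q_pos: "0 < L2_norm \<Omega> q" using L2_norm_nonneg[of \<Omega> q] by simp
  define U where "U i = normalized_solution \<Omega> (u i)" for i
  define Q where "Q = normalized_potential \<Omega> q"
  define \<sigma> where "\<sigma> i = H1_norm \<Omega> (u i) * L2_norm \<Omega> q" for i
  have U: "U i \<in> H1 \<Omega>" "H1_inner \<Omega> (U i) (U i) = 1" if "i \<in> {1..N}" for i
  proof -
    have eq: "U i = (\<lambda>x. (1 / H1_norm \<Omega> (u i)) * u i x)"
      by (simp add: U_def normalized_solution_def)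
    show "U i \<in> H1 \<Omega>" unfolding eq using u[OF that] by (rule H1.cmult_in)
    have "H1_norm \<Omega> (U i) = 1"
      unfolding eq H1_norm_cmult[OF u[OF that]] using u_pos[OF that] by simp
    then show "H1_inner \<Omega> (U i) (U i) = 1" using H1_norm_power2[of "U i"] by simp
  qed
  have Q: "Q \<in> W" "L2_inner \<Omega> Q Q = 1"
  proof -
    have eq: "Q = (\<lambda>x. (1 / L2_norm \<Omega> q) * q x)"
      by (simp add: Q_def normalized_potential_def)
    show "Q \<in> W" unfolding eq using q by (rule L2.cmult_in)
    have "L2_norm \<Omega> Q = 1"
      unfolding eq L2_norm_cmult[OF q] using q_pos by simp
    then show "L2_inner \<Omega> Q Q = 1" using L2_norm_power2[of \<Omega> Q] by simp
  qed
  have \<sigma>_pos: "0 < \<sigma> i" if "i \<in> {1..N}" for i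
    using u_pos[OF that] q_pos by (simp add: \<sigma>_def)
  have decomp: "tensor (u i) q x y = \<sigma> i * tensor (U i) Q x y" if "i \<in> {1..N}" for i x y
    using u_pos[OF that] q_pos
    by (simp add: tensor_def \<sigma>_def U_def Q_def normalized_solution_def normalized_potential_def)
  let ?F = "\<lambda>i. tensor (u i) q"
  have F: "?F i \<in> H1W \<Omega> W" if "i \<in> {1..N}" for i
    using u[OF that] q by (rule tensor_in_H1W)
  have F_nn: "nuclear_norm \<Omega> W (?F i) = \<sigma> i" if "i \<in> {1..N}" for i
    using nuclear_norm_eq[OF svd_rank_one[OF U(1)[OF that] Q(1) U(2)[OF that] Q(2) \<sigma>_pos[OF that], of "?F i"]]
    by (simp add: decomp[OF that])
  define is_remainder where "is_remainder K i X \<longleftrightarrow> X \<in> H1W \<Omega> W \<and>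
        (AE x in lebesgue_on \<Omega>. \<forall>y. K x y = tensor (U i) Q x y + X x y) \<and>
        op_of \<Omega> X (U i) = (\<lambda>_. 0) \<and> (AE x in lebesgue_on \<Omega>. adjoint_of \<Omega> X Q x = 0) \<and> op_norm \<Omega> X < 1"
    for K i X
  obtain H where H: "H \<in> range_Phi_adjoint \<Omega> W q f N" and "\<forall>i\<in>{1..N}. \<exists>X. is_remainder (H i) i X"
    using \<open>NDSC \<Omega> W q f u N\<close> unfolding NDSC_def U_def Q_def is_remainder_def by blast
  then obtain V where "\<And>i. i \<in> {1..N} \<Longrightarrow> is_remainder (H i) i (V i)"
    by metis
  note V = this[unfolded is_remainder_def]
  obtain p where H_in: "\<And>i. i \<in> {1..N} \<Longrightarrow> H i \<in> H1W \<Omega> W"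
    and H_adj: "\<And>F. (\<And>i. i \<in> {1..N} \<Longrightarrow> F i \<in> H1W \<Omega> W) \<Longrightarrow>
        (\<Sum>i=1..N. H1W_inner \<Omega> (H i) (F i)) = data_inner \<Omega> N p (Phi \<Omega> W q f F)"
    using H unfolding range_Phi_adjoint_def by blast
  have cert: "H1W_inner \<Omega> (H i) G \<le> nuclear_norm \<Omega> W G"
    "H1W_inner \<Omega> (H i) G = nuclear_norm \<Omega> W G \<Longrightarrow>
      AE x in lebesgue_on \<Omega>. \<forall>y. G x y = nuclear_norm \<Omega> W G * tensor (U i) Q x y"
    if i: "i \<in> {1..N}" and G: "G \<in> H1W \<Omega> W" for i G
  proof -
    note Vi = V[OF i]
    have Vq: "L2_inner \<Omega> Q (op_of \<Omega> (V i) b) = 0" if "b \<in> H1 \<Omega>" for b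
      using adjoint_of_eq_0[OF _ Q(1) _ that] Vi by blast
    show "H1W_inner \<Omega> (H i) G \<le> nuclear_norm \<Omega> W G"
      using Vi by (intro certificate_pairing(1)[OF U[OF i] Q _ _ Vq _ H_in[OF i] _ G]) auto
    show "AE x in lebesgue_on \<Omega>. \<forall>y. G x y = nuclear_norm \<Omega> W G * tensor (U i) Q x y"
      if "H1W_inner \<Omega> (H i) G = nuclear_norm \<Omega> W G"
      using Vi that by (intro certificate_pairing(2)[OF U[OF i] Q _ _ Vq _ H_in[OF i] _ G]) auto
  qed
  have H_F: "H1W_inner \<Omega> (H i) (?F i) = \<sigma> i" if i: "i \<in> {1..N}" for i
  proof -
    note Vi = V[OF i]
    have svd: "is_svd \<Omega> W (?F i) 1 (\<lambda>_. \<sigma> i) (\<lambda>_. U i) (\<lambda>_. Q)"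
      by (rule svd_rank_one[OF U(1)[OF i] Q(1) U(2)[OF i] Q(2) \<sigma>_pos[OF i]]) (simp add: decomp[OF i])
    \<comment> \<open>\<open>V i\<close> annihilates \<open>U i\<close>, so \<open>H i\<close> acts
      on it like the tensor of \<open>U i\<close> and Q.\<close>
    have "op_of \<Omega> (H i) (U i) = Q"
    proof
      fix y
      have "AE x in lebesgue_on \<Omega>. Q y * U i x + 1 * V i x y = H i x y"
        using Vi by (elim conjE AE_mp) (auto simp: tensor_def)
      then have "H1_inner \<Omega> (\<lambda>x. H i x y) (U i) = H1_inner \<Omega> (\<lambda>x. Q y * U i x + 1 * V i x y) (U i)"
        by (rule H1_inner_cong_AE)
      also have "\<dots> = Q y * H1_inner \<Omega> (U i) (U i) + 1 * H1_inner \<Omega> (\<lambda>x. V i x y) (U i)"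
        using Vi U(1)[OF i] H1W_slice by (intro H1_inner_lincomb_left) blast+
      also have "H1_inner \<Omega> (\<lambda>x. V i x y) (U i) = 0"
      proof -
        have "op_of \<Omega> (V i) (U i) = (\<lambda>_. 0)" using Vi by blast
        from fun_cong[OF this, of y] show ?thesis by (simp add: op_of_def)
      qed
      finally show "op_of \<Omega> (H i) (U i) y = Q y" using U(2)[OF i] by (simp add: op_of_def)
    qed
    then show ?thesis using H1W_inner_svd[OF H_in[OF i] svd] Q(2) by simp
  qed
  have feas_sum: "(\<Sum>i=1..N. H1W_inner \<Omega> (H i) (G i)) = (\<Sum>i=1..N. \<sigma> i)"
    if "feasible \<Omega> W q f N (Phi \<Omega> W q f ?F) G" for G
  proof -
    have "(\<Sum>i=1..N. H1W_inner \<Omega> (H i) (G i)) = data_inner \<Omega> N p (Phi \<Omega> W q f G)"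
      using that by (intro H_adj) (auto simp: feasible_def)
    also have "\<dots> = data_inner \<Omega> N p (Phi \<Omega> W q f ?F)"
      using that by (intro data_inner_cong) (auto simp: feasible_def)
    also have "\<dots> = (\<Sum>i=1..N. H1W_inner \<Omega> (H i) (?F i))"
      using F by (intro H_adj[symmetric]) auto
    finally show ?thesis using H_F by simp
  qed
  have feas_F: "feasible \<Omega> W q f N (Phi \<Omega> W q f ?F) ?F"
    using F by (simp add: feasible_def data_eq_def Phi_def)
  have min_F: "is_minimizer \<Omega> W q f N (Phi \<Omega> W q f ?F) ?F"
    unfolding is_minimizer_def
  proof (intro conjI allI impI feas_F)
    fix G assume G: "feasible \<Omega> W q f N (Phi \<Omega> W q f ?F) G"
    have "(\<Sum>i=1..N. nuclear_norm \<Omega> W (?F i)) = (\<Sum>i=1..N. H1W_inner \<Omega> (H i) (G i))"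
      using feas_sum[OF G] F_nn by simp
    also have "\<dots> \<le> (\<Sum>i=1..N. nuclear_norm \<Omega> W (G i))"
      using G cert(1) by (intro sum_mono) (auto simp: feasible_def)
    finally show "(\<Sum>i=1..N. nuclear_norm \<Omega> W (?F i)) \<le> (\<Sum>i=1..N. nuclear_norm \<Omega> W (G i))" .
  qed
  have unique: "AE x in lebesgue_on \<Omega>. G i x = ?F i x"
    if G_min: "is_minimizer \<Omega> W q f N (Phi \<Omega> W q f ?F) G" and i: "i \<in> {1..N}" for G i
  proof -
    have G_feas: "feasible \<Omega> W q f N (Phi \<Omega> W q f ?F) G" using G_min by (simp add: is_minimizer_def)
    then have G: "G j \<in> H1W \<Omega> W" if "j \<in> {1..N}" for j using that by (simp add: feasible_def)
    have "(\<Sum>j=1..N. nuclear_norm \<Omega> W (G j)) \<le> (\<Sum>j=1..N. nuclear_norm \<Omega> W (?F j))"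
      using G_min feas_F by (simp add: is_minimizer_def)
    also have "\<dots> = (\<Sum>j=1..N. H1W_inner \<Omega> (H j) (G j))"
      using feas_sum[OF G_feas] F_nn by simp
    \<comment> \<open>The summands are nonnegative by \<open>cert\<close>, so optimality forces
      equality in every component.\<close>
    finally have "(\<Sum>j=1..N. nuclear_norm \<Omega> W (G j) - H1W_inner \<Omega> (H j) (G j)) \<le> 0"
      by (simp add: sum_subtractf)
    moreover have nonneg: "0 \<le> nuclear_norm \<Omega> W (G j) - H1W_inner \<Omega> (H j) (G j)" if "j \<in> {1..N}" for j
      using cert(1)[OF that G[OF that]] by simp
    ultimately have "(\<Sum>j=1..N. nuclear_norm \<Omega> W (G j) - H1W_inner \<Omega> (H j) (G j)) = 0"
      by (intro antisym sum_nonneg) auto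
    then have "\<forall>j\<in>{1..N}. nuclear_norm \<Omega> W (G j) - H1W_inner \<Omega> (H j) (G j) = 0"
      using nonneg by (subst (asm) sum_nonneg_eq_0_iff) auto
    then have G_nn: "H1W_inner \<Omega> (H j) (G j) = nuclear_norm \<Omega> W (G j)" if "j \<in> {1..N}" for j
      using that by auto
    \<comment> \<open>Equality in the certificate leaves \<open>G j\<close> a multiple of the
      normalised tensor; dividing by \<open>\<sigma> j\<close> expresses it as a multiple of the
      true component.\<close>
    define \<tau> where "\<tau> j = nuclear_norm \<Omega> W (G j) / \<sigma> j" for j
    have G_F: "AE x in lebesgue_on \<Omega>. \<forall>y. G j x y = \<tau> j * ?F j x y" if "j \<in> {1..N}" for j
      using cert(2)[OF that G[OF that] G_nn[OF that]]
      by eventually_elim (use \<sigma>_pos[OF that] in \<open>simp add: decomp[OF that] \<tau>_def\<close>)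
    have H_G: "H1W_inner \<Omega> (H j) (G j) = \<tau> j * \<sigma> j" if "j \<in> {1..N}" for j
      using G_nn[OF that] \<sigma>_pos[OF that] by (simp add: \<tau>_def)
    define C where "C = {j \<in> {1..N}. \<tau> j = \<tau> i}"
    define GC where "GC j = (if j \<in> C then G j else (\<lambda>_ _. 0))" for j
    define FC where "FC j = (if j \<in> C then ?F j else (\<lambda>_ _. 0))" for j
    have in_H1W: "GC j \<in> H1W \<Omega> W" "FC j \<in> H1W \<Omega> W" if "j \<in> {1..N}" for j
      using that G F zero_in_H1W by (auto simp: GC_def FC_def)
    \<comment> \<open>\<open>traceW\<close> is a choice, so even the trace of the zero kernel is
      known only almost everywhere; it is read off as 0 times a rank-one kernel.\<close>
    have tr_G: "AE x in surface_measure \<Omega>. traceW \<Omega> W (G j) x = (\<lambda>y. \<tau> j * f j x * q y)"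
      and tr_F: "AE x in surface_measure \<Omega>. traceW \<Omega> W (?F j) x = (\<lambda>y. 1 * f j x * q y)"
      and tr_0: "AE x in surface_measure \<Omega>. traceW \<Omega> W (\<lambda>_ _. 0) x = (\<lambda>y. 0 * f j x * q y)"
      if j: "j \<in> {1..N}" for j
    proof -
      show "AE x in surface_measure \<Omega>. traceW \<Omega> W (G j) x = (\<lambda>y. \<tau> j * f j x * q y)"
        by (rule traceW_rank_one[OF trace[OF j] q G_F[OF j]])
      show "AE x in surface_measure \<Omega>. traceW \<Omega> W (?F j) x = (\<lambda>y. 1 * f j x * q y)"
        by (rule traceW_rank_one[OF trace[OF j] q]) simp
      show "AE x in surface_measure \<Omega>. traceW \<Omega> W (\<lambda>_ _. 0) x = (\<lambda>y. 0 * f j x * q y)"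
        by (rule traceW_rank_one[OF trace[OF j] q]) simp
    qed
    \<comment> \<open>Evaluating at one point where q does not vanish turns the W-valued boundary
      equation into a scalar one.\<close>
    obtain z where z: "q z \<noteq> 0" using q_pos by (force simp: L2_norm_def L2_inner_def)
    have third: "AE x in surface_measure \<Omega>.
        (\<lambda>y. f k x * traceW \<Omega> W (GC j) x y - f j x * traceW \<Omega> W (GC k) x y) =
        (\<lambda>y. f k x * traceW \<Omega> W (FC j) x y - f j x * traceW \<Omega> W (FC k) x y)"
      if jk: "(j, k) \<in> pairs N" for j k
    proof -
      have j: "j \<in> {1..N}" and k: "k \<in> {1..N}" using jk by (auto simp: pairs_def)
      have "AE x in surface_measure \<Omega>.
          (\<lambda>y. f k x * traceW \<Omega> W (G j) x y - f j x * traceW \<Omega> W (G k) x y) =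
          (\<lambda>y. f k x * traceW \<Omega> W (?F j) x y - f j x * traceW \<Omega> W (?F k) x y)"
        using G_feas jk by (auto simp: feasible_def data_eq_def Phi_def)
      with tr_G[OF j] tr_G[OF k] tr_F[OF j] tr_F[OF k] tr_0[OF j] tr_0[OF k]
      show ?thesis
      proof eventually_elim
        case (elim x)
        have "f k x * (\<tau> j * f j x * q z) - f j x * (\<tau> k * f k x * q z) =
            f k x * (1 * f j x * q z) - f j x * (1 * f k x * q z)"
          using fun_cong[OF elim(7), of z] unfolding elim(1-4) .
        \<comment> \<open>The contribution of the true solution on the right-hand side cancels by
          symmetry.\<close>
        then have "(\<tau> j - \<tau> k) * (f j x * f k x) * q z = 0" by (simp add: algebra_simps)
        then have "\<tau> j = \<tau> k \<or> f j x = 0 \<or> f k x = 0" using z by auto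
        \<comment> \<open>If both or neither of j, k belong to C, both sides vanish. If exactly one
          does, then \<tau> j \<noteq> \<tau> k, so the product of the two boundary values is
          0.\<close>
        then show ?case
          using elim(1-6) j k by (auto simp: GC_def FC_def C_def algebra_simps)
      qed
    qed
    have "data_eq \<Omega> N (Phi \<Omega> W q f GC) (Phi \<Omega> W q f FC)"
    proof -
      \<comment> \<open>Inside C this is feasibility of G; outside C both truncations are the same
        zero kernel, whatever \<open>vF\<close> is for it.\<close>
      have "\<forall>j\<in>{1..N}.
          (\<forall>g\<in>Hhalf \<Omega>. normal_derivative \<Omega> (vF \<Omega> (f j) (GC j)) g = normal_derivative \<Omega> (vF \<Omega> (f j) (FC j)) g) \<and>
          (AE x in lebesgue_on \<Omega>.
            (LINT y|lebesgue_on \<Omega>. GC j x y) - (LINT y|lebesgue_on \<Omega>. q y) * vF \<Omega> (f j) (GC j) x =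
            (LINT y|lebesgue_on \<Omega>. FC j x y) - (LINT y|lebesgue_on \<Omega>. q y) * vF \<Omega> (f j) (FC j) x)"
        using G_feas by (auto simp: feasible_def data_eq_def Phi_def GC_def FC_def)
      with third show ?thesis
        unfolding data_eq_def Phi_def prod.case by blast
    qed
    then have "(\<Sum>j=1..N. H1W_inner \<Omega> (H j) (GC j)) = (\<Sum>j=1..N. H1W_inner \<Omega> (H j) (FC j))"
      using H_adj[of GC] H_adj[of FC] in_H1W data_inner_cong by simp
    moreover have "(\<Sum>j=1..N. H1W_inner \<Omega> (H j) (GC j)) = (\<Sum>j\<in>C. \<tau> i * \<sigma> j)"
      by (rule sum.mono_neutral_cong_right)
        (use H_in H_G in \<open>auto simp: C_def GC_def H1W_inner_0_right\<close>)
    moreover have "(\<Sum>j=1..N. H1W_inner \<Omega> (H j) (FC j)) = (\<Sum>j\<in>C. \<sigma> j)"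
      by (rule sum.mono_neutral_cong_right)
        (use H_in H_F in \<open>auto simp: C_def FC_def H1W_inner_0_right\<close>)
    ultimately have "\<tau> i * (\<Sum>j\<in>C. \<sigma> j) = (\<Sum>j\<in>C. \<sigma> j)" by (simp add: sum_distrib_left)
    \<comment> \<open>C contains i, so the sum is positive and can be cancelled.\<close>
    moreover have "0 < (\<Sum>j\<in>C. \<sigma> j)"
      using i \<sigma>_pos by (intro sum_pos) (auto simp: C_def)
    ultimately have "\<tau> i = 1" by simp
    with G_F[OF i] show ?thesis by (auto elim!: AE_mp)
  qed
  have recovery: "q = (\<lambda>y. 1 / (LINT x|surface_measure \<Omega>. \<bar>f i x\<bar>\<^sup>2) *
         (LINT x|surface_measure \<Omega>. traceW \<Omega> W (?F i) x y * f i x))" if i: "i \<in> {1..N}" for i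
  proof
    fix y
    have "AE x in surface_measure \<Omega>. traceW \<Omega> W (?F i) x = (\<lambda>y. 1 * f i x * q y)"
      by (rule traceW_rank_one[OF trace[OF i] q]) simp
    then have "AE x in surface_measure \<Omega>. traceW \<Omega> W (?F i) x y * f i x = q y * \<bar>f i x\<bar>\<^sup>2"
      by eventually_elim (simp add: power2_eq_square)
    then have "(LINT x|surface_measure \<Omega>. traceW \<Omega> W (?F i) x y * f i x) =
        (LINT x|surface_measure \<Omega>. q y * \<bar>f i x\<bar>\<^sup>2)"
      by (rule surf.integral_cong_AE_complete)
    also have "\<dots> = q y * (LINT x|surface_measure \<Omega>. \<bar>f i x\<bar>\<^sup>2)"
      by (rule integral_mult_right_zero)
    finally show "q y = 1 / (LINT x|surface_measure \<Omega>. \<bar>f i x\<bar>\<^sup>2) *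
        (LINT x|surface_measure \<Omega>. traceW \<Omega> W (?F i) x y * f i x)"
      using orthonormal_basis_boundary_integral[OF basis _ trace[OF i]] i by simp
  qed
  show ?thesis
    unfolding is_unique_minimizer_def
    using min_F unique recovery decomp by (auto simp: \<sigma>_def U_def Q_def fun_eq_iff)
qed

end
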